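(* Let $0<\gamma<1$ and let $u_1\in\partial X_\gamma=\{u\in X:|u|=\gamma\}$. \begin{enumerate} \item Suppose $\gamma$ is not of the form $|\pi|^{\frac{1}{q^s+q^{s+1}}}$ for any integer $s\geq 0$, and let $n$ be the smallest non-negative integer with $\gamma^{q^n}<|\pi|^{\frac{1}{q+1}}$. Then the elements of $\Phi^{-1}(\Phi(u_1))\cap\partial X_\gamma$ can be ordered as $u_1,u_2,\dots,u_{q^n}$ such that \[|u_i-u_1|=\Big(\frac{|\pi|}{\gamma^{2q^{j-1}}}\Big)^{\frac{1}{q^{j}-q^{j-1}}}\] for all $1\leq j\leq n$ and $q^{j-1}<i\leq q^{j}$. \item Suppose $\gamma=|\pi|^{\frac{1}{q^s+q^{s+1}}}$ for some integer $s\geq 0$. Then the elements of $\Phi^{-1}(\Phi(u_1))\cap\partial X_\gamma$ can be ordered as $u_1,u_2,\dots,u_{q^s+q^{s+1}}$ such that \[|u_i-u_1|=\Big(\frac{|\pi|}{\gamma^{2q^{j-1}}}\Big)^{\frac{1}{q^{j}-q^{j-1}}}\] for $1\leq j\leq s$ and $q^{j-1}<i\leq q^{j}$, and $|u_i-u_1|=\gamma$ $\big(=(\frac{|\pi|}{\gamma^{2q^{s}}})^{\frac{1}{q^{s+1}-q^{s}}}\big)$ for $i>q^s$. \end{enumerate}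
   Context: Let $p$ be a prime, $K$ a finite extension of $\mathbb{Q}_p$ with ring of integers $A$, uniformizer $\pi$ and residue field $\mathbb{F}_q$. Let $\mathbb{C}_p$ be the completion of an algebraic closure of $\mathbb{Q}_p$, with absolute value $|\cdot|$, ring of integers $\mathfrak{o}_{\mathbb{C}_p}$ and maximal ideal $\mathfrak{m}_{\mathbb{C}_p}$. Let $\bar F$ be a formal $A$-module of height $2$ over $\mathbb{F}_q$ with $[\zeta]_{\bar F}(x)=\zeta x$ for all $(q-1)$-th roots of unity $\zeta$. Its Lubin–Tate deformation space is $\mathrm{Spf}\,A[[u]]$, and its $\mathbb{C}_p$-points form the open unit disc $X=\{u\in\mathbb{C}_p:|u|<1\}$. The universal deformation $F_u$ over $A[[u]]$ is the formal $A$-module whose logarithm $g_0(u,x)=\sum_{k\geq 0}m_k(u)x^{q^k}$ is determined by the functional equation $g_0(u,x)=x+\frac{u}{\pi}g_0(u^q,x^q)+\frac{1}{\pi}g_0(u^{q^2},x^{q^2})$; for $u_0\in X$, $F_{u_0}$ denotes its specialization at $u=u_0$. The Gross–Hopkins period map is $\Phi:X\to\mathbb{P}^1(\mathbb{C}_p)$, $\Phi(u)=[\phi_0(u):\phi_1(u)]$, where $\phi_0(u)=\lim_{k\to\infty}\pi^k m_{2k}(u)$ and $\phi_1(u)=\lim_{k\to\infty}\pi^k m_{2k-1}(u)$. For $\gamma>0$ write $\partial X_\gamma=\{u\in X:|u|=\gamma\}$. *)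

theory Defs
  imports "HOL-Analysis.Analysis" "HOL-Computational_Algebra.Computational_Algebra"
begin

section \<open>The field of p-adic complex numbers\<close>

text \<open>
  The library constant \<open>norm\<close> is reserved for real normed spaces, so the absolute value
  is a separate class operation; it induces the metric, hence the topology.
\<close>
class nonarch_field = field_char_0 + metric_space +
  fixes absv :: "'a \<Rightarrow> real"
  assumes dist_absv: "dist x y = absv (x - y)"
    and absv_mult: "absv (x * y) = absv x * absv y"
    and absv_add: "absv (x + y) \<le> max (absv x) (absv y)"

text \<open>
  In a complete field whose absolute value restricts to (a power of) the p-adic one on the
  rationals, the closure of the rationals is the completion of the rationals.
\<close>
definition Q_p :: "'c::nonarch_field set" where
  "Q_p = closure \<rat>"

definition Q_p_alg :: "'c::nonarch_field set" where
  "Q_p_alg = {x. \<exists>P. P \<noteq> 0 \<and> (\<forall>i. coeff P i \<in> Q_p) \<and> poly P x = 0}"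

text \<open>
  There is no p-adic field in the library, so the type \<open>'c\<close> is characterised as
  a completion of an algebraic closure of the p-adic numbers: it is complete and algebraically
  closed, and the elements algebraic over the p-adic numbers are dense.  By Ostrowski's theorem,
  \<open>absv p < 1\<close> determines the absolute value on the rationals up to a positive
  power; its normalisation is left open.
\<close>
definition p_adic_complex ::
    "'c::{nonarch_field, complete_space, alg_closed_field} itself \<Rightarrow> nat \<Rightarrow> bool" where
  "p_adic_complex _ p \<longleftrightarrow>
     prime p \<and> absv (of_nat p :: 'c) < 1 \<and> closure (Q_p_alg :: 'c set) = UNIV"

section \<open>Finite extensions of the p-adic numbers inside \<open>'c\<close>\<close>

definition finite_extension :: "'c::nonarch_field set \<Rightarrow> bool" where
  "finite_extension K \<longleftrightarrow>
     Q_p \<subseteq> K \<and>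
     (\<forall>x\<in>K. \<forall>y\<in>K. x + y \<in> K \<and> x * y \<in> K) \<and>
     (\<forall>x\<in>K. - x \<in> K \<and> inverse x \<in> K) \<and>
     (\<exists>B. finite B \<and> B \<subseteq> K \<and>
        (\<forall>x\<in>K. \<exists>c. (\<forall>b\<in>B. c b \<in> Q_p) \<and> x = (\<Sum>b\<in>B. c b * b)))"

definition int_ring :: "'c::nonarch_field set \<Rightarrow> 'c set" where
  "int_ring K = {x \<in> K. absv x \<le> 1}"

definition max_ideal :: "'c::nonarch_field set \<Rightarrow> 'c set" where
  "max_ideal K = {x \<in> K. absv x < 1}"

definition uniformizer :: "'c::nonarch_field set \<Rightarrow> 'c \<Rightarrow> bool" where
  "uniformizer K \<pi> \<longleftrightarrow> \<pi> \<in> K \<and> max_ideal K = (\<lambda>a. \<pi> * a) ` int_ring K"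

definition residue_field :: "'c::nonarch_field set \<Rightarrow> 'c set set" where
  "residue_field K =
     int_ring K // {(x, y). x \<in> int_ring K \<and> y \<in> int_ring K \<and> x - y \<in> max_ideal K}"

section \<open>The logarithm of the universal deformation\<close>

text \<open>
  Power series in \<open>x\<close> whose coefficients are polynomials in \<open>u\<close>;
  \<open>subst_powers r g\<close> is \<open>g(u^r, x^r)\<close>.
\<close>
definition subst_powers :: "nat \<Rightarrow> 'c::field poly fps \<Rightarrow> 'c poly fps" where
  "subst_powers r g = Abs_fps (\<lambda>n. pcompose (fps_nth g n) (monom 1 r)) oo (fps_X ^ r)"

definition is_universal_log :: "nat \<Rightarrow> 'c::field \<Rightarrow> 'c poly fps \<Rightarrow> bool" where
  "is_universal_log q \<pi> g \<longleftrightarrow>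
     (\<forall>n. fps_nth g n \<noteq> 0 \<longrightarrow> (\<exists>k. n = q ^ k)) \<and>
     g = fps_X + fps_const [:0, 1 / \<pi>:] * subst_powers q g
               + fps_const [:1 / \<pi>:] * subst_powers (q\<^sup>2) g"

definition universal_log :: "nat \<Rightarrow> 'c::field \<Rightarrow> 'c poly fps" where
  "universal_log q \<pi> = (THE g. is_universal_log q \<pi> g)"

definition log_coeff :: "nat \<Rightarrow> 'c::field \<Rightarrow> nat \<Rightarrow> 'c poly" where
  "log_coeff q \<pi> k = fps_nth (universal_log q \<pi>) (q ^ k)"

lemma subst_powers_nth:
  assumes "r > 0"
  shows "fps_nth (subst_powers r g) n =
    (if r dvd n then pcompose (fps_nth g (n div r)) (monom 1 r) else 0)"
  using assms by (simp add: subst_powers_def fps_nth_compose_X_power)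

lemma is_universal_log_nth:
  assumes "q > 0" "is_universal_log q \<pi> g"
  shows "fps_nth g n = (if n = 1 then 1 else 0)
    + [:0, 1 / \<pi>:] * (if q dvd n then pcompose (fps_nth g (n div q)) (monom 1 q) else 0)
    + [:1 / \<pi>:] * (if q\<^sup>2 dvd n then pcompose (fps_nth g (n div q\<^sup>2)) (monom 1 (q\<^sup>2)) else 0)"
proof -
  have "g = fps_X + fps_const [:0, 1 / \<pi>:] * subst_powers q g
               + fps_const [:1 / \<pi>:] * subst_powers (q\<^sup>2) g"
    using assms(2) by (simp add: is_universal_log_def)
  then have "fps_nth g n = fps_nth (fps_X + fps_const [:0, 1 / \<pi>:] * subst_powers q g
               + fps_const [:1 / \<pi>:] * subst_powers (q\<^sup>2) g) n"
    by (rule arg_cong)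
  then show ?thesis
    using assms(1) by (simp only: fps_add_nth fps_mult_left_const_nth fps_X_nth subst_powers_nth
        zero_less_power)
qed

lemma is_universal_log_unique:
  assumes q: "q > 1" and g: "is_universal_log q \<pi> g" and h: "is_universal_log q \<pi> h"
  shows "g = h"
proof (rule fps_ext)
  fix n show "fps_nth g n = fps_nth h n"
  proof (induction n rule: less_induct)
    case (less n)
    show ?case
    proof (cases "n = 0")
      case True
      have "\<not> (\<exists>k. 0 = q ^ k)" using q by simp
      then show ?thesis using g h True unfolding is_universal_log_def by metis
    next
      case False
      have "1 < q\<^sup>2" using q by (intro one_less_power) auto
      then have "n div q < n" "n div q\<^sup>2 < n"
        using q False by (simp_all add: div_less_dividend)
      then have "fps_nth g (n div q) = fps_nth h (n div q)"
        "fps_nth g (n div q\<^sup>2) = fps_nth h (n div q\<^sup>2)"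
        using less by blast+
      then show ?thesis
        using is_universal_log_nth[OF _ g, of n] is_universal_log_nth[OF _ h, of n] q by simp
    qed
  qed
qed

fun log_rec :: "nat \<Rightarrow> 'c::field \<Rightarrow> nat \<Rightarrow> 'c poly" where
  "log_rec q \<pi> 0 = 1"
| "log_rec q \<pi> (Suc 0) = [:0, 1 / \<pi>:]"
| "log_rec q \<pi> (Suc (Suc k)) = [:0, 1 / \<pi>:] * pcompose (log_rec q \<pi> (Suc k)) (monom 1 q)
      + [:1 / \<pi>:] * pcompose (log_rec q \<pi> k) (monom 1 (q\<^sup>2))"

lemma is_universal_log_exists:
  fixes \<pi> :: "'c::field"
  assumes q: "q > 1"
  shows "\<exists>g. is_universal_log q \<pi> g \<and> (\<forall>k. fps_nth g (q ^ k) = log_rec q \<pi> k)"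
proof -
  define g where "g = Abs_fps (\<lambda>n. if \<exists>k. n = q ^ k then log_rec q \<pi> (THE k. n = q ^ k) else 0)"
  have gk: "fps_nth g (q ^ k) = log_rec q \<pi> k" for k
    using q by (auto simp: g_def)
  have g0: "fps_nth g n = 0" if "\<not> (\<exists>k. n = q ^ k)" for n
    using that by (simp add: g_def)
  have eq: "fps_nth g n = (if n = 1 then 1 else 0)
    + [:0, 1 / \<pi>:] * (if q dvd n then pcompose (fps_nth g (n div q)) (monom 1 q) else 0)
    + [:1 / \<pi>:] * (if q\<^sup>2 dvd n then pcompose (fps_nth g (n div q\<^sup>2)) (monom 1 (q\<^sup>2)) else 0)" for n
  proof (cases "\<exists>k. n = q ^ k")
    case True
    then obtain k where k: "n = q ^ k" by blast
    show ?thesis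
    proof -
      consider "k = 0" | "k = 1" | j where "k = Suc (Suc j)"
        by (metis One_nat_def old.nat.exhaust)
      then show ?thesis
      proof cases
        case 1
        have "fps_nth g 1 = 1" using gk[of 0] by simp
        then show ?thesis using q k 1 by simp
      next
        case 2
        have "\<not> q\<^sup>2 dvd q" using q by (auto dest!: dvd_imp_le simp: power2_eq_square)
        moreover have "fps_nth g 1 = 1" using gk[of 0] by simp
        ultimately show ?thesis using q k 2 gk[of 1] by (simp add: one_pCons pcompose_pCons)
      next
        case (3 j)
        then have n: "n = q ^ (Suc (Suc j))" using k by simp
        have "n div q = q ^ Suc j" "n div q\<^sup>2 = q ^ j" "q dvd n" "q\<^sup>2 dvd n" "n \<noteq> 1"
          using q by (simp_all add: n power2_eq_square)
        then show ?thesis using gk[of "Suc j"] gk[of j] gk[of "Suc (Suc j)"] by (simp add: n)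
      qed
    qed
  next
    case False
    have "n \<noteq> 1" using False by (metis power_0)
    moreover have "fps_nth g (n div q) = 0" if "q dvd n"
      using that False by (intro g0) (metis dvd_mult_div_cancel power_Suc)
    moreover have "fps_nth g (n div q\<^sup>2) = 0" if "q\<^sup>2 dvd n"
      using that False by (intro g0) (metis dvd_mult_div_cancel power_add)
    ultimately show ?thesis using g0[OF False] by simp
  qed
  have "g = fps_X + fps_const [:0, 1 / \<pi>:] * subst_powers q g
               + fps_const [:1 / \<pi>:] * subst_powers (q\<^sup>2) g"
  proof (rule fps_ext)
    fix n
    show "fps_nth g n = fps_nth (fps_X + fps_const [:0, 1 / \<pi>:] * subst_powers q g
               + fps_const [:1 / \<pi>:] * subst_powers (q\<^sup>2) g) n"
      using eq[of n] q
      by (simp only: fps_add_nth fps_mult_left_const_nth fps_X_nth subst_powers_nth zero_less_power)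
  qed
  then show ?thesis using gk g0 unfolding is_universal_log_def by blast
qed

lemma is_universal_log_universal_log:
  assumes "q > 1"
  shows "is_universal_log q \<pi> (universal_log q \<pi>)"
  unfolding universal_log_def
  using is_universal_log_exists[OF assms, of \<pi>] is_universal_log_unique[OF assms]
  by (intro theI'[of "is_universal_log q \<pi>"]) blast

lemma log_coeff_eq_log_rec:
  assumes "q > 1"
  shows "log_coeff q \<pi> k = log_rec q \<pi> k"
  using is_universal_log_exists[OF assms, of \<pi>] is_universal_log_universal_log[OF assms, of \<pi>]
    is_universal_log_unique[OF assms] unfolding log_coeff_def by metis

section \<open>The Gross--Hopkins period map\<close>

definition phi0 :: "nat \<Rightarrow> 'c::nonarch_field \<Rightarrow> 'c \<Rightarrow> 'c" where
  "phi0 q \<pi> u = lim (\<lambda>k. \<pi> ^ k * poly (log_coeff q \<pi> (2 * k)) u)"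

text \<open>For \<open>k = 0\<close> the truncated index is \<open>0\<close>, which does not affect the limit.\<close>
definition phi1 :: "nat \<Rightarrow> 'c::nonarch_field \<Rightarrow> 'c \<Rightarrow> 'c" where
  "phi1 q \<pi> u = lim (\<lambda>k. \<pi> ^ k * poly (log_coeff q \<pi> (2 * k - 1)) u)"

definition proj_rel :: "(('c::field \<times> 'c) \<times> ('c \<times> 'c)) set" where
  "proj_rel = {((a, b), (a', b')). (a, b) \<noteq> (0, 0) \<and> (a', b') \<noteq> (0, 0) \<and>
                 (\<exists>c. c \<noteq> 0 \<and> a' = c * a \<and> b' = c * b)}"

text \<open>\<open>proj_point a b\<close> is \<open>[a : b]\<close>, an element of
  \<open>(UNIV - {(0, 0)}) // proj_rel\<close> unless \<open>a = b = 0\<close>.\<close>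
definition proj_point :: "'c::field \<Rightarrow> 'c \<Rightarrow> ('c \<times> 'c) set" where
  "proj_point a b = proj_rel `` {(a, b)}"

definition period_map :: "nat \<Rightarrow> 'c::nonarch_field \<Rightarrow> 'c \<Rightarrow> ('c \<times> 'c) set" where
  "period_map q \<pi> u = proj_point (phi0 q \<pi> u) (phi1 q \<pi> u)"

definition open_disc :: "'c::nonarch_field set" where
  "open_disc = {u. absv u < 1}"

definition disc_sphere :: "real \<Rightarrow> 'c::nonarch_field set" where
  "disc_sphere \<gamma> = {u \<in> open_disc. absv u = \<gamma>}"

definition period_fibre :: "nat \<Rightarrow> 'c::nonarch_field \<Rightarrow> 'c \<Rightarrow> 'c set" where
  "period_fibre q \<pi> u\<^sub>1 = {u \<in> open_disc. period_map q \<pi> u = period_map q \<pi> u\<^sub>1}"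

end

theory Submission
  imports Defs
begin

text \<open>
  Removing the outermost factor of the continuants \<open>m k\<close> (the coefficients of the logarithm) gives
  the two-term recursion \<open>\<pi> * m (k + 2) u = u ^ q ^ (k + 1) * m (k + 1) u + m k u\<close>, and this turns
  the determinant of the approximate periods of \<open>u\<close> and \<open>v\<close> into the sum of the terms
  \<open>(-\<pi>) ^ j * m j u * m j v * (u ^ q ^ j - v ^ q ^ j)\<close>.  On a sphere \<open>absv u = absv v = g\<close> all
  these terms have known size, and unless \<open>absv (u - v)\<close> is one of the critical radii of the theorem,
  a single one of them dominates.  For a polynomial over an algebraically closed field, the exponent with
  which its absolute value grows on an annulus is the number of roots inside; so the growth
  \<open>absv (u - v) ^ q ^ j\<close> between consecutive critical radii yields the number of roots at
  each distance from \<open>v\<close>.  In the boundary case the roots at distance \<open>g\<close> are counted in the same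
  way from the growth around the origin.  The Pluecker relation between three points of the sphere shows
  that every root is simple and moves by a quickly decreasing amount from one approximation to the next,
  so that the count passes to the limit.
\<close>

section \<open>Non-archimedean absolute values\<close>

text \<open>The critical radii are the distances t at which two consecutive terms of the determinant
  balance. As long as \<open>(u - v) ^ q ^ j\<close> governs \<open>u ^ q ^ j - v ^ q ^ j\<close>,
  term j has size g ^ (2 * (1 + q + ... + q ^ (j - 1))) / absv \<pi> ^ j * t ^ q ^ j, and equating
  terms j - 1 and j gives t ^ (q ^ j - q ^ (j - 1)) = absv \<pi> / g ^ (2 * q ^ (j - 1)). There are
  finitely many such radii below g because the continuants follow their top monomial only up to a
  certain index; afterwards they repeat with period two up to powers of \<pi>, and this index is the
  n or s of the theorem. If g is itself exceptional, the critical radius of index s + 1 equals g and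
  two terms balance at distance g from v, so no growth around v can be read off there; this forces
  the second count, around the origin. Roots are counted for the approximations because these are
  polynomials and split into linear factors. The prime p and the field K matter only through two
  facts: q is a power of p, and absv p is at most absv \<pi>. Together they make the q-th power
  additive up to an error controlled by absv \<pi>.\<close>

lemma absv_zero [simp]: "absv (0::'a::nonarch_field) = 0"
  using dist_absv[of 0 "0::'a"] by simp

lemma absv_nonneg [simp]: "0 \<le> absv (x::'a::nonarch_field)"
  using dist_absv[of x 0] zero_le_dist[of x 0] by simp

lemma absv_eq_0_iff [simp]: "absv (x::'a::nonarch_field) = 0 \<longleftrightarrow> x = 0"
  using dist_absv[of x 0] dist_eq_0_iff[of x 0] by simp

lemma absv_pos_iff [simp]: "0 < absv (x::'a::nonarch_field) \<longleftrightarrow> x \<noteq> 0"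
  using absv_nonneg[of x] absv_eq_0_iff[of x] by linarith

lemma absv_le_0_iff [simp]: "absv (x::'a::nonarch_field) \<le> 0 \<longleftrightarrow> x = 0"
  using absv_nonneg[of x] absv_eq_0_iff[of x] by linarith

lemma absv_one [simp]: "absv (1::'a::nonarch_field) = 1"
  using absv_mult[of 1 "1::'a"] by (metis absv_eq_0_iff mult_cancel_right2 mult_1 zero_neq_one)

lemma absv_minus [simp]: "absv (- x :: 'a::nonarch_field) = absv x"
proof -
  have "absv (-1::'a) * absv (-1::'a) = 1"
    using absv_mult[of "-1::'a" "-1"] by simp
  then have "absv (-1::'a) = 1"
    using absv_nonneg[of "-1::'a"] by (metis abs_of_nonneg real_sqrt_abs2 real_sqrt_one)
  then show ?thesis using absv_mult[of "-1" x] by simp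
qed

lemma absv_diff_commute: "absv (x - y :: 'a::nonarch_field) = absv (y - x)"
  using absv_minus[of "x - y"] by simp

lemma absv_diff_le: "absv (x - y :: 'a::nonarch_field) \<le> max (absv x) (absv y)"
  using absv_add[of x "-y"] by simp

lemma absv_power [simp]: "absv (x ^ n :: 'a::nonarch_field) = absv x ^ n"
  by (induction n) (auto simp: absv_mult)

lemma absv_inverse [simp]: "absv (inverse x :: 'a::nonarch_field) = inverse (absv x)"
proof (cases "x = 0")
  case False
  then have "absv x * absv (inverse x) = 1"
    using absv_mult[of x "inverse x"] by simp
  then show ?thesis by (metis inverse_unique)
qed simp

lemma absv_divide [simp]: "absv (x / y :: 'a::nonarch_field) = absv x / absv y"
  by (simp add: divide_inverse absv_mult)

lemma absv_of_nat_le_1: "absv (of_nat n :: 'a::nonarch_field) \<le> 1"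
proof (induction n)
  case (Suc n)
  then show ?case using absv_add[of 1 "of_nat n :: 'a"] by simp
qed simp

lemma absv_of_int_le_1: "absv (of_int n :: 'a::nonarch_field) \<le> 1"
  by (cases n rule: int_cases2) (auto simp: absv_of_nat_le_1)

lemma absv_add_eq_left:
  assumes "absv y < absv (x::'a::nonarch_field)"
  shows "absv (x + y) = absv x"
proof (rule antisym)
  show "absv (x + y) \<le> absv x" using absv_add[of x y] assms by simp
  show "absv x \<le> absv (x + y)" using absv_diff_le[of "x + y" y] assms by simp
qed

lemma absv_add_eq_right:
  assumes "absv x < absv (y::'a::nonarch_field)"
  shows "absv (x + y) = absv y"
  using absv_add_eq_left[OF assms] by (simp add: add.commute)

lemma absv_sum_le:
  assumes "0 \<le> B" "\<And>i. i \<in> A \<Longrightarrow> absv (f i :: 'a::nonarch_field) \<le> B"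
  shows "absv (sum f A) \<le> B"
  using assms(2)
proof (induction A rule: infinite_finite_induct)
  case (insert i A)
  then have "absv (f i) \<le> B" "absv (sum f A) \<le> B" by auto
  then show ?case using absv_add[of "f i" "sum f A"] insert.hyps by simp
qed (use assms(1) in auto)

lemma absv_sum_less:
  assumes "0 < B" "\<And>i. i \<in> A \<Longrightarrow> absv (f i :: 'a::nonarch_field) < B"
  shows "absv (sum f A) < B"
  using assms(2)
proof (induction A rule: infinite_finite_induct)
  case (insert i A)
  then have "absv (f i) < B" "absv (sum f A) < B" by auto
  then show ?case using absv_add[of "f i" "sum f A"] insert.hyps by simp
qed (use assms(1) in auto)

lemma absv_sum_dominant:
  assumes "finite A" "a \<in> A" "f a \<noteq> 0"
    and "\<And>i. i \<in> A - {a} \<Longrightarrow> absv (f i) < absv (f a :: 'a::nonarch_field)"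
  shows "absv (sum f A) = absv (f a)"
proof -
  have "absv (sum f (A - {a})) < absv (f a)"
    using assms by (intro absv_sum_less) auto
  then show ?thesis by (simp add: sum.remove[OF assms(1,2)] absv_add_eq_left)
qed

lemma absv_prod_mset: "absv (\<Prod>x\<in>#A. f x :: 'a::nonarch_field) = (\<Prod>x\<in>#A. absv (f x))"
  by (induction A) (auto simp: absv_mult)

section \<open>Limits in the ultrametric topology\<close>

lemma tendsto_absv_iff:
  "(X \<longlonglongrightarrow> (l::'a::nonarch_field)) \<longleftrightarrow> (\<lambda>n. absv (X n - l)) \<longlonglongrightarrow> 0"
  by (subst tendsto_dist_iff) (simp add: dist_absv)

lemma tendsto_absvI:
  assumes "e \<longlonglongrightarrow> 0" "\<And>n. absv (X n - (l::'a::nonarch_field)) \<le> e n"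
  shows "X \<longlonglongrightarrow> l"
  unfolding tendsto_absv_iff
  by (rule tendsto_sandwich[OF _ _ tendsto_const assms(1)])
    (simp_all add: assms(2) always_eventually)

lemma tendsto_absv:
  assumes "X \<longlonglongrightarrow> (l::'a::nonarch_field)"
  shows "(\<lambda>n. absv (X n)) \<longlonglongrightarrow> absv l"
  using tendsto_dist[OF assms tendsto_const[of 0]] by (simp add: dist_absv)

lemma tendsto_mult_nonarch:
  assumes X: "X \<longlonglongrightarrow> (a::'a::nonarch_field)" and Y: "Y \<longlonglongrightarrow> b"
  shows "(\<lambda>n. X n * Y n) \<longlonglongrightarrow> a * b"
proof -
  have "(\<lambda>n. absv (X n - a) * absv (Y n) + absv a * absv (Y n - b)) \<longlonglongrightarrow> 0 * absv b + absv a * 0"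
    by (intro tendsto_intros tendsto_absv[OF Y] X[unfolded tendsto_absv_iff] Y[unfolded tendsto_absv_iff])
  moreover have "absv (X n * Y n - a * b) \<le> absv (X n - a) * absv (Y n) + absv a * absv (Y n - b)" for n
  proof -
    have "X n * Y n - a * b = (X n - a) * Y n + a * (Y n - b)" by (simp add: algebra_simps)
    then have "absv (X n * Y n - a * b) \<le> max (absv ((X n - a) * Y n)) (absv (a * (Y n - b)))"
      using absv_add by metis
    also have "\<dots> \<le> absv ((X n - a) * Y n) + absv (a * (Y n - b))"
      by (simp add: max_def)
    finally show ?thesis by (simp add: absv_mult)
  qed
  ultimately show ?thesis
    by (intro tendsto_absvI) simp_all
qed

lemma tendsto_add_nonarch:
  assumes X: "X \<longlonglongrightarrow> (a::'a::nonarch_field)" and Y: "Y \<longlonglongrightarrow> b"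
  shows "(\<lambda>n. X n + Y n) \<longlonglongrightarrow> a + b"
proof -
  have "(\<lambda>n. absv (X n - a) + absv (Y n - b)) \<longlonglongrightarrow> 0 + 0"
    by (intro tendsto_intros X[unfolded tendsto_absv_iff] Y[unfolded tendsto_absv_iff])
  moreover have "absv (X n + Y n - (a + b)) \<le> absv (X n - a) + absv (Y n - b)" for n
  proof -
    have "absv ((X n - a) + (Y n - b)) \<le> max (absv (X n - a)) (absv (Y n - b))"
      by (rule absv_add)
    also have "\<dots> \<le> absv (X n - a) + absv (Y n - b)" by (simp add: max_def)
    finally show ?thesis by (simp add: algebra_simps)
  qed
  ultimately show ?thesis
    by (intro tendsto_absvI) simp_all
qed

lemma tendsto_minus_nonarch:
  "X \<longlonglongrightarrow> (a::'a::nonarch_field) \<Longrightarrow> (\<lambda>n. - X n) \<longlonglongrightarrow> - a"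
  using tendsto_mult_nonarch[OF tendsto_const[of "-1"], of X a] by simp

lemma nonarch_convergent:
  fixes X :: "nat \<Rightarrow> 'a::{nonarch_field, complete_space}"
  assumes "e \<longlonglongrightarrow> 0" "\<And>n. N \<le> n \<Longrightarrow> absv (X (Suc n) - X n) \<le> e n" "decseq e"
  obtains l where "X \<longlonglongrightarrow> l" "\<And>n. N \<le> n \<Longrightarrow> absv (l - X n) \<le> e n"
proof -
  have step: "absv (X (n + k) - X n) \<le> e n" if "N \<le> n" for n k
  proof (induction k)
    case 0
    have "0 \<le> e n" using assms(2)[OF that] absv_nonneg[of "X (Suc n) - X n"] by linarith
    then show ?case by simp
  next
    case (Suc k)
    have "absv (X (Suc (n + k)) - X (n + k)) \<le> e (n + k)" using assms(2) that by simp
    also have "\<dots> \<le> e n" using assms(3) by (simp add: decseqD)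
    finally have "absv ((X (Suc (n + k)) - X (n + k)) + (X (n + k) - X n)) \<le> e n"
      using Suc absv_add[of "X (Suc (n + k)) - X (n + k)" "X (n + k) - X n"] by linarith
    then show ?case by simp
  qed
  have "Cauchy X"
  proof (rule metric_CauchyI)
    fix r :: real assume "0 < r"
    then obtain M where M: "\<And>n. M \<le> n \<Longrightarrow> e n < r"
      using assms(1) by (metis (no_types, lifting) order_tendstoD(2) eventually_sequentially)
    define L where "L = max M N"
    have L: "dist (X n) (X L) < r" if "L \<le> n" for n
      using step[of L "n - L"] M[of L] that by (auto simp: dist_absv L_def)
    have "dist (X m) (X n) < r" if "L \<le> m" "L \<le> n" for m n
    proof -
      have "absv (X m - X n) \<le> max (absv (X m - X L)) (absv (X n - X L))"
        using absv_diff_le[of "X m - X L" "X n - X L"] by simp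
      then show ?thesis using L[OF that(1)] L[OF that(2)] by (simp add: dist_absv)
    qed
    then show "\<exists>M. \<forall>m\<ge>M. \<forall>n\<ge>M. dist (X m) (X n) < r" by blast
  qed
  then obtain l where l: "X \<longlonglongrightarrow> l" using Cauchy_convergent convergent_def by blast
  have "absv (l - X n) \<le> e n" if "N \<le> n" for n
  proof -
    have "(\<lambda>k. X (n + k)) \<longlonglongrightarrow> l"
      using LIMSEQ_ignore_initial_segment[OF l, of n] by (simp add: add.commute)
    from tendsto_absv[OF tendsto_add_nonarch[OF this tendsto_const[of "- X n"]]]
    have "(\<lambda>k. absv (X (n + k) - X n)) \<longlonglongrightarrow> absv (l - X n)" by simp
    then show ?thesis using step[OF that] by (intro LIMSEQ_le_const2) auto
  qed
  with l show thesis by (rule that)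
qed

section \<open>Counting roots by the growth of a polynomial\<close>

text \<open>A root of \<open>z\<close> of high order has absolute value close to 1, and the powers
  of such a root form a geometric progression too fine to jump over the interval.\<close>

lemma absv_dense:
  fixes z :: "'a::{nonarch_field, alg_closed_field}"
  assumes z: "z \<noteq> 0" "absv z < 1" and "0 \<le> a" "a < b"
  obtains x :: 'a where "a < absv x" "absv x < b"
proof -
  \<comment> \<open>The midpoint stays positive even for \<open>a = 0\<close>, so it is enough that
    the progression has a ratio above \<open>c / b\<close>.\<close>
  define c where "c = (a + b) / 2"
  have c: "a < c" "0 < c" "c < b" using assms by (auto simp: c_def)
  have "(\<lambda>n. root n (absv z)) \<longlonglongrightarrow> 1" using z by (intro LIMSEQ_root_const) simp
  then have "eventually (\<lambda>n. c / b < root n (absv z)) sequentially"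
    using c by (intro order_tendstoD(1)) (auto simp: field_simps)
  then have "eventually (\<lambda>n. c / b < root n (absv z) \<and> 0 < n) sequentially"
    using eventually_gt_at_top by (rule eventually_conj)
  then obtain n where n: "c / b < root n (absv z)" "0 < n"
    by (auto simp: eventually_sequentially)
  obtain y where y: "y ^ n = z" using nth_root_exists[OF n(2)] by blast
  have ay: "absv y = root n (absv z)"
    using y n(2) absv_power[of y n] by (metis absv_nonneg real_root_power_cancel)
  have y1: "0 < absv y" "absv y < 1" "c / b < absv y"
    using z n by (auto simp: ay)
  \<comment> \<open>The progression starts at a value above \<open>b\<close>; \<open>k\<close> below
    is the first exponent that brings it under \<open>b\<close>.\<close>
  obtain k0 where k0: "inverse (absv y) ^ k0 > b"
    using y1 real_arch_pow[of "inverse (absv y)" b] by (auto simp: one_less_inverse)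
  define w where "w = inverse y ^ k0"
  have w: "absv w > b" using k0 by (simp add: w_def)
  obtain k1 where k1: "absv y ^ k1 < b / absv w"
    using y1(2) real_arch_pow_inv[of "b / absv w" "absv y"] c w by (metis divide_pos_pos less_trans)
  define k where "k = (LEAST k. absv w * absv y ^ k < b)"
  have ex: "absv w * absv y ^ k1 < b"
    using k1 c w pos_less_divide_eq[of "absv w" "absv y ^ k1" b]
    by (metis less_trans mult.commute)
  have k: "absv w * absv y ^ k < b" unfolding k_def using ex by (rule LeastI)
  have "k \<noteq> 0" using k w by (metis less_asym mult.right_neutral power_0)
  then have "\<not> absv w * absv y ^ (k - 1) < b"
    using not_less_Least[of "k - 1" "\<lambda>k. absv w * absv y ^ k < b", folded k_def] by simp
  then have "b * absv y \<le> absv w * absv y ^ (k - 1) * absv y" using y1 by simp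
  also have "\<dots> = absv w * absv y ^ k" using \<open>k \<noteq> 0\<close> by (cases k) (simp_all add: mult_ac)
  finally have "c < absv w * absv y ^ k"
    using y1(3) c by (simp add: pos_divide_less_eq mult.commute)
  then show thesis using that[of "w * y ^ k"] k c by (simp add: absv_mult)
qed

lemma poly_root_mset:
  fixes P :: "'a::alg_closed_field poly"
  assumes "P \<noteq> 0"
  obtains A where "\<And>x. poly P x = lead_coeff P * (\<Prod>z\<in>#A. x - z)"
proof -
  obtain A where "P = smult (lead_coeff P) (\<Prod>x\<in>#A. [:-x, 1:])"
    using alg_closed_imp_factorization[OF assms] by blast
  then have "poly P x = lead_coeff P * poly (\<Prod>x\<in>#A. [:-x, 1:]) x" for x
    by (metis poly_smult)
  moreover have "poly (\<Prod>x\<in>#A. [:-x, 1:]) x = (\<Prod>z\<in>#A. x - z)" for x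
    by (induction A) (auto simp: algebra_simps)
  ultimately show thesis using that by metis
qed

text \<open>Positivity of \<open>C\<close> keeps roots out of the annulus. A root inside contributes
  the factor \<open>absv (x - c)\<close> and a root outside a constant, so the number of inner roots
  is the exponent of growth.\<close>

lemma root_count_annulus:
  fixes A :: "'a::{nonarch_field, alg_closed_field} multiset"
  assumes z0: "z\<^sub>0 \<noteq> (0::'a)" "absv z\<^sub>0 < 1" and r: "0 \<le> r\<^sub>1" "r\<^sub>1 < r\<^sub>2" and "0 < C" "a \<noteq> 0"
    and mag: "\<And>x. r\<^sub>1 < absv (x - c) \<Longrightarrow> absv (x - c) < r\<^sub>2 \<Longrightarrow>
      absv (a * (\<Prod>z\<in>#A. x - z)) = C * absv (x - c) ^ m"
  shows "size (filter_mset (\<lambda>z. absv (z - c) \<le> r\<^sub>1) A) = m"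
proof -
  have noroot: "\<not> (r\<^sub>1 < absv (z - c) \<and> absv (z - c) < r\<^sub>2)" if "z \<in># A" for z
  proof
    assume h: "r\<^sub>1 < absv (z - c) \<and> absv (z - c) < r\<^sub>2"
    have "(\<Prod>x\<in>#A. z - x) = 0"
      using that by (metis (no_types, lifting) cancel_comm_monoid_add_class.diff_cancel image_eqI
          prod_mset_zero_iff set_image_mset)
    then have "C * absv (z - c) ^ m = 0" using mag[of z] h by (metis absv_zero mult_zero_right)
    moreover have "0 < C * absv (z - c) ^ m" using \<open>0 < C\<close> h r by (intro mult_pos_pos zero_less_power) auto
    ultimately show False by linarith
  qed
  define B where "B = filter_mset (\<lambda>z. absv (z - c) \<le> r\<^sub>1) A"
  define D where "D = filter_mset (\<lambda>z. \<not> absv (z - c) \<le> r\<^sub>1) A"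
  define C' where "C' = absv a * (\<Prod>z\<in>#D. absv (z - c))"
  have A: "A = B + D" by (simp add: B_def D_def)
  have eq: "C' * absv (x - c) ^ size B = C * absv (x - c) ^ m"
    if x: "r\<^sub>1 < absv (x - c)" "absv (x - c) < r\<^sub>2" for x
  proof -
    have "(\<Prod>z\<in>#B. absv (x - z)) = (\<Prod>z\<in>#B. absv (x - c))"
    proof (intro arg_cong[of _ _ prod_mset] image_mset_cong)
      fix z assume "z \<in># B"
      then have "absv (- (z - c)) < absv (x - c)" using x by (simp add: B_def absv_diff_commute)
      from absv_add_eq_left[OF this] show "absv (x - z) = absv (x - c)" by simp
    qed
    moreover have "(\<Prod>z\<in>#D. absv (x - z)) = (\<Prod>z\<in>#D. absv (z - c))"
    proof (intro arg_cong[of _ _ prod_mset] image_mset_cong)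
      fix z assume "z \<in># D"
      then have "absv (x - c) < absv (- (z - c))" using x noroot[of z]
        unfolding absv_minus by (auto simp: D_def)
      from absv_add_eq_right[OF this] show "absv (x - z) = absv (z - c)" by (simp add: absv_diff_commute)
    qed
    ultimately have "absv (a * (\<Prod>z\<in>#A. x - z)) = C' * absv (x - c) ^ size B"
      by (simp add: A C'_def absv_mult absv_prod_mset mult_ac)
    with mag[OF x] show ?thesis by simp
  qed
  \<comment> \<open>The constants \<open>C\<close> and \<open>C'\<close> are not known to agree;
    comparing two different radii eliminates them.\<close>
  obtain y1 :: 'a where y1: "r\<^sub>1 < absv y1" "absv y1 < r\<^sub>2" using absv_dense[OF z0 r] .
  obtain y2 :: 'a where y2: "absv y1 < absv y2" "absv y2 < r\<^sub>2"
    using absv_dense[OF z0 absv_nonneg y1(2)] .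
  define s1 s2 where "s1 = absv y1" and "s2 = absv y2"
  have s: "0 < s1" "s1 < s2" using y1 y2 r by (auto simp: s1_def s2_def)
  have e1: "C' * s1 ^ size B = C * s1 ^ m" and e2: "C' * s2 ^ size B = C * s2 ^ m"
    using eq[of "c + y1"] eq[of "c + y2"] y1 y2 by (auto simp: s1_def s2_def)
  have "C' > 0"
  proof -
    have "0 < C * s1 ^ m" using s \<open>0 < C\<close> by simp
    then show ?thesis using e1 s by (metis zero_less_mult_pos2 zero_less_power)
  qed
  have pow: "(s2 / s1) ^ size B = (s2 / s1) ^ m"
  proof -
    have "C' * s2 ^ size B * (C * s1 ^ m) = C * s2 ^ m * (C' * s1 ^ size B)"
      by (simp only: e1 e2)
    then have "s2 ^ size B * s1 ^ m = s2 ^ m * s1 ^ size B"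
      using \<open>C' > 0\<close> \<open>0 < C\<close> by simp
    then show ?thesis using s by (simp add: power_divide field_simps)
  qed
  have "1 < s2 / s1" using s by simp
  then show ?thesis using pow power_inject_exp[of "s2/s1"] by (simp add: B_def)
qed

section \<open>The cardinality of the residue field\<close>

text \<open>If \<open>p\<close> does not divide \<open>n\<close>, Bezout writes 1 as an integral
  combination of \<open>p\<close> and \<open>n\<close>; were both small, 1 would be small
  too.\<close>

lemma absv_of_int_less_1_iff:
  assumes p: "prime p" "absv (of_nat p :: 'a::nonarch_field) < 1"
  shows "absv (of_int n :: 'a) < 1 \<longleftrightarrow> int p dvd n"
proof
  assume "int p dvd n"
  then obtain k where "n = int p * k" by blast
  then have "absv (of_int n :: 'a) = absv (of_nat p :: 'a) * absv (of_int k :: 'a)"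
    by (simp add: absv_mult)
  also have "\<dots> \<le> absv (of_nat p :: 'a) * 1"
    by (intro mult_left_mono absv_of_int_le_1) simp
  finally show "absv (of_int n :: 'a) < 1" using p by simp
next
  assume n: "absv (of_int n :: 'a) < 1"
  show "int p dvd n"
  proof (rule ccontr)
    assume "\<not> int p dvd n"
    then have "coprime (int p) n" using p by (simp add: prime_imp_coprime)
    then obtain u w where "u * int p + w * n = 1"
      using bezout_int[of "int p" n] by (metis coprime_iff_gcd_eq_1)
    then have "of_int (u * int p + w * n) = (1::'a)" by simp
    then have one: "of_int u * of_nat p + of_int w * of_int n = (1::'a)" by simp
    have "absv (of_int u * of_nat p :: 'a) \<le> absv (of_nat p :: 'a)"
      using absv_of_int_le_1[of u, where 'a = 'a] by (simp add: absv_mult mult_left_le_one_le)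
    moreover have "absv (of_int w * of_int n :: 'a) \<le> absv (of_int n :: 'a)"
      using absv_of_int_le_1[of w, where 'a = 'a] by (simp add: absv_mult mult_left_le_one_le)
    ultimately have "absv (of_int u * of_nat p + of_int w * of_int n :: 'a) < 1"
      using absv_add[of "of_int u * of_nat p :: 'a" "of_int w * of_int n"] p n by linarith
    then show False using one by simp
  qed
qed

section \<open>The p-adic numbers as a closed subfield with prime residue field\<close>

lemma Q_p_of_rat: "x \<in> \<rat> \<Longrightarrow> x \<in> Q_p"
  unfolding Q_p_def using closure_subset by blast

lemma Q_p_add:
  assumes "x \<in> Q_p" "y \<in> Q_p"
  shows "x + y \<in> Q_p"
proof -
  obtain X Y where "\<And>n. X n \<in> \<rat>" "X \<longlonglongrightarrow> x" "\<And>n. Y n \<in> \<rat>" "Y \<longlonglongrightarrow> y"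
    using assms unfolding Q_p_def closure_sequential by blast
  then show ?thesis
    unfolding Q_p_def closure_sequential
    by (intro exI[of _ "\<lambda>n. X n + Y n"]) (simp add: tendsto_add_nonarch)
qed

lemma Q_p_mult:
  assumes "x \<in> Q_p" "y \<in> Q_p"
  shows "x * y \<in> Q_p"
proof -
  obtain X Y where "\<And>n. X n \<in> \<rat>" "X \<longlonglongrightarrow> x" "\<And>n. Y n \<in> \<rat>" "Y \<longlonglongrightarrow> y"
    using assms unfolding Q_p_def closure_sequential by blast
  then show ?thesis
    unfolding Q_p_def closure_sequential
    by (intro exI[of _ "\<lambda>n. X n * Y n"]) (simp add: tendsto_mult_nonarch)
qed

lemma Q_p_uminus: "x \<in> Q_p \<Longrightarrow> - x \<in> Q_p"
  using Q_p_mult[OF Q_p_of_rat[of "-1"], of x] by simp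

lemma Q_p_inverse:
  assumes "(x::'a::nonarch_field) \<in> Q_p"
  shows "inverse x \<in> Q_p"
proof (cases "x = 0")
  case True
  then show ?thesis using assms by simp
next
  case False
  show ?thesis
    unfolding Q_p_def closure_approachable
  proof (intro allI impI)
    fix e :: real assume "0 < e"
    \<comment> \<open>The first bound forces \<open>absv y = absv x\<close>; then the inverses
      differ by \<open>absv (y - x) / absv x ^ 2\<close>, which the second bound controls.\<close>
    define d where "d = min (absv x) (e * absv x ^ 2)"
    have "0 < d" using False \<open>0 < e\<close> by (simp add: d_def)
    then obtain y where y: "y \<in> \<rat>" "dist y x < d"
      using assms unfolding Q_p_def closure_approachable by blast
    have yx: "absv (y - x) < absv x" "absv (y - x) < e * absv x ^ 2"
      using y(2) by (auto simp: d_def dist_absv)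
    have ay: "absv y = absv x" using absv_add_eq_left[OF yx(1)] by simp
    then have "y \<noteq> 0" using False by (metis absv_eq_0_iff)
    then have "inverse y - inverse x = (x - y) / (x * y)" using False by (simp add: field_simps)
    then have "dist (inverse y) (inverse x) = absv (y - x) / absv x ^ 2"
      by (simp add: dist_absv absv_mult ay power2_eq_square absv_diff_commute)
    also have "\<dots> < e" using yx(2) False by (simp add: field_simps)
    finally show "\<exists>z\<in>\<rat>. dist z (inverse x) < e" using y(1) by (intro bexI[of _ "inverse y"]) auto
  qed
qed

text \<open>A rational number within distance 1 of \<open>x\<close> is integral at \<open>p\<close>,
  so its denominator is prime to \<open>p\<close> and can be replaced by an inverse modulo
  \<open>p\<close>.\<close>

lemma Q_p_int_approx:
  assumes p: "prime p" "absv (of_nat p :: 'a::nonarch_field) < 1"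
    and x: "(x::'a) \<in> Q_p" "absv x \<le> 1"
  obtains c :: int where "absv (x - of_int c) < 1"
proof -
  obtain r where r: "r \<in> \<rat>" "dist r x < 1"
    using x(1) unfolding Q_p_def closure_approachable by (metis zero_less_one)
  have r1: "absv r \<le> 1" using absv_add[of "r - x" x] r(2) x(2) by (simp add: dist_absv)
  obtain a b where ab: "b > 0" "coprime a b" "r = of_int a / of_int b"
    using Rats_cases'[OF r(1)] by metis
  have b: "\<not> int p dvd b"
  proof
    assume pb: "int p dvd b"
    have "\<not> int p dvd a"
      using pb ab(2) p(1) by (metis coprime_common_divisor not_prime_unit prime_nat_int_transfer)
    then have "1 \<le> absv (of_int a :: 'a)" using absv_of_int_less_1_iff[OF p] by (metis not_le)
    also have "\<dots> = absv r * absv (of_int b :: 'a)" using ab by (simp add: absv_mult)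
    also have "\<dots> \<le> 1 * absv (of_int b :: 'a)" using r1 by (intro mult_right_mono) auto
    finally show False using pb absv_of_int_less_1_iff[OF p] by (metis mult_1 not_le)
  qed
  then have b1: "absv (of_int b :: 'a) = 1"
    using absv_of_int_less_1_iff[OF p, of b] absv_of_int_le_1[of b, where 'a = 'a] by linarith
  have "coprime (int p) b" using p b by (simp add: prime_imp_coprime)
  then obtain u w where "u * int p + w * b = 1"
    using bezout_int[of "int p" b] by (metis coprime_iff_gcd_eq_1)
  then have "of_int (u * int p + w * b) = (1::'a)" by simp
  then have one: "of_int u * of_nat p = (1::'a) - of_int w * of_int b" by (simp add: algebra_simps)
  have "r - of_int (a * w) = of_int a * (of_int u * of_nat p) / of_int b"
    unfolding one using ab by (simp add: field_simps)
  then have "absv (r - of_int (a * w)) = absv (of_int (a * u) :: 'a) * absv (of_nat p :: 'a)"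
    using b1 by (simp add: absv_mult)
  also have "\<dots> \<le> absv (of_nat p :: 'a)"
    using absv_of_int_le_1[of "a * u", where 'a = 'a] by (intro mult_left_le_one_le) auto
  finally have "absv (r - of_int (a * w)) < 1" using p by simp
  moreover have "absv (x - of_int (a * w)) \<le> max (absv (r - of_int (a * w))) (absv (r - x))"
    using absv_diff_le[of "r - of_int (a * w)" "r - x"] by simp
  ultimately show thesis using r(2) by (intro that[of "a * w"]) (simp add: dist_absv)
qed

text \<open>Gaussian elimination, by induction on the equations \<open>B\<close>. The scalars range
  over a subset \<open>F\<close> closed under the field operations because the p-adic numbers are a
  subset of the large field.\<close>

lemma homogeneous_system_nontrivial_solution:
  fixes F :: "'a::field set" and a :: "'i \<Rightarrow> 'b \<Rightarrow> 'a"
  assumes F: "0 \<in> F" "1 \<in> F" "\<And>x y. x \<in> F \<Longrightarrow> y \<in> F \<Longrightarrow> x + y \<in> F"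
      "\<And>x y. x \<in> F \<Longrightarrow> y \<in> F \<Longrightarrow> x * y \<in> F" "\<And>x. x \<in> F \<Longrightarrow> - x \<in> F" "\<And>x. x \<in> F \<Longrightarrow> inverse x \<in> F"
    and "finite B" "finite I" "card B < card I" "\<And>i b. i \<in> I \<Longrightarrow> b \<in> B \<Longrightarrow> a i b \<in> F"
  shows "\<exists>d. (\<forall>i\<in>I. d i \<in> F) \<and> (\<exists>i\<in>I. d i \<noteq> 0) \<and> (\<forall>b\<in>B. (\<Sum>i\<in>I. d i * a i b) = 0)"
  using assms(7-10)
proof (induction B arbitrary: I a)
  case empty
  then have "I \<noteq> {}" by auto
  then show ?case using F(2) by (intro exI[of _ "\<lambda>_. 1"]) auto
next
  case (insert b B)
  show ?case
  proof (cases "\<forall>i\<in>I. a i b = 0")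
    case True
    have "card B < card I" using insert.prems insert.hyps by simp
    then obtain d where "\<forall>i\<in>I. d i \<in> F" "\<exists>i\<in>I. d i \<noteq> 0" "\<forall>b\<in>B. (\<Sum>i\<in>I. d i * a i b) = 0"
      using insert.IH[of I a] insert.prems by auto
    then show ?thesis using True by (intro exI[of _ d]) auto
  next
    case False
    then obtain k where k: "k \<in> I" "a k b \<noteq> 0" by blast
    define J where "J = I - {k}"
    have I: "I = insert k J" "k \<notin> J" "finite J" using k insert.prems by (auto simp: J_def)
    \<comment> \<open>Equation \<open>b\<close> is used to eliminate the unknown \<open>k\<close>
      from the remaining equations.\<close>
    define a' where "a' i c = a i c - a i b / a k b * a k c" for i c
    have div: "x / y \<in> F" if "x \<in> F" "y \<in> F" for x y
      using that F by (simp add: divide_inverse)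
    have a': "a' i c \<in> F" if "i \<in> J" "c \<in> B" for i c
    proof -
      have "a i c \<in> F" "a i b \<in> F" "a k b \<in> F" "a k c \<in> F"
        using insert.prems(3) that I by auto
      then have "a i c + - (a i b / a k b * a k c) \<in> F" by (intro F(3-5) div)
      then show ?thesis by (simp add: a'_def)
    qed
    have "card B < card J" using insert.prems insert.hyps I by simp
    then obtain d where d: "\<forall>i\<in>J. d i \<in> F" "\<exists>i\<in>J. d i \<noteq> 0" "\<forall>c\<in>B. (\<Sum>i\<in>J. d i * a' i c) = 0"
      using insert.IH[of J a'] a' I by blast
    \<comment> \<open>The value at \<open>k\<close> is the one that equation \<open>b\<close>
      forces.\<close>
    define e where "e = d(k := - (\<Sum>i\<in>J. d i * (a i b / a k b)))"
    have sumF: "(\<Sum>i\<in>T. f i) \<in> F" if "\<And>i. i \<in> T \<Longrightarrow> f i \<in> F" for f and T :: "'i set"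
      using that F(1,3) by (induction T rule: infinite_finite_induct) auto
    have "e k \<in> F"
    proof -
      have "d i * (a i b / a k b) \<in> F" if "i \<in> J" for i
        using that d(1) insert.prems(3) I by (intro F(4) div) auto
      then show ?thesis using sumF F(5) I(2) by (simp add: e_def)
    qed
    moreover have "(\<Sum>i\<in>I. e i * a i c) = 0" if "c \<in> insert b B" for c
    proof -
      have "(\<Sum>i\<in>I. e i * a i c) = e k * a k c + (\<Sum>i\<in>J. d i * a i c)"
        using I by (simp add: e_def) (intro sum.cong, auto)
      also have "e k * a k c = - (\<Sum>i\<in>J. d i * (a i b / a k b) * a k c)"
        by (simp add: e_def sum_distrib_right)
      also have "\<dots> + (\<Sum>i\<in>J. d i * a i c) = (\<Sum>i\<in>J. d i * a' i c)"
        by (simp add: a'_def algebra_simps sum_subtractf)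
      also have "\<dots> = 0"
      proof (cases "c = b")
        case True
        then show ?thesis using k by (simp add: a'_def)
      next
        case False
        then show ?thesis using d(3) that by blast
      qed
      finally show ?thesis .
    qed
    moreover have "\<exists>i\<in>I. e i \<noteq> 0" using d(2) I by (auto simp: e_def)
    moreover have "\<forall>i\<in>J. e i \<in> F" using d(1) I by (auto simp: e_def)
    ultimately show ?thesis using I by (intro exI[of _ e]) auto
  qed
qed

text \<open>Linear independence over the prime field of the residue classes of a set of integral elements.\<close>
definition residually_independent :: "nat \<Rightarrow> 'a::nonarch_field set \<Rightarrow> bool" where
  "residually_independent p S \<longleftrightarrow>
     (\<forall>c :: 'a \<Rightarrow> int. absv (\<Sum>x\<in>S. of_int (c x) * x) < 1 \<longrightarrow> (\<forall>x\<in>S. int p dvd c x))"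

text \<open>The residue degree is at most the degree. With more elements than generators there is a
  nontrivial relation over the p-adic numbers; dividing by its largest coefficient and rounding to
  integers yields a relation between residue classes in which one coefficient is 1 modulo
  \<open>p\<close>.\<close>

lemma residually_independent_card_le:
  fixes S :: "'a::nonarch_field set"
  assumes p: "prime p" "absv (of_nat p :: 'a) < 1"
    and S: "finite S" "\<And>x. x \<in> S \<Longrightarrow> absv x \<le> 1" "residually_independent p S"
    and B: "finite B" "\<And>x. x \<in> S \<Longrightarrow> \<exists>c. (\<forall>b\<in>B. c b \<in> Q_p) \<and> x = (\<Sum>b\<in>B. c b * b)"
  shows "card S \<le> card B"
proof (rule ccontr)
  assume "\<not> card S \<le> card B"
  then have less: "card B < card S" by simp
  obtain a where a: "\<And>x b. x \<in> S \<Longrightarrow> b \<in> B \<Longrightarrow> a x b \<in> Q_p" "\<And>x. x \<in> S \<Longrightarrow> x = (\<Sum>b\<in>B. a x b * b)"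
    using B(2) bchoice[of S "\<lambda>x c. (\<forall>b\<in>B. c b \<in> Q_p) \<and> x = (\<Sum>b\<in>B. c b * b)"] by blast
  have "\<exists>d. (\<forall>x\<in>S. d x \<in> Q_p) \<and> (\<exists>x\<in>S. d x \<noteq> 0) \<and> (\<forall>b\<in>B. (\<Sum>x\<in>S. d x * a x b) = 0)"
    by (rule homogeneous_system_nontrivial_solution)
      (use less B(1) S(1) a(1) in \<open>auto intro: Q_p_add Q_p_mult Q_p_uminus Q_p_inverse Q_p_of_rat\<close>)
  then obtain d where d: "\<forall>x\<in>S. d x \<in> Q_p" "\<exists>x\<in>S. d x \<noteq> 0" "\<forall>b\<in>B. (\<Sum>x\<in>S. d x * a x b) = 0"
    by blast
  have zero: "(\<Sum>x\<in>S. d x * x) = 0"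
  proof -
    have "(\<Sum>x\<in>S. d x * x) = (\<Sum>x\<in>S. \<Sum>b\<in>B. d x * a x b * b)"
    proof (intro sum.cong refl)
      fix x assume "x \<in> S"
      then have "d x * x = d x * (\<Sum>b\<in>B. a x b * b)" using a(2) by simp
      then show "d x * x = (\<Sum>b\<in>B. d x * a x b * b)" by (simp add: sum_distrib_left mult.assoc)
    qed
    also have "\<dots> = (\<Sum>b\<in>B. (\<Sum>x\<in>S. d x * a x b) * b)"
      by (subst sum.swap) (simp add: sum_distrib_right)
    also have "\<dots> = 0" using d(3) by simp
    finally show ?thesis .
  qed
  have "S \<noteq> {}" using d(2) by blast
  \<comment> \<open>A coefficient of maximal size, so that all quotients by it are integral.\<close>
  then obtain y where y: "y \<in> S" "\<And>x. x \<in> S \<Longrightarrow> absv (d x) \<le> absv (d y)"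
    using S(1) Max_in[of "(\<lambda>x. absv (d x)) ` S"] Max_ge[of "(\<lambda>x. absv (d x)) ` S"] by fastforce
  have dy: "d y \<noteq> 0" using d(2) y(2) by (metis absv_eq_0_iff absv_nonneg antisym)
  have "\<exists>c::int. absv (d x / d y - of_int c) < 1" if "x \<in> S" for x
  proof -
    have "d x / d y \<in> Q_p" 
      using that y(1) d(1) by (auto simp: divide_inverse intro!: Q_p_mult Q_p_inverse)
    moreover have "absv (d x / d y) \<le> 1" using y(2)[OF that] dy by simp
    ultimately show ?thesis using Q_p_int_approx[OF p] by metis
  qed
  then obtain c :: "'a \<Rightarrow> int" where c: "\<And>x. x \<in> S \<Longrightarrow> absv (d x / d y - of_int (c x)) < 1"
    by metis
  have "(\<Sum>x\<in>S. of_int (c x) * x) = (\<Sum>x\<in>S. (of_int (c x) - d x / d y) * x) + (\<Sum>x\<in>S. d x * x) / d y"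
    by (simp add: left_diff_distrib sum_subtractf sum_divide_distrib)
  also have "\<dots> = (\<Sum>x\<in>S. (of_int (c x) - d x / d y) * x)" using zero by simp
  finally have "absv (\<Sum>x\<in>S. of_int (c x) * x) = absv (\<Sum>x\<in>S. (of_int (c x) - d x / d y) * x)"
    by simp
  also have "\<dots> < 1"
  proof (rule absv_sum_less)
    fix x assume x: "x \<in> S"
    have "absv (of_int (c x) - d x / d y) * absv x \<le> absv (of_int (c x) - d x / d y)"
      using S(2)[OF x] by (intro mult_right_le_one_le) auto
    then show "absv ((of_int (c x) - d x / d y) * x) < 1"
      using c[OF x] by (simp add: absv_mult absv_diff_commute)
  qed simp
  finally have "int p dvd c y" using S(3) y(1) unfolding residually_independent_def by blast
  then have "absv (of_int (c y) :: 'a) < 1" using absv_of_int_less_1_iff[OF p] by blast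
  moreover have "absv (1 - of_int (c y) :: 'a) < 1" using c[OF y(1)] dy by simp
  ultimately have "absv ((1 - of_int (c y)) + of_int (c y) :: 'a) < 1"
    using absv_add[of "1 - of_int (c y) :: 'a" "of_int (c y)"] by linarith
  then show False by simp
qed

text \<open>A maximal residually independent set is a basis of the residue field over the prime
  field; the classes then correspond to coefficient vectors with entries in
  \<open>{0..<int p}\<close>.\<close>

lemma residue_field_card:
  fixes K :: "'a::nonarch_field set"
  assumes p: "prime p" "absv (of_nat p :: 'a) < 1" and K: "finite_extension K"
  obtains e where "0 < e" "card (residue_field K) = p ^ e"
proof -
  obtain B where B: "finite B" "\<And>x. x \<in> K \<Longrightarrow> \<exists>c. (\<forall>b\<in>B. c b \<in> Q_p) \<and> x = (\<Sum>b\<in>B. c b * b)"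
    using K unfolding finite_extension_def by metis
  have KQ: "Q_p \<subseteq> K" and Kadd: "\<And>x y. x \<in> K \<Longrightarrow> y \<in> K \<Longrightarrow> x + y \<in> K"
    and Kmult: "\<And>x y. x \<in> K \<Longrightarrow> y \<in> K \<Longrightarrow> x * y \<in> K" and Kminus: "\<And>x. x \<in> K \<Longrightarrow> - x \<in> K"
    using K unfolding finite_extension_def by blast+
  have Kint: "of_int n \<in> K" for n using KQ Q_p_of_rat[of "of_int n :: 'a"] by auto
  have Ksum: "(\<Sum>i\<in>T. f i) \<in> K" if "\<And>i. i \<in> T \<Longrightarrow> f i \<in> K" for f and T :: "'a set"
    using that Kadd Kint[of 0] by (induction T rule: infinite_finite_induct) auto
  have Kdiff: "x - y \<in> K" if "x \<in> K" "y \<in> K" for x y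
    using Kadd[OF that(1) Kminus[OF that(2)]] by simp
  define good where "good S \<longleftrightarrow> finite S \<and> S \<subseteq> int_ring K \<and> residually_independent p S" for S
  have bound: "card S \<le> card B" if "good S" for S
    using that B by (intro residually_independent_card_le[OF p])
      (auto simp: good_def int_ring_def)
  have "good {}" by (simp add: good_def residually_independent_def)
  \<comment> \<open>The bound by the number of generators makes a set of largest cardinality
    exist.\<close>
  then obtain S where S: "good S" "\<And>T. good T \<Longrightarrow> card T \<le> card S"
    using bound ex_has_greatest_nat[of good "{}" card "Suc (card B)"]
    by (metis less_Suc_eq_le)
  have fin: "finite S" and SO: "S \<subseteq> int_ring K" and ind: "residually_independent p S"
    using S(1) by (auto simp: good_def)
  define R where "R = {(x, y). x \<in> int_ring K \<and> y \<in> int_ring K \<and> x - y \<in> max_ideal K}"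
  have R_iff: "(x, y) \<in> R \<longleftrightarrow> x \<in> int_ring K \<and> y \<in> int_ring K \<and> absv (x - y) < 1" for x y
    using Kdiff by (auto simp: R_def int_ring_def max_ideal_def)
  have R_equiv: "equiv (int_ring K) R"
  proof (rule equivI)
    show "R \<subseteq> int_ring K \<times> int_ring K" by (auto simp: R_def)
    show "refl_on (int_ring K) R" by (auto simp: refl_on_def R_iff)
    show "sym R" by (auto simp: sym_def R_iff absv_diff_commute)
    show "trans R"
    proof (rule transI)
      fix x y z assume "(x, y) \<in> R" "(y, z) \<in> R"
      then show "(x, z) \<in> R" using absv_add[of "x - y" "y - z"] by (auto simp: R_iff)
    qed
  qed
  define comb where "comb c = (\<Sum>x\<in>S. of_int (c x) * x)" for c :: "'a \<Rightarrow> int"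
  have comb_O: "comb c \<in> int_ring K" for c
  proof -
    have "absv (of_int (c x) * x) \<le> 1" if "x \<in> S" for x
      using that SO mult_le_one[OF absv_of_int_le_1[of "c x", where 'a = 'a], of "absv x"]
      by (auto simp: absv_mult int_ring_def)
    moreover have "comb c \<in> K"
      unfolding comb_def by (intro Ksum Kmult Kint) (use SO in \<open>auto simp: int_ring_def\<close>)
    ultimately show ?thesis by (simp add: comb_def int_ring_def absv_sum_le)
  qed
  define cls where "cls c = R `` {comb c}" for c
  have "bij_betw cls (S \<rightarrow>\<^sub>E {0..<int p}) (int_ring K // R)"
  proof (rule bij_betwI')
    fix c d assume c: "c \<in> S \<rightarrow>\<^sub>E {0..<int p}" and d: "d \<in> S \<rightarrow>\<^sub>E {0..<int p}"
    show "cls c = cls d \<longleftrightarrow> c = d"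
    proof
      assume "cls c = cls d"
      then have "(comb c, comb d) \<in> R"
        using eq_equiv_class[OF _ R_equiv comb_O] by (simp add: cls_def)
      then have "absv (comb c - comb d) < 1" by (simp add: R_iff)
      also have "comb c - comb d = (\<Sum>x\<in>S. of_int (c x - d x) * x)"
        by (simp add: comb_def sum_subtractf left_diff_distrib)
      finally have dv: "\<forall>x\<in>S. int p dvd (c x - d x)"
        using ind unfolding residually_independent_def by (elim allE[of _ "\<lambda>x. c x - d x"]) simp
      show "c = d"
      proof (rule PiE_ext[OF c d])
        fix x assume x: "x \<in> S"
        then have "c x \<in> {0..<int p}" "d x \<in> {0..<int p}" using c d by blast+
        moreover have "c x mod int p = d x mod int p" using dv x by (simp add: mod_eq_dvd_iff)
        ultimately show "c x = d x" by simp
      qed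
    qed simp
  next
    fix c assume "c \<in> S \<rightarrow>\<^sub>E {0..<int p}"
    show "cls c \<in> int_ring K // R" unfolding cls_def by (intro quotientI comb_O)
  next
    fix X assume "X \<in> int_ring K // R"
    then obtain y where y: "y \<in> int_ring K" "X = R `` {y}" by (auto elim: quotientE)
    have y1: "absv y \<le> 1" using y by (simp add: int_ring_def)
    have "\<exists>c. absv (y - comb c) < 1"
    proof (cases "y \<in> S")
      case True
      have "comb (\<lambda>x. if x = y then 1 else 0) = y"
        using fin True by (simp add: comb_def if_distrib[of of_int] if_distrib[of "\<lambda>a. a * _"] cong: if_cong)
      then show ?thesis by (metis absv_zero cancel_comm_monoid_add_class.diff_cancel zero_less_one)
    next
      case False
      have "\<not> good (insert y S)" using S(2)[of "insert y S"] fin False by auto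
      then have "\<not> residually_independent p (insert y S)" using fin SO y by (simp add: good_def)
      then obtain c where c: "absv (\<Sum>x\<in>insert y S. of_int (c x) * x) < 1"
        "\<exists>x\<in>insert y S. \<not> int p dvd c x" unfolding residually_independent_def by blast
      have c1: "absv (of_int (c y) * y + comb c) < 1" using c(1) fin False by (simp add: comb_def)
      have "\<not> int p dvd c y"
      proof
        assume dv: "int p dvd c y"
        then have "absv (of_int (c y) :: 'a) < 1" using absv_of_int_less_1_iff[OF p] by blast
        then have "absv (of_int (c y) * y) < 1"
          using mult_right_le_one_le[of "absv (of_int (c y) :: 'a)" "absv y"] y1
          by (simp add: absv_mult)
        then have "absv (comb c) < 1"
          using absv_diff_le[of "of_int (c y) * y + comb c" "of_int (c y) * y"] c1 by simp
        then have "\<forall>x\<in>S. int p dvd c x"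
          using ind unfolding residually_independent_def comb_def by blast
        then show False using c(2) dv by blast
      qed
      \<comment> \<open>The coefficient of \<open>y\<close> is invertible modulo \<open>p\<close>,
        with inverse \<open>w\<close>, so the relation can be solved for \<open>y\<close> up to an
        element of the maximal ideal.\<close>
      then have "coprime (int p) (c y)" using p by (simp add: prime_imp_coprime)
      then obtain u w where "u * int p + w * c y = 1"
        using bezout_int[of "int p" "c y"] by (metis coprime_iff_gcd_eq_1)
      then have "of_int (u * int p + w * c y) = (1::'a)" by simp
      then have one: "of_int u * of_nat p = (1::'a) - of_int w * of_int (c y)" by (simp add: algebra_simps)
      have "comb (\<lambda>x. - w * c x) = - (of_int w * comb c)"
        by (simp add: comb_def sum_distrib_left sum_negf mult.assoc)
      then have "y - comb (\<lambda>x. - w * c x) =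
          of_int w * (of_int (c y) * y + comb c) + of_int u * of_nat p * y"
        unfolding one by (simp add: algebra_simps)
      moreover have "absv (of_int w * (of_int (c y) * y + comb c)) < 1"
        using c1 mult_left_le_one_le[OF absv_nonneg absv_nonneg absv_of_int_le_1[of w, where 'a = 'a]]
        unfolding absv_mult[of "of_int w"] by (meson le_less_trans)
      moreover have "absv (of_int u * of_nat p * y) < 1"
      proof -
        have "absv (of_int u * y) \<le> 1"
          using y1 absv_of_int_le_1[of u, where 'a = 'a] by (simp add: absv_mult mult_le_one)
        then have "absv (of_int u * y) * absv (of_nat p :: 'a) \<le> absv (of_nat p :: 'a)"
          by (intro mult_left_le_one_le) auto
        then show ?thesis using p(2) by (simp add: absv_mult mult_ac)
      qed
      ultimately have "absv (y - comb (\<lambda>x. - w * c x)) < 1"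
        using absv_add[of "of_int w * (of_int (c y) * y + comb c)" "of_int u * of_nat p * y"]
        by (metis max_less_iff_conj le_less_trans)
      then show ?thesis by blast
    qed
    then obtain c where c: "absv (y - comb c) < 1" by blast
    \<comment> \<open>Reducing the coefficients modulo \<open>p\<close> changes the combination only
      within the maximal ideal.\<close>
    define d where "d = restrict (\<lambda>x. c x mod int p) S"
    have d: "d \<in> S \<rightarrow>\<^sub>E {0..<int p}" using prime_gt_0_nat[OF p(1)] by (auto simp: d_def)
    have "comb c - comb d = (\<Sum>x\<in>S. of_int (c x - c x mod int p) * x)"
      by (simp add: comb_def d_def sum_subtractf left_diff_distrib)
    also have "absv \<dots> < 1"
    proof (rule absv_sum_less)
      fix x assume x: "x \<in> S"
      have "absv (of_int (c x - c x mod int p) :: 'a) < 1"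
        using absv_of_int_less_1_iff[OF p] by (metis dvd_minus_mod)
      moreover have "absv (of_int (c x - c x mod int p) :: 'a) * absv x \<le> absv (of_int (c x - c x mod int p) :: 'a)"
        using x SO by (intro mult_right_le_one_le) (auto simp: int_ring_def)
      ultimately show "absv (of_int (c x - c x mod int p) * x) < 1" unfolding absv_mult by linarith
    qed simp
    finally have "absv (comb c - comb d) < 1" .
    then have "absv (y - comb d) < 1" using absv_add[of "y - comb c" "comb c - comb d"] c by simp
    then have "(y, comb d) \<in> R" using y comb_O by (simp add: R_iff)
    then have "X = cls d" unfolding y(2) cls_def using equiv_class_eq[OF R_equiv] by blast
    then show "\<exists>d\<in>S \<rightarrow>\<^sub>E {0..<int p}. X = cls d" using d by blast
  qed
  then have "card (residue_field K) = card (S \<rightarrow>\<^sub>E {0..<int p})"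
    unfolding residue_field_def R_def[symmetric] by (metis bij_betw_same_card)
  also have "\<dots> = p ^ card S" using fin by (simp add: card_PiE)
  finally have card: "card (residue_field K) = p ^ card S" .
  \<comment> \<open>Since \<open>{1}\<close> is independent, the exponent is positive, which later
    gives \<open>2 \<le> q\<close>.\<close>
  have "S \<noteq> {}"
  proof
    assume [simp]: "S = {}"
    have "(1::'a) \<in> int_ring K" using Kint[of 1] by (simp add: int_ring_def)
    then have "\<not> good {1}" using S(2)[of "{1}"] by auto
    moreover have "good {1}"
      using \<open>1 \<in> int_ring K\<close> absv_of_int_less_1_iff[OF p]
      by (auto simp: good_def residually_independent_def)
    ultimately show False by blast
  qed
  then have "0 < card S" using fin by (simp add: card_gt_0_iff)
  then show thesis using card that by blast
qed

section \<open>The size of the coefficients of the universal logarithm\<close>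

text \<open>This isolates what the estimates require of the arithmetic data. The bound on binomial
  coefficients stands for the fact that \<open>q\<close> is a power of \<open>p\<close> and that
  \<open>\<pi>\<close> divides \<open>p\<close>.\<close>

locale universal_deformation =
  fixes q :: nat and \<pi> :: "'c::nonarch_field"
  assumes q_ge_2: "2 \<le> q" and pi_nonzero: "\<pi> \<noteq> 0" and absv_pi_less_1: "absv \<pi> < 1"
    and absv_binomial_le: "\<And>i. 0 < i \<Longrightarrow> i < q \<Longrightarrow> absv (of_nat (q choose i) :: 'c) \<le> absv \<pi>"
begin

abbreviation \<rho> :: real where "\<rho> \<equiv> absv \<pi>"

lemma rho: "0 < \<rho>" "\<rho> < 1" "\<rho> \<le> 1" "\<rho> \<noteq> 0"
  using pi_nonzero absv_pi_less_1 by auto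

lemma q_pos: "0 < q" "1 < q" "0 < q ^ j"
  using q_ge_2 by auto

definition m :: "nat \<Rightarrow> 'c \<Rightarrow> 'c" where
  "m k u = poly (log_rec q \<pi> k) u"

lemma m_0 [simp]: "m 0 u = 1" and m_1: "m (Suc 0) u = u / \<pi>"
  by (simp_all add: m_def)

lemma m_Suc_Suc_inner: "\<pi> * m (Suc (Suc k)) u = u * m (Suc k) (u ^ q) + m k (u ^ q\<^sup>2)"
  using pi_nonzero by (simp add: m_def poly_pcompose poly_monom field_simps)

text \<open>The functional equation peels off the innermost factor of the continuant \<open>m k\<close>; here the
  outermost one is removed, so that only values at \<open>u\<close> occur.\<close>

lemma m_Suc_Suc: "\<pi> * m (Suc (Suc k)) u = u ^ (q ^ Suc k) * m (Suc k) u + m k u"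
proof (induction k arbitrary: u rule: less_induct)
  case (less k)
  consider "k = 0" | "k = 1" | j where "k = Suc (Suc j)"
    by (metis One_nat_def old.nat.exhaust)
  then show ?case
  proof cases
    case 1
    then show ?thesis by (simp add: m_Suc_Suc_inner m_1)
  next
    case 2
    have two: "\<pi> * m (Suc (Suc 0)) w = w * (w ^ q / \<pi>) + 1" for w
      by (simp add: m_Suc_Suc_inner m_1)
    have "\<pi> * (\<pi> * m (Suc (Suc 1)) u) = u * (\<pi> * m (Suc (Suc 0)) (u ^ q)) + \<pi> * m 1 (u ^ q\<^sup>2)"
      using m_Suc_Suc_inner[of 1 u] by (simp add: algebra_simps)
    also have "\<dots> = u * (u ^ q * (u ^ q\<^sup>2 / \<pi>) + 1) + u ^ q\<^sup>2"
      using pi_nonzero by (simp add: two m_1 power_mult[symmetric] power2_eq_square)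
    also have "\<dots> = u ^ q\<^sup>2 * (\<pi> * m (Suc (Suc 0)) u) + \<pi> * m 1 u"
      using pi_nonzero by (simp add: two m_1 field_simps)
    also have "\<dots> = \<pi> * (u ^ (q ^ Suc 1) * m (Suc 1) u + m 1 u)"
      by (simp add: power2_eq_square algebra_simps)
    finally show ?thesis using pi_nonzero 2 by simp
  next
    \<comment> \<open>The inner recursion and the outer one act at opposite ends of the continuant
      and hence commute: expand from inside, apply the hypotheses at \<open>u ^ q\<close> and
      \<open>u ^ q\<^sup>2\<close>, and fold back at \<open>u\<close>. Two earlier indices occur,
      which is why \<open>k = 1\<close> is treated apart.\<close>
    case (3 j)
    have e1: "\<pi> * m (Suc k) (u ^ q) = u ^ (q ^ Suc k) * m k (u ^ q) + m (Suc j) (u ^ q)"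
      using less.IH[of "Suc j" "u ^ q"] 3 by (simp add: power_mult[symmetric])
    have e2: "\<pi> * m k (u ^ q\<^sup>2) = u ^ (q ^ Suc k) * m (Suc j) (u ^ q\<^sup>2) + m j (u ^ q\<^sup>2)"
      using less.IH[of j "u ^ q\<^sup>2"] 3 by (simp add: power_mult[symmetric] power2_eq_square mult_ac)
    have "\<pi> * (\<pi> * m (Suc (Suc k)) u) = u * (\<pi> * m (Suc k) (u ^ q)) + \<pi> * m k (u ^ q\<^sup>2)"
      by (simp add: m_Suc_Suc_inner algebra_simps)
    also have "\<dots> = u ^ (q ^ Suc k) * (u * m k (u ^ q) + m (Suc j) (u ^ q\<^sup>2))
        + (u * m (Suc j) (u ^ q) + m j (u ^ q\<^sup>2))"
      unfolding e1 e2 by (simp add: algebra_simps)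
    also have "\<dots> = u ^ (q ^ Suc k) * (\<pi> * m (Suc k) u) + \<pi> * m k u"
      using m_Suc_Suc_inner[of "Suc j" u] m_Suc_Suc_inner[of j u] 3 by simp
    also have "\<dots> = \<pi> * (u ^ (q ^ Suc k) * m (Suc k) u + m k u)" by (simp add: algebra_simps)
    finally show ?thesis using pi_nonzero by simp
  qed
qed

lemma absv_m_Suc_Suc: "\<rho> * absv (m (Suc (Suc k)) u) = absv (u ^ (q ^ Suc k) * m (Suc k) u + m k u)"
  by (metis absv_mult m_Suc_Suc)

text \<open>The degree of the polynomial \<open>m j\<close>, whose top term is
  \<open>u ^ D j / \<pi> ^ j\<close>.\<close>

definition D :: "nat \<Rightarrow> nat" where "D j = (\<Sum>i<j. q ^ i)"

lemma D_0 [simp]: "D 0 = 0" and D_Suc [simp]: "D (Suc j) = D j + q ^ j"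
  by (simp_all add: D_def)

text \<open>The boundary case \<open>g ^ ((q + 1) * q ^ n) = \<rho>\<close> is that of the second part of
  the theorem; otherwise \<open>n\<close> is the index occurring in the first part.\<close>

definition level :: "real \<Rightarrow> nat \<Rightarrow> bool" where
  "level g n \<longleftrightarrow> 0 < g \<and> g < 1 \<and> (\<forall>j<n. \<rho> < g ^ ((q + 1) * q ^ j)) \<and> g ^ ((q + 1) * q ^ n) \<le> \<rho>"

lemma levelD:
  assumes "level g n"
  shows "0 < g" "g < 1" "\<And>j. j < n \<Longrightarrow> \<rho> < g ^ ((q + 1) * q ^ j)" "g ^ ((q + 1) * q ^ n) \<le> \<rho>"
  using assms by (auto simp: level_def)

text \<open>The two terms on the right of \<open>m_Suc_Suc\<close> have sizes in the ratio
  \<open>g ^ ((q + 1) * q ^ i) / \<rho>\<close>, which exceeds 1 for \<open>i < n\<close>; hence the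
  top monomial dominates.\<close>

lemma absv_m_le_level:
  assumes L: "level g n" and u: "absv u = g" and j: "j \<le> Suc n"
  shows "absv (m j u) = g ^ D j / \<rho> ^ j"
  using j
proof (induction j rule: less_induct)
  case (less j)
  note g = levelD[OF L]
  consider "j = 0" | "j = 1" | i where "j = Suc (Suc i)"
    by (metis One_nat_def old.nat.exhaust)
  then show ?case
  proof cases
    case 1
    then show ?thesis by simp
  next
    case 2
    then show ?thesis by (simp add: m_1 u)
  next
    case (3 i)
    have mi: "absv (m i u) = g ^ D i / \<rho> ^ i" "absv (m (Suc i) u) = g ^ D (Suc i) / \<rho> ^ Suc i"
      using less 3 by auto
    have "\<rho> < g ^ (q ^ Suc i + q ^ i)" using g(3)[of i] 3 less.prems by (simp add: algebra_simps)
    then have "g ^ D i * \<rho> < g ^ D i * g ^ (q ^ Suc i + q ^ i)" using g by simp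
    then have "absv (m i u) < absv (u ^ (q ^ Suc i) * m (Suc i) u)"
      using rho g by (simp add: mi absv_mult u power_add field_simps)
    then have "\<rho> * absv (m j u) = absv (u ^ (q ^ Suc i) * m (Suc i) u)"
      unfolding 3 absv_m_Suc_Suc by (rule absv_add_eq_left)
    also have "\<dots> = \<rho> * (g ^ D j / \<rho> ^ j)"
      using rho by (simp add: mi absv_mult u 3 power_add)
    finally show ?thesis by (metis mult_cancel_left rho(4))
  qed
qed

text \<open>Beyond the level the other term, \<open>m k u\<close>, takes over and the sizes repeat
  with period two up to the factor \<open>\<rho>\<close>. For indices of the parity of
  \<open>Suc n\<close> its dominance is strict. For the parity of \<open>n\<close> the two terms may
  have equal size in the boundary case and cancel, so there only an upper bound holds in
  general.\<close>

lemma absv_m_ge_level: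
  assumes L: "level g n" and u: "absv u = g"
  shows "absv (m (Suc n + 2 * i) u) = g ^ D (Suc n) / \<rho> ^ (Suc n + i) \<and>
    absv (m (n + 2 * i) u) \<le> g ^ D n / \<rho> ^ (n + i) \<and>
    (g ^ ((q + 1) * q ^ n) < \<rho> \<longrightarrow> absv (m (n + 2 * i) u) = g ^ D n / \<rho> ^ (n + i))"
proof (induction i)
  case 0
  show ?case using absv_m_le_level[OF L u, of n] absv_m_le_level[OF L u, of "Suc n"] by simp
next
  case (Suc i)
  note g = levelD[OF L]
  let ?N = "n + 2 * i"
  have X: "absv (m (Suc ?N) u) = g ^ D (Suc n) / \<rho> ^ (Suc n + i)"
    and Y: "absv (m ?N u) \<le> g ^ D n / \<rho> ^ (n + i)"
    and Ys: "g ^ ((q + 1) * q ^ n) < \<rho> \<Longrightarrow> absv (m ?N u) = g ^ D n / \<rho> ^ (n + i)"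
    using Suc by auto
  have qm: "q ^ Suc n \<le> q ^ Suc ?N" "q ^ n < q ^ Suc (Suc ?N)"
    by (rule power_increasing power_strict_increasing; use q_pos in simp)+
  have B: "absv (u ^ (q ^ Suc ?N) * m (Suc ?N) u) \<le> (g ^ ((q + 1) * q ^ n) / \<rho>) * (g ^ D n / \<rho> ^ (n + i))"
  proof -
    have "g ^ (q ^ Suc ?N) \<le> g ^ (q ^ Suc n)" using g by (intro power_decreasing qm(1)) auto
    then have "g ^ (q ^ Suc ?N) * (g ^ D (Suc n) / \<rho> ^ (Suc n + i)) \<le> g ^ (q ^ Suc n) * (g ^ D (Suc n) / \<rho> ^ (Suc n + i))"
      using g rho by (intro mult_right_mono) auto
    also have "\<dots> = (g ^ ((q + 1) * q ^ n) / \<rho>) * (g ^ D n / \<rho> ^ (n + i))"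
      by (simp add: power_add algebra_simps)
    finally show ?thesis unfolding absv_mult absv_power u X .
  qed
  have le1: "g ^ ((q + 1) * q ^ n) / \<rho> \<le> 1" using g rho by simp
  have pos: "0 < g ^ D n / \<rho> ^ (n + i)" using g rho by simp
  have B': "absv (u ^ (q ^ Suc ?N) * m (Suc ?N) u) \<le> g ^ D n / \<rho> ^ (n + i)"
    using B mult_right_mono[OF le1, of "g ^ D n / \<rho> ^ (n + i)"] pos by linarith
  have Y2: "\<rho> * absv (m (Suc (Suc ?N)) u) \<le> g ^ D n / \<rho> ^ (n + i)"
    unfolding absv_m_Suc_Suc using absv_add[of "u ^ (q ^ Suc ?N) * m (Suc ?N) u" "m ?N u"] B' Y by linarith
  have Y3: "\<rho> * absv (m (Suc (Suc ?N)) u) = g ^ D n / \<rho> ^ (n + i)" if s: "g ^ ((q + 1) * q ^ n) < \<rho>"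
  proof -
    have "(g ^ ((q + 1) * q ^ n) / \<rho>) * (g ^ D n / \<rho> ^ (n + i)) < 1 * (g ^ D n / \<rho> ^ (n + i))"
      using s rho pos by (intro mult_strict_right_mono) auto
    then have "absv (u ^ (q ^ Suc ?N) * m (Suc ?N) u) < absv (m ?N u)" using B Ys[OF s] by linarith
    then show ?thesis unfolding absv_m_Suc_Suc using Ys[OF s] by (simp add: absv_add_eq_right)
  qed
  have X2: "\<rho> * absv (m (Suc (Suc (Suc ?N))) u) = g ^ D (Suc n) / \<rho> ^ (Suc n + i)"
  proof -
    have "absv (u ^ (q ^ Suc (Suc ?N)) * m (Suc (Suc ?N)) u) < absv (m (Suc ?N) u)"
    proof -
      \<comment> \<open>Strictness comes from the comparison of the exponents
        \<open>q ^ Suc (Suc ?N)\<close> and \<open>q ^ n\<close> alone, and therefore survives in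
        the boundary case.\<close>
      have "g ^ (q ^ Suc (Suc ?N)) < g ^ (q ^ n)" using g by (intro power_strict_decreasing qm(2)) auto
      then have "g ^ (q ^ Suc (Suc ?N)) * (g ^ D n / \<rho> ^ (n + i)) < g ^ (q ^ n) * (g ^ D n / \<rho> ^ (n + i))"
        using pos by (intro mult_strict_right_mono) auto
      also have "\<dots> = \<rho> * absv (m (Suc ?N) u)" using rho by (simp add: X power_add)
      finally have "g ^ (q ^ Suc (Suc ?N)) * (\<rho> * absv (m (Suc (Suc ?N)) u)) < \<rho> * absv (m (Suc ?N) u)"
        using Y2 g by (meson le_less_trans mult_left_mono zero_le_power less_imp_le)
      then have "\<rho> * absv (u ^ (q ^ Suc (Suc ?N)) * m (Suc (Suc ?N)) u) < \<rho> * absv (m (Suc ?N) u)"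
        by (simp only: absv_mult absv_power u mult_ac)
      then show ?thesis using rho by simp
    qed
    then show ?thesis unfolding absv_m_Suc_Suc X[symmetric] by (rule absv_add_eq_right)
  qed
  have idx: "Suc n + 2 * Suc i = Suc (Suc (Suc ?N))" "n + 2 * Suc i = Suc (Suc ?N)" by simp_all
  show ?case unfolding idx using X2 Y2 Y3 rho by (auto simp: field_simps)
qed

lemmas absv_m_odd = absv_m_ge_level[THEN conjunct1]
lemmas absv_m_even_le = absv_m_ge_level[THEN conjunct2, THEN conjunct1]
lemmas absv_m_even = absv_m_ge_level[THEN conjunct2, THEN conjunct2, rule_format]

section \<open>Differences of Frobenius powers\<close>

text \<open>In the expansion of \<open>(v + (u - v)) ^ q\<close> every mixed term carries a binomial
  coefficient of size at most \<open>\<rho>\<close> and at least one factor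
  \<open>u - v\<close>.\<close>

lemma power_q_diff:
  fixes u v :: 'c
  assumes "absv u \<le> g" "absv v \<le> g"
  shows "absv (u ^ q - v ^ q - (u - v) ^ q) \<le> \<rho> * g ^ (q - 1) * absv (u - v)"
proof -
  define t where "t = u - v"
  have g0: "0 \<le> g" using assms(1) absv_nonneg order_trans by blast
  have t: "absv t \<le> g" unfolding t_def using assms absv_diff_le[of u v] by simp
  have "u ^ q = (v + t) ^ q" by (simp add: t_def)
  also have "\<dots> = (\<Sum>i\<le>q. of_nat (q choose i) * v ^ i * t ^ (q - i))" by (rule binomial_ring)
  also have "{..q} = insert 0 (insert q {0<..<q})" using q_pos by auto
  also have "(\<Sum>i\<in>insert 0 (insert q {0<..<q}). of_nat (q choose i) * v ^ i * t ^ (q - i)) =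
      t ^ q + (v ^ q + (\<Sum>i\<in>{0<..<q}. of_nat (q choose i) * v ^ i * t ^ (q - i)))"
    using q_pos by simp
  finally have "u ^ q - v ^ q - t ^ q = (\<Sum>i\<in>{0<..<q}. of_nat (q choose i) * v ^ i * t ^ (q - i))"
    by simp
  also have "absv \<dots> \<le> \<rho> * g ^ (q - 1) * absv t"
  proof (rule absv_sum_le)
    fix i assume i: "i \<in> {0<..<q}"
    have "absv v ^ i * absv t ^ (q - 1 - i) \<le> g ^ i * g ^ (q - 1 - i)"
      using assms t by (intro mult_mono power_mono) (auto simp: g0)
    also have "\<dots> = g ^ (q - 1)" using i by (simp flip: power_add)
    finally have le: "absv v ^ i * absv t ^ (q - 1 - i) \<le> g ^ (q - 1)" .
    have qi: "q - i = Suc (q - 1 - i)" using i by auto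
    have "absv (of_nat (q choose i) * v ^ i * t ^ (q - i)) =
        absv (of_nat (q choose i) :: 'c) * (absv v ^ i * absv t ^ (q - 1 - i)) * absv t"
      unfolding qi by (simp only: absv_mult absv_power power_Suc mult_ac)
    also have "\<dots> \<le> \<rho> * g ^ (q - 1) * absv t"
      using le absv_binomial_le[of i] i g0 by (intro mult_right_mono mult_mono) auto
    finally show "absv (of_nat (q choose i) * v ^ i * t ^ (q - i)) \<le> \<rho> * g ^ (q - 1) * absv t" .
  qed (use rho g0 in auto)
  finally show ?thesis by (simp add: t_def)
qed

definition tau :: "'c \<Rightarrow> 'c \<Rightarrow> nat \<Rightarrow> real" where
  "tau u v j = absv (u ^ (q ^ j) - v ^ (q ^ j))"

lemma tau_0 [simp]: "tau u v 0 = absv (u - v)" and tau_nonneg [simp]: "0 \<le> tau u v j"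
  by (simp_all add: tau_def)

lemma tau_le: "absv u = g \<Longrightarrow> absv v = g \<Longrightarrow> tau u v j \<le> g ^ (q ^ j)"
  using absv_diff_le[of "u ^ (q ^ j)" "v ^ (q ^ j)"] by (simp add: tau_def)

text \<open>The two arguments of the maximum come from the q-th power of the difference and from the
  mixed binomial terms.\<close>

lemma tau_Suc_le:
  assumes "absv u = g" "absv v = g"
  shows "tau u v (Suc j) \<le> max (tau u v j ^ (q - 1)) (\<rho> * g ^ (q ^ j * (q - 1))) * tau u v j"
proof -
  define x y where "x = u ^ (q ^ j)" and "y = v ^ (q ^ j)"
  have xy: "absv (x ^ q - y ^ q - (x - y) ^ q) \<le> \<rho> * (g ^ (q ^ j)) ^ (q - 1) * absv (x - y)"
    by (rule power_q_diff) (simp_all add: x_def y_def assms)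
  have "tau u v (Suc j) = absv (x ^ q - y ^ q)"
    by (simp add: tau_def x_def y_def power_mult[symmetric] mult.commute)
  also have "\<dots> \<le> max (absv (x ^ q - y ^ q - (x - y) ^ q)) (absv ((x - y) ^ q))"
    using absv_add[of "x ^ q - y ^ q - (x - y) ^ q" "(x - y) ^ q"] by simp
  also have "\<dots> \<le> max (\<rho> * (g ^ (q ^ j)) ^ (q - 1) * absv (x - y)) (absv (x - y) ^ (q - 1) * absv (x - y))"
    using xy power_minus_mult[of q "absv (x - y)"] q_pos(1) by (intro max.mono) auto
  also have "\<dots> = max (tau u v j ^ (q - 1)) (\<rho> * g ^ (q ^ j * (q - 1))) * tau u v j"
    by (simp add: tau_def x_def y_def power_mult max_mult_distrib_right max.commute)
  finally show ?thesis .
qed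

lemma tau_Suc_eq:
  assumes "absv u = g" "absv v = g" "\<rho> * g ^ (q ^ j * (q - 1)) < tau u v j ^ (q - 1)" "0 < tau u v j"
  shows "tau u v (Suc j) = tau u v j ^ q"
proof -
  define x y where "x = u ^ (q ^ j)" and "y = v ^ (q ^ j)"
  have t: "tau u v j = absv (x - y)" by (simp add: tau_def x_def y_def)
  have "absv (x ^ q - y ^ q - (x - y) ^ q) \<le> \<rho> * (g ^ (q ^ j)) ^ (q - 1) * absv (x - y)"
    by (rule power_q_diff) (simp_all add: x_def y_def assms)
  also have "\<dots> < absv (x - y) ^ (q - 1) * absv (x - y)"
    using assms(3,4) by (simp add: t power_mult)
  also have "\<dots> = absv ((x - y) ^ q)" by (simp only: absv_power power_minus_mult[OF q_pos(1)])
  finally have "absv ((x ^ q - y ^ q - (x - y) ^ q) + (x - y) ^ q) = absv ((x - y) ^ q)"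
    by (rule absv_add_eq_right)
  then show ?thesis by (simp add: tau_def x_def y_def power_mult[symmetric] mult.commute)
qed

section \<open>The determinant of two approximate periods\<close>

definition G :: "nat \<Rightarrow> 'c \<Rightarrow> 'c \<Rightarrow> 'c" where
  "G k u v = (\<Sum>j<k. (-\<pi>) ^ j * m j u * m j v * (u ^ (q ^ j) - v ^ (q ^ j)))"

text \<open>Inserting the recursion at \<open>u\<close> and at \<open>v\<close>, the product
  \<open>m (Suc k) u * m (Suc k) v\<close> collects the difference of powers, and the rest is the
  previous determinant with its columns exchanged. The alternating sign of
  \<open>(-\<pi>) ^ j\<close> absorbs this exchange.\<close>

lemma G_wedge: "G (Suc k) u v = - ((-\<pi>) ^ Suc k) * (m (Suc k) u * m k v - m k u * m (Suc k) v)"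
proof (induction k)
  case 0
  then show ?case using pi_nonzero by (simp add: G_def m_1 right_diff_distrib)
next
  case (Suc k)
  have "G (Suc (Suc k)) u v = G (Suc k) u v + (-\<pi>) ^ Suc k * m (Suc k) u * m (Suc k) v * (u ^ (q ^ Suc k) - v ^ (q ^ Suc k))"
    by (simp add: G_def)
  also have "\<dots> = (-\<pi>) ^ Suc k * ((u ^ (q ^ Suc k) * m (Suc k) u + m k u) * m (Suc k) v -
      m (Suc k) u * (v ^ (q ^ Suc k) * m (Suc k) v + m k v))"
  proof -
    define c where "c = (-\<pi>) ^ Suc k"
    show ?thesis unfolding Suc.IH c_def[symmetric] by (simp add: algebra_simps)
  qed
  also have "\<dots> = (-\<pi>) ^ Suc k * (\<pi> * m (Suc (Suc k)) u * m (Suc k) v - m (Suc k) u * (\<pi> * m (Suc (Suc k)) v))"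
    unfolding m_Suc_Suc ..
  also have "\<dots> = - ((-\<pi>) ^ Suc (Suc k)) * (m (Suc (Suc k)) u * m (Suc k) v - m (Suc k) u * m (Suc (Suc k)) v)"
    by (simp add: algebra_simps)
  finally show ?case .
qed

lemma G_swap: "G k v u = - G k u v"
  unfolding G_def sum_negf[symmetric] by (intro sum.cong) (simp_all add: algebra_simps)

lemma G_refl [simp]: "G k u u = 0"
  by (simp add: G_def)

lemma G_poly: "\<exists>p. \<forall>u. poly p u = G k u v"
proof
  show "\<forall>u. poly (\<Sum>j<k. [:(-\<pi>) ^ j * m j v:] * log_rec q \<pi> j * (monom 1 (q ^ j) - [:v ^ (q ^ j):])) u = G k u v"
    by (simp add: G_def poly_sum m_def poly_monom mult_ac)
qed

text \<open>The size of \<open>(-\<pi>) ^ j * m j u * m j v\<close> on the sphere of radius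
  \<open>g\<close>, for \<open>j\<close> up to one more than the level.\<close>

definition coef :: "real \<Rightarrow> nat \<Rightarrow> real" where
  "coef g j = g ^ (2 * D j) / \<rho> ^ j"

lemma coef_0 [simp]: "coef g 0 = 1"
  by (simp add: coef_def)

lemma coef_Suc: "coef g (Suc j) = coef g j * (g ^ (2 * q ^ j) / \<rho>)"
  by (simp add: coef_def power_add algebra_simps)

lemma coef_pos: "0 < g \<Longrightarrow> 0 < coef g j"
  using rho by (simp add: coef_def)

lemma G_term_le_level:
  assumes "level g n" "absv u = g" "absv v = g" "j \<le> Suc n"
  shows "absv ((-\<pi>) ^ j * m j u * m j v * (u ^ (q ^ j) - v ^ (q ^ j))) = coef g j * tau u v j"
proof -
  have "absv ((-\<pi>) ^ j * m j u * m j v * (u ^ (q ^ j) - v ^ (q ^ j))) =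
      \<rho> ^ j * absv (m j u) * absv (m j v) * tau u v j"
    by (simp only: absv_mult absv_power absv_minus tau_def)
  also have "\<dots> = coef g j * tau u v j"
    unfolding absv_m_le_level[OF assms(1,2,4)] absv_m_le_level[OF assms(1,3,4)] coef_def
    using rho by (simp add: power_add mult_2 mult_2_right field_simps)
  finally show ?thesis .
qed

text \<open>Because of the period two, the factor \<open>\<rho> ^ j\<close> exactly compensates the
  growth of the two continuants. Past the level the decay of the terms is thus left to the
  differences of powers.\<close>

lemma coef_growth_bound:
  assumes L: "level g n" "absv u = g" "absv v = g" "n \<le> j"
  shows "\<rho> ^ j * (absv (m j u) * absv (m j v)) \<le> max (coef g n) (coef g (Suc n))"
proof -
  note g = levelD[OF L(1)]
  have "even (j - n) \<or> odd (j - n)" by blast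
  then consider i where "j = n + 2 * i" | i where "j = Suc n + 2 * i"
    using L(4) by (metis add.commute add_Suc dvd_def le_add_diff_inverse oddE plus_1_eq_Suc)
  then show ?thesis
  proof cases
    case (1 i)
    have "absv (m j u) * absv (m j v) \<le> (g ^ D n / \<rho> ^ (n + i)) * (g ^ D n / \<rho> ^ (n + i))"
      unfolding 1 using absv_m_even_le[OF L(1,2), of i] absv_m_even_le[OF L(1,3), of i] g rho
      by (intro mult_mono) auto
    then have "\<rho> ^ j * (absv (m j u) * absv (m j v)) \<le> \<rho> ^ j * ((g ^ D n / \<rho> ^ (n + i)) * (g ^ D n / \<rho> ^ (n + i)))"
      using rho by (intro mult_left_mono) auto
    also have "\<dots> = coef g n" unfolding 1 coef_def using rho
      by (simp add: power_add mult_2 mult_2_right field_simps)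
    finally show ?thesis by simp
  next
    case (2 i)
    have "\<rho> ^ j * (absv (m j u) * absv (m j v)) = coef g (Suc n)"
      unfolding 2 absv_m_odd[OF L(1,2), of i] absv_m_odd[OF L(1,3), of i] coef_def using rho
      by (simp add: power_add mult_2 mult_2_right field_simps)
    then show ?thesis by simp
  qed
qed

text \<open>The terms of \<open>G k u v\<close> increase in absolute value up to index \<open>j\<close> and decrease
  afterwards.\<close>

lemma absv_G:
  assumes L: "level g n" and u: "absv u = g" and v: "absv v = g" and uv: "u \<noteq> v"
    and j: "j \<le> n" and k: "n < k"
    and lower: "0 < j \<Longrightarrow> \<rho> < (absv (u - v) ^ (q - 1) * g\<^sup>2) ^ (q ^ (j - 1))"
    and upper: "(absv (u - v) ^ (q - 1) * g\<^sup>2) ^ (q ^ j) < \<rho>"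
  shows "absv (G k u v) = coef g j * absv (u - v) ^ (q ^ j)"
proof -
  note g = levelD[OF L]
  define t where "t = absv (u - v)"
  \<comment> \<open>While the differences of powers equal the powers of the difference,
    \<open>w ^ (q ^ i) / \<rho>\<close> is the quotient of terms \<open>Suc i\<close> and
    \<open>i\<close>. The hypotheses \<open>lower\<close> and \<open>upper\<close> say where it
    crosses 1.\<close>
  define w where "w = t ^ (q - 1) * g\<^sup>2"
  define F where "F i = absv ((-\<pi>) ^ i * m i u * m i v * (u ^ (q ^ i) - v ^ (q ^ i)))" for i
  have t: "0 < t" "t \<le> g" using uv absv_diff_le[of u v] u v by (auto simp: t_def)
  have w: "0 < w" "w < 1"
  proof -
    show "0 < w" using t g by (simp add: w_def)
    have "t ^ (q - 1) * g\<^sup>2 \<le> 1 * g\<^sup>2" using t g by (intro mult_right_mono power_le_one) auto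
    also have "\<dots> < 1" using g by (simp add: power_less_one_iff)
    finally show "w < 1" by (simp add: w_def)
  qed
  have F_eq: "F i = coef g i * tau u v i" if "i \<le> Suc n" for i
    unfolding F_def using G_term_le_level[OF L u v that] .
  have low: "\<rho> < w ^ (q ^ i)" if "i < j" for i
  proof -
    have "w ^ (q ^ (j - 1)) \<le> w ^ (q ^ i)"
      using w that q_pos by (intro power_decreasing power_increasing) auto
    then show ?thesis using lower that by (simp add: w_def t_def)
  qed
  have w_pow: "w ^ (q ^ i) = (t ^ (q ^ i)) ^ (q - 1) * g ^ (2 * q ^ i)" for i
    by (simp add: w_def power_mult_distrib power_mult[symmetric] mult_ac)
  \<comment> \<open>Below \<open>j\<close>, the inequality \<open>\<rho> < w ^ (q ^ i)\<close> puts
    the q-th power of the difference above the mixed binomial terms.\<close>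
  have tau_eq: "tau u v i = t ^ (q ^ i)" if "i \<le> j" for i
    using that
  proof (induction i)
    case (Suc i)
    then have ti: "tau u v i = t ^ (q ^ i)" and ij: "i < j" by auto
    have "\<rho> * g ^ (q ^ i * (q - 1)) \<le> \<rho> * 1"
      using g rho by (intro mult_left_mono power_le_one) auto
    also have "\<dots> < w ^ (q ^ i)" using low[OF ij] by simp
    also have "\<dots> \<le> (t ^ (q ^ i)) ^ (q - 1) * 1"
      unfolding w_pow using g t by (intro mult_left_mono power_le_one) auto
    finally have "tau u v (Suc i) = tau u v i ^ q"
      using t by (intro tau_Suc_eq[OF u v]) (auto simp: ti)
    then show ?case by (simp add: ti power_mult[symmetric] mult.commute)
  qed (simp add: t_def)
  have Fj: "F j = coef g j * t ^ (q ^ j)" using F_eq[of j] tau_eq[of j] j by simp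
  have Fj_pos: "0 < F j" unfolding Fj using t g coef_pos by simp
  have inc: "F i < F (Suc i)" if "i < j" for i
  proof -
    have "F (Suc i) = coef g i * (g ^ (2 * q ^ i) / \<rho>) * (t ^ (q ^ i)) ^ q"
      using F_eq[of "Suc i"] tau_eq[of "Suc i"] that j
      by (simp add: coef_Suc power_mult[symmetric] mult.commute)
    also have "(t ^ (q ^ i)) ^ q = (t ^ (q ^ i)) ^ (q - 1) * t ^ (q ^ i)"
      using power_minus_mult[OF q_pos(1)] by (rule sym)
    also have "coef g i * (g ^ (2 * q ^ i) / \<rho>) * ((t ^ (q ^ i)) ^ (q - 1) * t ^ (q ^ i)) =
        coef g i * t ^ (q ^ i) * (w ^ (q ^ i) / \<rho>)"
      by (simp add: w_pow)
    finally have e: "F (Suc i) = F i * (w ^ (q ^ i) / \<rho>)"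
      using F_eq[of i] tau_eq[of i] that j by simp
    have "0 < F i" using F_eq[of i] tau_eq[of i] that j t g coef_pos by simp
    moreover have "1 < w ^ (q ^ i) / \<rho>" using low[OF that] rho by simp
    ultimately show ?thesis unfolding e using mult_strict_left_mono[of 1 "w ^ (q ^ i) / \<rho>" "F i"] by simp
  qed
  have chain: "F i < F (i + Suc d)" if "i + Suc d \<le> j" for i d
    using that
  proof (induction d)
    case (Suc d)
    then show ?case using inc[of "i + Suc d"] by simp
  qed (use inc in auto)
  have below: "F i < F j" if "i < j" for i
    using chain[of i "j - Suc i"] that by simp
  \<comment> \<open>From \<open>j\<close> on the differences of powers are only bounded:
    \<open>M\<close> bounds the quotient of consecutive ones and \<open>W\<close> replaces the
    powers of \<open>w\<close>. \<open>H\<close> continues by formula the values that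
    \<open>F\<close> has up to \<open>Suc n\<close>.\<close>
  define H where "H i = coef g i * tau u v i" for i
  define W where "W i = tau u v i ^ (q - 1) * g ^ (2 * q ^ i)" for i
  define M where "M i = max (tau u v i ^ (q - 1)) (\<rho> * g ^ (q ^ i * (q - 1)))" for i
  have tau_M: "tau u v (Suc i) \<le> M i * tau u v i" for i
    unfolding M_def by (rule tau_Suc_le[OF u v])
  have M_pos: "0 < M i" for i unfolding M_def using rho g by (simp add: less_max_iff_disj)
  have B_less: "\<rho> * g ^ (q ^ i * (q - 1)) \<le> \<rho>" for i
    using rho g by (intro mult_right_le_one_le power_le_one) auto
  have gpow: "g ^ N < 1" if "0 < N" for N using g that by (simp add: power_less_one_iff)
  have M_W: "M i * g ^ (2 * q ^ i) < \<rho>" if "W i < \<rho>" for i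
  proof -
    have "\<rho> * g ^ (q ^ i * (q - 1)) * g ^ (2 * q ^ i) < \<rho> * 1"
      using B_less[of i] gpow[of "2 * q ^ i"] q_pos rho g by (intro mult_le_less_imp_less) auto
    then show ?thesis using that g by (simp add: M_def W_def max_mult_distrib_right)
  qed
  \<comment> \<open>Once below \<open>\<rho>\<close>, \<open>W\<close> stays there:
    \<open>W (Suc i)\<close> is at most \<open>W i\<close> times a power of
    \<open>M i * g ^ (2 * q ^ i)\<close>, a number below 1.\<close>
  have W_small: "W i < \<rho>" if "j \<le> i" for i
    using that
  proof (induction i rule: dec_induct)
    case base
    show ?case using upper tau_eq[of j] w_pow[of j] by (simp add: W_def w_def t_def)
  next
    case (step i)
    have "W (Suc i) \<le> (M i * tau u v i) ^ (q - 1) * g ^ (2 * q ^ Suc i)"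
      unfolding W_def using tau_M g by (intro mult_right_mono power_mono) auto
    also have "g ^ (2 * q ^ Suc i) = (g ^ (2 * q ^ i)) ^ (q - 1) * g ^ (2 * q ^ i)"
      using power_minus_mult[OF q_pos(1), of "g ^ (2 * q ^ i)"] by (simp add: power_mult[symmetric] mult_ac)
    also have "(M i * tau u v i) ^ (q - 1) * ((g ^ (2 * q ^ i)) ^ (q - 1) * g ^ (2 * q ^ i)) =
        (M i * g ^ (2 * q ^ i)) ^ (q - 1) * W i"
      by (simp add: W_def power_mult_distrib mult_ac)
    also have "\<dots> \<le> 1 * W i"
      using M_W[OF step.IH] M_pos[of i] g rho
      by (intro mult_right_mono power_le_one) (auto simp: W_def)
    finally show ?case using step.IH by simp
  qed
  have H_Suc: "H (Suc i) \<le> (M i * g ^ (2 * q ^ i) / \<rho>) * H i" for i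
  proof -
    have "H (Suc i) \<le> coef g (Suc i) * (M i * tau u v i)"
      unfolding H_def using coef_pos[OF g(1), of "Suc i"] tau_M by (intro mult_left_mono) auto
    then show ?thesis by (simp add: H_def coef_Suc mult_ac)
  qed
  have H_nonneg: "0 \<le> H i" for i using coef_pos[OF g(1), of i] by (simp add: H_def)
  have H_dec: "H (Suc i) \<le> H i" if "j \<le> i" for i
  proof -
    have "(M i * g ^ (2 * q ^ i) / \<rho>) * H i \<le> 1 * H i"
      using M_W[OF W_small[OF that]] rho H_nonneg by (intro mult_right_mono) auto
    then show ?thesis using H_Suc[of i] by linarith
  qed
  have Hj: "H j = F j" using F_eq[of j] j by (simp add: H_def)
  have H_less: "H i < F j" if "j < i" for i
  proof -
    have "0 < tau u v j" using tau_eq[of j] t by simp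
    then have "0 < H j" using coef_pos[OF g(1), of j] by (simp add: H_def)
    then have "(M j * g ^ (2 * q ^ j) / \<rho>) * H j < 1 * H j"
      using M_W[OF W_small[of j]] rho by (intro mult_strict_right_mono) auto
    then have "H (Suc j) < F j" using H_Suc[of j] Hj by linarith
    with Suc_leI[OF that] show ?thesis
    proof (induction i rule: dec_induct)
      case (step i)
      then show ?case using H_dec[of i] by simp
    qed
  qed
  have tau_dec: "tau u v (Suc i) \<le> tau u v i \<and> (0 < tau u v i \<longrightarrow> tau u v (Suc i) < tau u v i)" for i
  proof -
    have "tau u v i ^ (q - 1) \<le> (g ^ (q ^ i)) ^ (q - 1)"
      using tau_le[OF u v] by (intro power_mono) auto
    also have "\<dots> < 1" using gpow[of "q ^ i * (q - 1)"] q_pos by (simp add: power_mult)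
    finally have "M i < 1" using B_less[of i] rho unfolding M_def by linarith
    then have "M i * tau u v i \<le> tau u v i" "0 < tau u v i \<Longrightarrow> M i * tau u v i < tau u v i"
      using M_pos[of i] by (auto intro: mult_left_le_one_le)
    then show ?thesis using tau_M[of i] by (metis le_less_trans order_trans)
  qed
  have tau_antimono: "tau u v i \<le> tau u v (Suc n)" if "Suc n \<le> i" for i
    using that by (induction i rule: dec_induct) (use tau_dec order_trans in blast)+
  \<comment> \<open>Past \<open>Suc n\<close> the terms no longer have the size \<open>H\<close>;
    bounded products and decreasing differences reduce them to the indices \<open>n\<close> and
    \<open>Suc n\<close>.\<close>
  have tail: "F i < F j" if "Suc n \<le> i" for i
  proof -
    have "F i = \<rho> ^ i * (absv (m i u) * absv (m i v)) * tau u v i"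
      unfolding F_def by (simp only: absv_mult absv_power absv_minus tau_def mult.assoc)
    also have "\<dots> \<le> max (coef g n) (coef g (Suc n)) * tau u v (Suc n)"
      using coef_growth_bound[OF L u v, of i] tau_antimono[OF that] that coef_pos[OF g(1), of n]
      by (intro mult_mono) (auto simp: le_max_iff_disj)
    also have "\<dots> = max (coef g n * tau u v (Suc n)) (H (Suc n))"
      by (simp add: H_def max_mult_distrib_right)
    also have "\<dots> < F j"
    proof -
      \<comment> \<open>Equality occurs for \<open>j = n\<close>; strictness is then supplied by the
        strict decrease of \<open>tau\<close> from \<open>n\<close> to \<open>Suc n\<close>.\<close>
      have "H n \<le> F j" using H_less[of n] Hj j by (cases "j = n") auto
      moreover have "coef g n * tau u v (Suc n) < H n \<or> tau u v (Suc n) = 0"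
        using tau_dec[of n] coef_pos[OF g(1), of n] tau_nonneg[of u v n] tau_nonneg[of u v "Suc n"]
        unfolding H_def by (metis antisym less_eq_real_def mult_strict_left_mono)
      ultimately have "coef g n * tau u v (Suc n) < F j" using Fj_pos by auto
      then show ?thesis using H_less[of "Suc n"] j by simp
    qed
    finally show ?thesis .
  qed
  have "F i < F j" if "i \<noteq> j" for i
    using below[of i] tail[of i] H_less[of i] F_eq[of i] that unfolding H_def
    by (metis le_SucI not_less_eq_eq linorder_neqE_nat)
  then have "absv (G k u v) = F j"
    unfolding G_def F_def using j k Fj_pos by (intro absv_sum_dominant) (auto simp: F_def)
  then show ?thesis by (simp add: Fj t_def)
qed

end

section \<open>Zeros of the approximations\<close>

locale universal_deformation_alg_closed = universal_deformation q \<pi>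
  for q :: nat and \<pi> :: "'c::{nonarch_field, complete_space, alg_closed_field}"
begin

text \<open>Here term 0 dominates, since \<open>t ^ (q - 1) * g\<^sup>2 \<le> t < \<rho>\<close> for
  \<open>t = absv (u - v)\<close>. Simplicity and separation of the roots rest on this
  isometry.\<close>

lemma G_near:
  assumes L: "level g n" and u: "absv u = g" and v: "absv v = g" and k: "n < k"
    and uv: "absv (u - v) < min g \<rho>"
  shows "absv (G k u v) = absv (u - v)"
proof (cases "u = v")
  case False
  note g = levelD[OF L]
  define t where "t = absv (u - v)"
  have t: "0 < t" "t < g" "t < \<rho>" using uv False by (auto simp: t_def)
  have "t ^ (q - 1) \<le> t ^ 1" using t rho q_ge_2 by (intro power_decreasing) auto
  moreover have "g\<^sup>2 \<le> 1" using g by (simp add: power_le_one)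
  ultimately have "t ^ (q - 1) * g\<^sup>2 \<le> t * 1" using t g by (intro mult_mono) auto
  then show ?thesis
    using absv_G[OF L u v False _ k, of 0] t by (simp add: t_def)
qed simp

lemma absv_eq_of_near: "absv v = g \<Longrightarrow> absv (u - v) < g \<Longrightarrow> absv u = g" for u v :: 'c
  using absv_add_eq_left[of "u - v" v] by simp

text \<open>The linear relation between three vectors in the plane, here the pairs of consecutive
  continuants at \<open>u\<close>, \<open>v\<close> and \<open>z\<close>. One coordinate suffices
  for it, and it can be chosen so that all coefficients have the same size.\<close>

lemma plucker:
  assumes L: "level g n" and u: "absv u = g" and v: "absv v = g" and z: "absv z = g" and k: "n < k"
  obtains a b where "absv a = 1" "absv b = 1" "G k u v = a * G k z v + b * G k u z"
proof -
  note g = levelD[OF L]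
  obtain K where K: "k = Suc K" "n \<le> K" using k by (cases k) auto
  have "even (K - n) \<or> odd (K - n)" by blast
  then obtain \<kappa> i where \<kappa>: "\<kappa> \<in> {K, Suc K}" "\<kappa> = Suc n + 2 * i"
    using K(2) by (metis add.commute add_Suc dvd_def insertCI le_add_diff_inverse oddE plus_1_eq_Suc)
  have abs_m: "absv (m \<kappa> x) = g ^ D (Suc n) / \<rho> ^ (Suc n + i)" if "absv x = g" for x
    unfolding \<kappa>(2) by (rule absv_m_odd[OF L that])
  have pos: "0 < g ^ D (Suc n) / \<rho> ^ (Suc n + i)" using g rho by simp
  have nz: "m \<kappa> x \<noteq> 0" if "absv x = g" for x
    using abs_m[OF that] pos by (metis absv_zero less_irrefl)
  have "G k u v * m \<kappa> z = G k z v * m \<kappa> u + G k u z * m \<kappa> v"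
    using \<kappa>(1) unfolding K(1) G_wedge by (auto simp: algebra_simps)
  then have "G k u v = (m \<kappa> u / m \<kappa> z) * G k z v + (m \<kappa> v / m \<kappa> z) * G k u z"
    using nz[OF z] by (simp add: field_simps)
  moreover have "absv (m \<kappa> u / m \<kappa> z) = 1" "absv (m \<kappa> v / m \<kappa> z) = 1"
    unfolding absv_divide abs_m[OF u] abs_m[OF v] abs_m[OF z] using pos
    by (metis divide_self less_irrefl)+
  ultimately show thesis by (rule that[rotated 2])
qed

lemma plucker_zero:
  assumes "level g n" "absv u = g" "absv v = g" "absv z = g" "n < k" "G k z v = 0"
  shows "absv (G k u v) = absv (G k u z)"
proof -
  obtain a b where "absv b = 1" "G k u v = a * G k z v + b * G k u z"
    using plucker[OF assms(1-5)] by metis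
  then show ?thesis using assms(6) by (simp add: absv_mult)
qed

section \<open>Roots of an approximation, counted with multiplicity\<close>

definition is_root_mset :: "nat \<Rightarrow> 'c \<Rightarrow> 'c \<Rightarrow> 'c multiset \<Rightarrow> bool" where
  "is_root_mset k v a A \<longleftrightarrow> a \<noteq> 0 \<and> (\<forall>u. G k u v = a * (\<Prod>z\<in>#A. u - z))"

lemma root_mset_exists:
  assumes L: "level g n" and v: "absv v = g" and k: "n < k"
  obtains a A where "is_root_mset k v a A"
proof -
  obtain P where P: "\<forall>u. poly P u = G k u v" using G_poly[of k v] by blast
  \<comment> \<open>A point close to \<open>v\<close>, but different from it, shows that the
    polynomial is not zero.\<close>
  have "0 < min g \<rho>" using levelD[OF L] rho by simp
  then obtain x :: 'c where x: "0 < absv x" "absv x < min g \<rho>"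
    using absv_dense[OF pi_nonzero absv_pi_less_1 order_refl] by blast
  have "absv (v + x) = g" using x v absv_add_eq_left[of x v] by simp
  then have "absv (G k (v + x) v) = absv x" using G_near[OF L _ v k, of "v + x"] x by simp
  then have "P \<noteq> 0" using P x by force
  then obtain A where A: "\<And>x. poly P x = lead_coeff P * (\<Prod>z\<in>#A. x - z)"
    using poly_root_mset by blast
  have "is_root_mset k v (lead_coeff P) A"
    unfolding is_root_mset_def using A P \<open>P \<noteq> 0\<close> by auto
  then show thesis by (rule that)
qed

lemma in_root_mset_iff: "is_root_mset k v a A \<Longrightarrow> x \<in># A \<longleftrightarrow> G k x v = 0"
  by (auto simp: is_root_mset_def prod_mset_zero_iff)

lemma root_mset_count:
  assumes A: "is_root_mset k v a A" and "0 \<le> r\<^sub>1" "r\<^sub>1 < r\<^sub>2" "0 < C"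
    and "\<And>x. r\<^sub>1 < absv (x - c) \<Longrightarrow> absv (x - c) < r\<^sub>2 \<Longrightarrow> absv (G k x v) = C * absv (x - c) ^ N"
  shows "size (filter_mset (\<lambda>z. absv (z - c) \<le> r\<^sub>1) A) = N"
proof (rule root_count_annulus[OF pi_nonzero absv_pi_less_1 assms(2-4)])
  show "a \<noteq> 0" using A by (simp add: is_root_mset_def)
  fix x assume "r\<^sub>1 < absv (x - c)" "absv (x - c) < r\<^sub>2"
  then show "absv (a * (\<Prod>z\<in>#A. x - z)) = C * absv (x - c) ^ N"
    using assms(5)[of x] A by (simp add: is_root_mset_def)
qed

text \<open>The relation of \<open>plucker\<close> replaces \<open>G k x v\<close> by
  \<open>G k x z\<close> up to an error of size \<open>e\<close>, so it grows linearly around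
  \<open>z\<close>. With \<open>e = 0\<close> this says that a root is simple; with positive
  \<open>e\<close> it locates a root near an approximate one.\<close>

lemma one_root_near:
  assumes L: "level g n" and v: "absv v = g" and z: "absv z = g" and k: "n < k"
    and A: "is_root_mset k v a A" and e: "0 \<le> e" "e < min g \<rho>" "absv (G k z v) \<le> e"
  shows "size (filter_mset (\<lambda>x. absv (x - z) \<le> e) A) = 1"
proof (rule root_mset_count[OF A e(1,2), of 1])
  fix x assume x: "e < absv (x - z)" "absv (x - z) < min g \<rho>"
  have xg: "absv x = g" using absv_eq_of_near[OF z] x(2) by simp
  obtain c b where cb: "absv c = 1" "absv b = 1" "G k x v = c * G k z v + b * G k x z"
    using plucker[OF L xg v z k] .
  have "absv (b * G k x z) = absv (x - z)"
    using G_near[OF L xg z k x(2)] cb by (simp add: absv_mult)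
  moreover have "absv (c * G k z v) \<le> e" using cb e by (simp add: absv_mult)
  ultimately show "absv (G k x v) = 1 * absv (x - z) ^ 1"
    unfolding cb(3) using x(1) by (simp add: absv_add_eq_right)
qed simp

text \<open>Roots on the sphere are simple, so the multiset count is a count of points as long as
  \<open>Q\<close> selects only such roots.\<close>

lemma root_mset_card:
  assumes L: "level g n" and v: "absv v = g" and k: "n < k"
    and A: "is_root_mset k v a A" and Q: "\<And>x. G k x v = 0 \<Longrightarrow> Q x \<Longrightarrow> absv x = g"
  shows "size (filter_mset Q A) = card {x. G k x v = 0 \<and> Q x}"
proof -
  have "size (filter_mset Q A) = (\<Sum>x\<in>set_mset (filter_mset Q A). count (filter_mset Q A) x)"
    by (rule size_multiset_overloaded_eq)
  also have "\<dots> = (\<Sum>x\<in>set_mset (filter_mset Q A). 1)"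
  proof (rule sum.cong[OF refl])
    fix x assume x: "x \<in> set_mset (filter_mset Q A)"
    then have "G k x v = 0" "absv x = g" using in_root_mset_iff[OF A] Q by auto
    moreover have "0 < min g \<rho>" using levelD[OF L] rho by simp
    ultimately have "size (filter_mset (\<lambda>y. absv (y - x) \<le> 0) A) = 1"
      by (intro one_root_near[OF L v _ k A]) auto
    also have "(\<lambda>y. absv (y - x) \<le> 0) = (\<lambda>y. y = x)"
      by (intro ext) (metis absv_eq_0_iff absv_nonneg antisym eq_iff_diff_eq_0 order_refl)
    finally show "count (filter_mset Q A) x = 1" using x by (simp add: filter_eq_replicate_mset)
  qed
  also have "\<dots> = card (set_mset (filter_mset Q A))" by simp
  also have "set_mset (filter_mset Q A) = {x. G k x v = 0 \<and> Q x}"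
    using in_root_mset_iff[OF A] by auto
  finally show ?thesis .
qed

text \<open>The distance at which terms \<open>j - 1\<close> and \<open>j\<close> of
  \<open>G\<close> balance. The value 0 at \<open>j = 0\<close> makes the innermost disc the single
  point at its centre.\<close>

definition radius :: "real \<Rightarrow> nat \<Rightarrow> real" where
  "radius g j = (if j = 0 then 0 else root (q ^ j - q ^ (j - 1)) (\<rho> / g ^ (2 * q ^ (j - 1))))"

lemma radius_nonneg: "0 < g \<Longrightarrow> 0 \<le> radius g j"
  using rho by (auto simp: radius_def intro!: real_root_ge_zero)

text \<open>This rephrases the position of \<open>t\<close> relative to a critical radius in the
  form of the hypotheses \<open>lower\<close> and \<open>upper\<close> of
  \<open>absv_G\<close>.\<close>

lemma radius_compare:
  assumes g: "0 < g" and t: "0 \<le> t"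
  shows "radius g (Suc j) < t \<longleftrightarrow> \<rho> < (t ^ (q - 1) * g\<^sup>2) ^ (q ^ j)" (is ?less)
    and "t < radius g (Suc j) \<longleftrightarrow> (t ^ (q - 1) * g\<^sup>2) ^ (q ^ j) < \<rho>" (is ?greater)
proof -
  define N where "N = q ^ Suc j - q ^ j"
  have N: "N = (q - 1) * q ^ j" by (simp add: N_def algebra_simps)
  have N0: "0 < N" using q_ge_2 by (simp add: N)
  have r: "radius g (Suc j) = root N (\<rho> / g ^ (2 * q ^ j))" by (simp add: radius_def N_def)
  have rN: "radius g (Suc j) ^ N = \<rho> / g ^ (2 * q ^ j)"
    unfolding r using g rho N0 by (intro real_root_pow_pos2) auto
  have r0: "0 \<le> radius g (Suc j)" using radius_nonneg[OF g] .
  have w: "(t ^ (q - 1) * g\<^sup>2) ^ (q ^ j) = t ^ N * g ^ (2 * q ^ j)"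
    by (simp add: N power_mult_distrib flip: power_mult)
  have lt: "x < y \<longleftrightarrow> x ^ N < y ^ N" if "0 \<le> x" "0 \<le> y" for x y :: real
    using that N0 by (metis power_strict_mono power_less_imp_less_base)
  show ?less unfolding lt[OF r0 t] rN w using g by (simp add: pos_divide_less_eq)
  show ?greater unfolding lt[OF t r0] rN w using g by (simp add: pos_less_divide_eq)
qed

lemma radius_strict_mono:
  assumes g: "0 < g" "g < 1"
  shows "radius g j < radius g (Suc j)"
proof (cases j)
  case 0
  have "0 < radius g (Suc 0)" using radius_compare(2)[OF g(1) order_refl, of 0] rho q_ge_2
    by (simp add: power_0_left)
  then show ?thesis using 0 by (simp add: radius_def)
next
  case (Suc i)
  define t where "t = radius g (Suc j)"
  define w where "w = t ^ (q - 1) * g\<^sup>2"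
  have t: "0 \<le> t" using radius_nonneg[OF g(1)] by (simp add: t_def)
  have wj: "w ^ (q ^ j) = \<rho>" using radius_compare[OF g(1) t, of j] by (simp add: t_def w_def)
  have w0: "0 \<le> w" using t by (simp add: w_def)
  have "w < 1" using wj rho one_le_power[of w "q ^ j"] by linarith
  moreover have "0 < w" using wj w0 rho q_pos by (metis less_eq_real_def power_0_left less_irrefl)
  ultimately have "w ^ (q ^ j) < w ^ (q ^ i)"
    using Suc q_ge_2 by (intro power_strict_decreasing power_strict_increasing) auto
  then have "radius g (Suc i) < t" using radius_compare(1)[OF g(1) t, of i] wj by (simp add: w_def)
  then show ?thesis by (simp add: t_def Suc)
qed

text \<open>For \<open>t = g\<close> the expression of \<open>radius_compare\<close> becomes that in
  \<open>level\<close>; thus the level tells which critical radii are below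
  \<open>g\<close>.\<close>

lemma power_level: "(g ^ (q - 1) * g\<^sup>2) ^ (q ^ j) = (g::real) ^ ((q + 1) * q ^ j)"
proof -
  have "q - 1 + 2 = q + 1" using q_ge_2 by simp
  then show ?thesis by (simp only: power_add[symmetric] power_mult[symmetric])
qed

lemma radius_less_level:
  assumes L: "level g n" and "j \<le> n"
  shows "radius g j < g"
proof (cases j)
  case (Suc i)
  then show ?thesis
    using levelD(3)[OF L, of i] assms(2) radius_compare(1)[of g g i] levelD(1)[OF L] power_level[of g i]
    by simp
qed (use levelD[OF L] in \<open>simp add: radius_def\<close>)

section \<open>Zeros on the sphere and their distances from the centre\<close>

definition zeros :: "real \<Rightarrow> nat \<Rightarrow> 'c \<Rightarrow> 'c set" where
  "zeros g k v = {z. absv z = g \<and> G k z v = 0}"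

lemma finite_zeros: "level g n \<Longrightarrow> absv v = g \<Longrightarrow> n < k \<Longrightarrow> finite (zeros g k v)"
proof -
  assume "level g n" "absv v = g" "n < k"
  then obtain a A where "is_root_mset k v a A" by (rule root_mset_exists)
  then have "zeros g k v \<subseteq> set_mset A" using in_root_mset_iff by (auto simp: zeros_def)
  then show ?thesis by (rule finite_subset) simp
qed

text \<open>The last region ends at \<open>g\<close> because closeness below \<open>g\<close>
  guarantees that \<open>x\<close> lies on the sphere; the critical radius of index
  \<open>Suc n\<close> is at least \<open>g\<close> by the definition of the level.\<close>

lemma absv_G_region:
  assumes L: "level g n" and v: "absv v = g" and k: "n < k" and j: "j \<le> n"
    and x: "radius g j < absv (x - v)" "absv (x - v) < (if j < n then radius g (Suc j) else g)"
  shows "absv (G k x v) = coef g j * absv (x - v) ^ (q ^ j)"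
proof (rule absv_G[OF L _ v _ j k])
  note g = levelD[OF L]
  have t: "0 \<le> absv (x - v)" "absv (x - v) < g"
    using x radius_less_level[OF L, of "Suc j"] by (auto split: if_splits)
  show "absv x = g" using absv_eq_of_near[OF v t(2)] .
  show "x \<noteq> v" using x(1) radius_nonneg[OF g(1), of j] by auto
  show "\<rho> < (absv (x - v) ^ (q - 1) * g\<^sup>2) ^ q ^ (j - 1)" if "0 < j"
    using x(1) radius_compare(1)[OF g(1) t(1), of "j - 1"] that by simp
  show "(absv (x - v) ^ (q - 1) * g\<^sup>2) ^ q ^ j < \<rho>"
  proof (cases "j < n")
    case True
    then show ?thesis using x(2) radius_compare(2)[OF g(1) t(1), of j] by simp
  next
    case False
    have "(absv (x - v) ^ (q - 1) * g\<^sup>2) ^ q ^ j < (g ^ (q - 1) * g\<^sup>2) ^ q ^ j"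
      using t g q_ge_2 by (intro power_strict_mono mult_strict_right_mono) auto
    also have "\<dots> \<le> \<rho>" using g(4) False j by (simp only: power_level) simp
    finally show ?thesis .
  qed
qed

text \<open>Taken together for consecutive \<open>j\<close>, the two parts place the zeros outside
  one disc and inside the next exactly at the critical radius.\<close>

lemma zeros_region:
  assumes L: "level g n" and v: "absv v = g" and k: "n < k" and j: "j \<le> n"
  shows "card {z \<in> zeros g k v. absv (z - v) \<le> radius g j} = q ^ j"
    and "z \<in> zeros g k v \<Longrightarrow> radius g j < absv (z - v) \<Longrightarrow>
      (if j < n then radius g (Suc j) else g) \<le> absv (z - v)"
proof -
  note g = levelD[OF L]
  obtain a A where A: "is_root_mset k v a A" using root_mset_exists[OF L v k] .
  have less: "radius g j < (if j < n then radius g (Suc j) else g)"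
    using radius_strict_mono[OF g(1,2), of j] radius_less_level[OF L j] by auto
  have "size (filter_mset (\<lambda>z. absv (z - v) \<le> radius g j) A) = q ^ j"
    by (rule root_mset_count[OF A radius_nonneg[OF g(1)] less coef_pos[OF g(1)] absv_G_region[OF L v k j]])
  moreover have "absv x = g" if "absv (x - v) \<le> radius g j" for x
    using absv_eq_of_near[OF v] radius_less_level[OF L j] that by (meson le_less_trans)
  ultimately have "card {z. G k z v = 0 \<and> absv (z - v) \<le> radius g j} = q ^ j"
    using root_mset_card[OF L v k A, of "\<lambda>z. absv (z - v) \<le> radius g j"] by simp
  also have "{z. G k z v = 0 \<and> absv (z - v) \<le> radius g j} = {z \<in> zeros g k v. absv (z - v) \<le> radius g j}"
    using \<open>\<And>x. absv (x - v) \<le> radius g j \<Longrightarrow> absv x = g\<close> by (auto simp: zeros_def)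
  finally show "card {z \<in> zeros g k v. absv (z - v) \<le> radius g j} = q ^ j" .
  assume z: "z \<in> zeros g k v" "radius g j < absv (z - v)"
  show "(if j < n then radius g (Suc j) else g) \<le> absv (z - v)"
  proof (rule ccontr)
    assume "\<not> ?thesis"
    then have "0 = coef g j * absv (z - v) ^ (q ^ j)"
      using absv_G_region[OF L v k j z(2)] z(1) by (simp add: zeros_def)
    moreover have "0 < absv (z - v)" using z(2) radius_nonneg[OF g(1), of j] by linarith
    ultimately show False using coef_pos[OF g(1), of j] by simp
  qed
qed

text \<open>Away from the boundary case term \<open>n\<close> still dominates at distance
  \<open>g\<close>, the largest distance possible on the sphere.\<close>

lemma zeros_dist_less:
  assumes L: "level g n" and v: "absv v = g" and k: "n < k"
    and strict: "g ^ ((q + 1) * q ^ n) < \<rho>" and z: "z \<in> zeros g k v"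
  shows "absv (z - v) < g"
proof (rule ccontr)
  note g = levelD[OF L]
  have zg: "absv z = g" and Gz: "G k z v = 0" using z by (auto simp: zeros_def)
  assume "\<not> absv (z - v) < g"
  then have t: "absv (z - v) = g" using absv_diff_le[of z v] zg v by simp
  then have "z \<noteq> v" using g by auto
  have "absv (G k z v) = coef g n * absv (z - v) ^ (q ^ n)"
  proof (rule absv_G[OF L zg v \<open>z \<noteq> v\<close> order_refl k])
    show "\<rho> < (absv (z - v) ^ (q - 1) * g\<^sup>2) ^ q ^ (n - 1)" if "0 < n"
      unfolding t power_level using that by (intro g(3)) simp
    show "(absv (z - v) ^ (q - 1) * g\<^sup>2) ^ q ^ n < \<rho>"
      unfolding t power_level by (rule strict)
  qed
  then show False using coef_pos[OF g(1), of n] g t Gz by simp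
qed

text \<open>Around the origin the growth exponent is \<open>D n\<close> just inside the sphere and
  \<open>D (Suc (Suc n))\<close> just outside; the difference is the number of zeros on it. The
  parity of \<open>k\<close> makes the size of \<open>m k v\<close> known exactly.\<close>

lemma card_zeros_boundary:
  assumes L: "level g n" and v: "absv v = g" and eq: "g ^ ((q + 1) * q ^ n) = \<rho>"
    and k: "k = Suc n + 2 * Suc i"
  shows "card (zeros g k v) = q ^ n + q ^ Suc n"
proof -
  note g = levelD[OF L]
  have nk: "n < k" using k by simp
  \<comment> \<open>The index \<open>k - 1\<close>, read in two ways: it has the parity of the level
    \<open>n\<close> for points inside the sphere, and that of \<open>Suc (Suc n)\<close> for points
    outside, where the level is \<open>Suc n\<close>.\<close>
  define K where "K = n + 2 * Suc i"
  have K: "k = Suc K" "K = Suc (Suc n) + 2 * i" by (simp_all add: k K_def)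
  obtain a A where A: "is_root_mset k v a A" using root_mset_exists[OF L v nk] .
  have absG: "absv (G k x v) = \<rho> ^ k * absv (m k x * m K v - m K x * m k v)" for x
    unfolding K(1) G_wedge by (simp add: absv_mult)
  have vk: "absv (m k v) = g ^ D (Suc n) / \<rho> ^ (Suc n + Suc i)"
    unfolding k by (rule absv_m_odd[OF L v])
  have vK: "absv (m K v) \<le> g ^ D n / \<rho> ^ (n + Suc i)"
    unfolding K_def by (rule absv_m_even_le[OF L v])
  have pow_less: "x ^ N < y ^ N" if "0 \<le> x" "x < y" "0 < N" for x y :: real and N :: nat
    using that by (intro power_strict_mono) auto
  \<comment> \<open>The neighbouring exceptional radii, of indices \<open>n - 1\<close> and
    \<open>Suc n\<close>. Between \<open>r\<^sub>1\<close> and \<open>g\<close> the level is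
    \<open>n\<close>, between \<open>g\<close> and \<open>r\<^sub>2\<close> it is
    \<open>Suc n\<close>.\<close>
  define r\<^sub>1 where "r\<^sub>1 = (if n = 0 then 0 else root ((q + 1) * q ^ (n - 1)) \<rho>)"
  define r\<^sub>2 where "r\<^sub>2 = root ((q + 1) * q ^ Suc n) \<rho>"
  have r1_pow: "r\<^sub>1 ^ ((q + 1) * q ^ (n - 1)) = \<rho>" if "n \<noteq> 0"
    using that rho q_pos by (simp only: r\<^sub>1_def if_False) (intro real_root_pow_pos2, auto)
  have r2_pow: "r\<^sub>2 ^ ((q + 1) * q ^ Suc n) = \<rho>"
    using rho q_pos unfolding r\<^sub>2_def by (intro real_root_pow_pos2) auto
  have r1: "0 \<le> r\<^sub>1" "r\<^sub>1 < g"
  proof -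
    show "0 \<le> r\<^sub>1" using rho by (auto simp: r\<^sub>1_def intro!: real_root_ge_zero)
    show "r\<^sub>1 < g"
    proof (cases "n = 0")
      case False
      then have "r\<^sub>1 ^ ((q + 1) * q ^ (n - 1)) < g ^ ((q + 1) * q ^ (n - 1))"
        unfolding r1_pow[OF False] by (intro g(3)) simp
      then show ?thesis by (rule power_less_imp_less_base) (use g in simp)
    qed (use g in \<open>simp add: r\<^sub>1_def\<close>)
  qed
  have gq: "g ^ ((q + 1) * q ^ Suc n) < \<rho>"
  proof -
    have "g ^ ((q + 1) * q ^ Suc n) < g ^ ((q + 1) * q ^ n)"
      using g q_pos by (intro power_strict_decreasing mult_strict_left_mono power_strict_increasing) auto
    then show ?thesis using eq by simp
  qed
  have r2: "g < r\<^sub>2" "r\<^sub>2 < 1"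
  proof -
    have "0 \<le> r\<^sub>2" using rho unfolding r\<^sub>2_def by (intro real_root_ge_zero) simp
    show "g < r\<^sub>2"
      using gq \<open>0 \<le> r\<^sub>2\<close> unfolding r2_pow[symmetric] by (rule power_less_imp_less_base)
    show "r\<^sub>2 < 1" using r2_pow rho one_le_power[of "r\<^sub>2" "(q + 1) * q ^ Suc n"] by linarith
  qed
  have level_below: "level r n" "r ^ ((q + 1) * q ^ n) < \<rho>" if r: "r\<^sub>1 < r" "r < g" for r
  proof -
    have r0: "0 < r" "r < 1" using r r1 g by auto
    show s: "r ^ ((q + 1) * q ^ n) < \<rho>"
      using pow_less[of r g "(q + 1) * q ^ n"] r0 r q_pos eq by simp
    have "\<rho> < r ^ ((q + 1) * q ^ j)" if "j < n" for j
    proof -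
      have "\<rho> < r ^ ((q + 1) * q ^ (n - 1))"
        using r1_pow pow_less[of r\<^sub>1 r "(q + 1) * q ^ (n - 1)"] that r r1 q_pos by simp
      also have "\<dots> \<le> r ^ ((q + 1) * q ^ j)"
        using r0 that q_pos by (intro power_decreasing mult_left_mono power_increasing) auto
      finally show ?thesis .
    qed
    then show "level r n" using r0 s by (simp add: level_def)
  qed
  have level_above: "level r (Suc n)" if r: "g < r" "r < r\<^sub>2" for r
  proof -
    have r0: "0 < r" "r < 1" using r r2 g by auto
    have "\<rho> < r ^ ((q + 1) * q ^ j)" if "j < Suc n" for j
    proof -
      have "\<rho> \<le> g ^ ((q + 1) * q ^ j)" using g(3)[of j] eq that by (cases "j = n") auto
      also have "\<dots> < r ^ ((q + 1) * q ^ j)" using pow_less r g q_pos by simp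
      finally show ?thesis .
    qed
    moreover have "r ^ ((q + 1) * q ^ Suc n) < \<rho>"
      using pow_less[of r "r\<^sub>2" "(q + 1) * q ^ Suc n"] r r0 q_pos r2_pow by simp
    ultimately show ?thesis using r0 by (simp add: level_def del: power_Suc)
  qed
  define C\<^sub>1 where "C\<^sub>1 = \<rho> ^ k * (g ^ D (Suc n) / \<rho> ^ (Suc n + Suc i) / \<rho> ^ (n + Suc i))"
  define C\<^sub>2 where "C\<^sub>2 = \<rho> ^ k * (g ^ D (Suc n) / \<rho> ^ (Suc n + Suc i) / \<rho> ^ (Suc (Suc n) + i))"
  have C: "0 < C\<^sub>1" "0 < C\<^sub>2" using g rho by (auto simp: C\<^sub>1_def C\<^sub>2_def)
  \<comment> \<open>Both here and in \<open>above\<close> the product \<open>m K x * m k v\<close>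
    dominates, so the exponent is that of \<open>m K x\<close>.\<close>
  have below: "absv (G k x v) = C\<^sub>1 * absv x ^ D n" if x: "r\<^sub>1 < absv x" "absv x < g" for x
  proof -
    note Lx = level_below(1)[OF x] and sx = level_below(2)[OF x]
    have x0: "0 < absv x" using x r1 by linarith
    have xk: "absv (m k x) = absv x ^ D (Suc n) / \<rho> ^ (Suc n + Suc i)"
      unfolding k by (rule absv_m_odd[OF Lx refl])
    have xK: "absv (m K x) = absv x ^ D n / \<rho> ^ (n + Suc i)"
      unfolding K_def by (rule absv_m_even[OF Lx refl sx])
    have "absv (m k x * m K v) \<le> (absv x ^ D (Suc n) / \<rho> ^ (Suc n + Suc i)) * (g ^ D n / \<rho> ^ (n + Suc i))"
      unfolding absv_mult xk using vK rho by (intro mult_left_mono) auto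
    also have "\<dots> = absv x ^ (q ^ n) * (absv x ^ D n * g ^ D n / \<rho> ^ (Suc n + Suc i) / \<rho> ^ (n + Suc i))"
      by (simp add: power_add)
    also have "\<dots> < g ^ (q ^ n) * (absv x ^ D n * g ^ D n / \<rho> ^ (Suc n + Suc i) / \<rho> ^ (n + Suc i))"
      using pow_less[of "absv x" g "q ^ n"] x x0 q_pos g rho by (intro mult_strict_right_mono) auto
    also have "\<dots> = absv (m K x * m k v)" by (simp add: absv_mult xK vk power_add mult_ac)
    finally have "absv (m k x * m K v - m K x * m k v) = absv (m K x * m k v)"
      using absv_add_eq_right[of "m k x * m K v" "- (m K x * m k v)"] by simp
    then show ?thesis unfolding absG by (simp add: absv_mult xK vk C\<^sub>1_def mult_ac)
  qed
  have above: "absv (G k x v) = C\<^sub>2 * absv x ^ D (Suc (Suc n))" if x: "g < absv x" "absv x < r\<^sub>2" for x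
  proof -
    note Lx = level_above[OF x]
    have x0: "0 < absv x" using x g by linarith
    have xk: "absv (m k x) \<le> absv x ^ D (Suc n) / \<rho> ^ (Suc n + Suc i)"
      unfolding k by (rule absv_m_even_le[OF Lx refl])
    have xK: "absv (m K x) = absv x ^ D (Suc (Suc n)) / \<rho> ^ (Suc (Suc n) + i)"
      unfolding K(2) by (rule absv_m_odd[OF Lx refl])
    have "\<rho> = g ^ (q ^ Suc n) * g ^ (q ^ n)" using eq by (simp add: algebra_simps flip: power_add)
    also have "\<dots> < absv x ^ (q ^ Suc n) * g ^ (q ^ n)"
      using pow_less[of g "absv x" "q ^ Suc n"] x g q_pos by (intro mult_strict_right_mono) auto
    finally have rho_less: "\<rho> < absv x ^ (q ^ Suc n) * g ^ (q ^ n)" .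
    have "absv (m k x * m K v) \<le> (absv x ^ D (Suc n) / \<rho> ^ (Suc n + Suc i)) * (g ^ D n / \<rho> ^ (n + Suc i))"
      unfolding absv_mult using xk vK g rho by (intro mult_mono) auto
    also have "\<dots> = \<rho> * (absv x ^ D (Suc n) * g ^ D n / \<rho> ^ (Suc n + Suc i) / \<rho> ^ (Suc (Suc n) + i))"
      using rho by simp
    also have "\<dots> < (absv x ^ (q ^ Suc n) * g ^ (q ^ n)) *
        (absv x ^ D (Suc n) * g ^ D n / \<rho> ^ (Suc n + Suc i) / \<rho> ^ (Suc (Suc n) + i))"
      using rho_less x0 g rho by (intro mult_strict_right_mono) auto
    also have "\<dots> = absv (m K x * m k v)" by (simp add: absv_mult xK vk power_add mult_ac)
    finally have "absv (m k x * m K v - m K x * m k v) = absv (m K x * m k v)"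
      using absv_add_eq_right[of "m k x * m K v" "- (m K x * m k v)"] by simp
    then show ?thesis unfolding absG by (simp add: absv_mult xK vk C\<^sub>2_def mult_ac del: D_Suc)
  qed
  have n1: "size (filter_mset (\<lambda>z. absv (z - 0) \<le> r\<^sub>1) A) = D n"
    using below by (intro root_mset_count[OF A r1 C(1)]) simp
  have n2: "size (filter_mset (\<lambda>z. absv (z - 0) \<le> g) A) = D (Suc (Suc n))"
    using above g(1) by (intro root_mset_count[OF A _ r2(1) C(2)]) (simp_all del: D_Suc)
  have "filter_mset (\<lambda>z. absv (z - 0) \<le> g) A =
      filter_mset (\<lambda>z. absv (z - 0) \<le> r\<^sub>1) A + filter_mset (\<lambda>z. absv z = g) A"
  proof (rule multiset_eqI)
    fix x
    have "x \<notin># A" if "r\<^sub>1 < absv x" "absv x < g"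
    proof -
      have "0 < C\<^sub>1 * absv x ^ D n"
        using C(1) that r1 by (intro mult_pos_pos zero_less_power) linarith+
      then have "G k x v \<noteq> 0" using below[OF that] by (metis absv_zero less_irrefl)
      then show ?thesis using in_root_mset_iff[OF A] by simp
    qed
    then have "count A x = 0" if "r\<^sub>1 < absv x" "absv x < g" using that by (simp add: not_in_iff)
    then show "count (filter_mset (\<lambda>z. absv (z - 0) \<le> g) A) x =
        count (filter_mset (\<lambda>z. absv (z - 0) \<le> r\<^sub>1) A + filter_mset (\<lambda>z. absv z = g) A) x"
      using r1 by auto
  qed
  then have "D (Suc (Suc n)) = D n + size (filter_mset (\<lambda>z. absv z = g) A)"
    using n1 n2 by simp
  moreover have "size (filter_mset (\<lambda>z. absv z = g) A) = card (zeros g k v)"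
    using root_mset_card[OF L v nk A, of "\<lambda>z. absv z = g"]
    by (simp add: zeros_def conj_commute)
  ultimately show ?thesis by simp
qed

end

section \<open>Passing to the limit\<close>

lemma proj_point_eq_iff:
  fixes a b a' b' :: "'a::field"
  assumes "(a, b) \<noteq> (0, 0)" "(a', b') \<noteq> (0, 0)"
  shows "proj_point a b = proj_point a' b' \<longleftrightarrow> a * b' = a' * b"
proof
  assume eq: "proj_point a b = proj_point a' b'"
  have "(a, b) \<in> proj_point a b"
    using assms(1) by (auto simp: proj_point_def proj_rel_def intro!: exI[of _ 1])
  then show "a * b' = a' * b"
    unfolding eq by (auto simp: proj_point_def proj_rel_def)
next
  assume eq: "a * b' = a' * b"
  obtain c where c: "c \<noteq> 0" "a' = c * a" "b' = c * b"
  proof (cases "a = 0")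
    case True
    then have "b \<noteq> 0" "a' = 0" "b' \<noteq> 0" using assms eq by auto
    then show thesis using True by (intro that[of "b' / b"]) auto
  next
    case False
    then have "b' = a' / a * b" using eq by (simp add: field_simps)
    moreover have "a' \<noteq> 0" using False assms(2) calculation by auto
    ultimately show thesis using False by (intro that[of "a' / a"]) auto
  qed
  have "(\<exists>d. d \<noteq> 0 \<and> x = d * a \<and> y = d * b) \<longleftrightarrow> (\<exists>d. d \<noteq> 0 \<and> x = d * a' \<and> y = d * b')" for x y
  proof
    assume "\<exists>d. d \<noteq> 0 \<and> x = d * a \<and> y = d * b"
    then obtain d where "d \<noteq> 0" "x = d * a" "y = d * b" by blast
    then show "\<exists>d. d \<noteq> 0 \<and> x = d * a' \<and> y = d * b'"
      using c by (intro exI[of _ "d / c"]) simp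
  next
    assume "\<exists>d. d \<noteq> 0 \<and> x = d * a' \<and> y = d * b'"
    then obtain d where "d \<noteq> 0" "x = d * a'" "y = d * b'" by blast
    then show "\<exists>d. d \<noteq> 0 \<and> x = d * a \<and> y = d * b"
      using c by (intro exI[of _ "d * c"]) (simp add: mult.assoc)
  qed
  then show "proj_point a b = proj_point a' b'"
    using assms by (auto simp: proj_point_def proj_rel_def)
qed

context universal_deformation_alg_closed
begin

section \<open>Convergence of the approximate periods\<close>

lemma power_q_tendsto_zero:
  fixes g C :: real
  assumes "0 < g" "g < 1"
  shows "(\<lambda>k. C * g ^ (q ^ k)) \<longlonglongrightarrow> 0"
proof -
  have "strict_mono (\<lambda>k. q ^ k)" using q_pos by (intro strict_monoI power_strict_increasing) auto
  then have "(\<lambda>k. g ^ (q ^ k)) \<longlonglongrightarrow> 0"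
    using LIMSEQ_subseq_LIMSEQ[OF LIMSEQ_realpow_zero[of g]] assms by (simp add: o_def)
  from tendsto_mult_left[OF this, of C] show ?thesis by simp
qed

lemma power_q_decseq:
  fixes g C :: real
  assumes "0 < g" "g < 1" "0 \<le> C"
  shows "decseq (\<lambda>k. C * g ^ (q ^ k))"
  using assms q_pos by (intro decseq_SucI mult_left_mono power_decreasing power_increasing) auto

definition growth :: "real \<Rightarrow> nat \<Rightarrow> real" where
  "growth g n = max (g ^ D n / \<rho> ^ n) (g ^ D (Suc n) / \<rho> ^ Suc n)"

text \<open>The factor \<open>\<rho> ^ (j div 2)\<close> cancels the growth by
  \<open>1 / \<rho>\<close> at every second index; consecutive approximate periods then differ by at
  most a constant times \<open>g ^ (q ^ N)\<close>.\<close>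

lemma growth_bound:
  assumes L: "level g n" and u: "absv u = g" and j: "n \<le> j"
  shows "\<rho> ^ (j div 2) * absv (m j u) \<le> growth g n"
proof -
  note g = levelD[OF L]
  have "even (j - n) \<or> odd (j - n)" by blast
  then consider i where "j = n + 2 * i" | i where "j = Suc n + 2 * i"
    using j by (metis add.commute add_Suc dvd_def le_add_diff_inverse oddE plus_1_eq_Suc)
  then show ?thesis
  proof cases
    case (1 i)
    have "\<rho> ^ (j div 2) * absv (m j u) \<le> \<rho> ^ i * (g ^ D n / \<rho> ^ (n + i))"
      using absv_m_even_le[OF L u, of i] rho g 1 by (intro mult_mono power_decreasing) auto
    also have "\<dots> = g ^ D n / \<rho> ^ n" using rho by (simp add: power_add)
    finally show ?thesis by (simp add: growth_def)
  next
    case (2 i)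
    have "\<rho> ^ (j div 2) * absv (m j u) \<le> \<rho> ^ i * (g ^ D (Suc n) / \<rho> ^ (Suc n + i))"
      using absv_m_odd[OF L u, of i] rho g 2 by (intro mult_mono power_decreasing) auto
    also have "\<dots> = g ^ D (Suc n) / \<rho> ^ Suc n" using rho by (simp add: power_add)
    finally show ?thesis by (simp add: growth_def)
  qed
qed

lemma growth_nonneg: "0 < g \<Longrightarrow> 0 \<le> growth g n"
  using rho by (simp add: growth_def le_max_iff_disj)

lemma period_step_le:
  assumes L: "level g n" and u: "absv u = g" and N: "n \<le> j" "N \<le> j" "N = j div 2"
  shows "absv (\<pi> ^ N * (u ^ (q ^ j) * m j u)) \<le> growth g n * g ^ (q ^ N)"
proof -
  note g = levelD[OF L]
  have "absv (\<pi> ^ N * (u ^ (q ^ j) * m j u)) = (\<rho> ^ (j div 2) * absv (m j u)) * g ^ (q ^ j)"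
    by (simp add: absv_mult u N(3))
  also have "\<dots> \<le> growth g n * g ^ (q ^ N)"
    using growth_bound[OF L u N(1)] growth_nonneg[OF g(1)] g q_pos N(2)
    by (intro mult_mono power_decreasing power_increasing) auto
  finally show ?thesis .
qed

lemma phi0_tendsto:
  assumes L: "level g n" and u: "absv u = g"
  shows "(\<lambda>N. \<pi> ^ N * m (2 * N) u) \<longlonglongrightarrow> phi0 q \<pi> u"
proof -
  note g = levelD[OF L]
  obtain l where l: "(\<lambda>N. \<pi> ^ N * m (2 * N) u) \<longlonglongrightarrow> l"
  proof (rule nonarch_convergent[OF power_q_tendsto_zero[OF g(1,2)] _ power_q_decseq[OF g(1,2) growth_nonneg[OF g(1)]]])
    fix N assume "n \<le> N"
    have "\<pi> ^ Suc N * m (2 * Suc N) u = \<pi> ^ N * (\<pi> * m (Suc (Suc (2 * N))) u)" by simp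
    also have "\<dots> = \<pi> ^ N * (u ^ (q ^ Suc (2 * N)) * m (Suc (2 * N)) u) + \<pi> ^ N * m (2 * N) u"
      unfolding m_Suc_Suc by (simp add: algebra_simps)
    finally have "\<pi> ^ Suc N * m (2 * Suc N) u - \<pi> ^ N * m (2 * N) u =
        \<pi> ^ N * (u ^ (q ^ Suc (2 * N)) * m (Suc (2 * N)) u)" by simp
    then show "absv (\<pi> ^ Suc N * m (2 * Suc N) u - \<pi> ^ N * m (2 * N) u) \<le> growth g n * g ^ (q ^ N)"
      using period_step_le[OF L u, of "Suc (2 * N)" N] \<open>n \<le> N\<close> by simp
  qed
  moreover have "phi0 q \<pi> u = lim (\<lambda>N. \<pi> ^ N * m (2 * N) u)"
    using q_pos by (simp add: phi0_def m_def log_coeff_eq_log_rec)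
  ultimately show ?thesis by (simp add: limI)
qed

lemma phi1_tendsto:
  assumes L: "level g n" and u: "absv u = g"
  shows "(\<lambda>N. \<pi> ^ N * m (2 * N - 1) u) \<longlonglongrightarrow> phi1 q \<pi> u"
proof -
  note g = levelD[OF L]
  obtain l where l: "(\<lambda>N. \<pi> ^ N * m (2 * N - 1) u) \<longlonglongrightarrow> l"
  proof (rule nonarch_convergent[OF power_q_tendsto_zero[OF g(1,2)] _ power_q_decseq[OF g(1,2) growth_nonneg[OF g(1)]]])
    \<comment> \<open>Here \<open>N\<close> is positive, so the truncated index
      \<open>2 * N - 1\<close> is the true one.\<close>
    fix N assume N: "Suc n \<le> N"
    then have e: "2 * Suc N - 1 = Suc (2 * N)" "Suc (2 * N - 1) = 2 * N" by auto
    have s: "\<pi> * m (Suc (2 * N)) u = u ^ (q ^ (2 * N)) * m (2 * N) u + m (2 * N - 1) u"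
      using m_Suc_Suc[of "2 * N - 1" u] unfolding e(2) .
    have "\<pi> ^ Suc N * m (2 * Suc N - 1) u = \<pi> ^ N * (\<pi> * m (Suc (2 * N)) u)" unfolding e(1) by simp
    also have "\<dots> = \<pi> ^ N * (u ^ (q ^ (2 * N)) * m (2 * N) u) + \<pi> ^ N * m (2 * N - 1) u"
      unfolding s by (simp add: algebra_simps)
    finally have "\<pi> ^ Suc N * m (2 * Suc N - 1) u - \<pi> ^ N * m (2 * N - 1) u =
        \<pi> ^ N * (u ^ (q ^ (2 * N)) * m (2 * N) u)" by simp
    then show "absv (\<pi> ^ Suc N * m (2 * Suc N - 1) u - \<pi> ^ N * m (2 * N - 1) u) \<le> growth g n * g ^ (q ^ N)"
      using period_step_le[OF L u, of "2 * N" N] N by simp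
  qed
  moreover have "phi1 q \<pi> u = lim (\<lambda>N. \<pi> ^ N * m (2 * N - 1) u)"
    using q_pos by (simp add: phi1_def m_def log_coeff_eq_log_rec)
  ultimately show ?thesis by (simp add: limI)
qed

text \<open>Along the indices of the parity of \<open>Suc n\<close> the scaled continuants have
  constant nonzero size. They converge to \<open>phi0\<close> or \<open>phi1\<close> according to
  this parity.\<close>

lemma phi_nonzero:
  assumes L: "level g n" and u: "absv u = g"
  shows "(phi0 q \<pi> u, phi1 q \<pi> u) \<noteq> (0, 0)"
proof -
  note g = levelD[OF L]
  have lim_nz: "l \<noteq> 0" if X: "X \<longlonglongrightarrow> l" and c: "\<And>i. absv (X (M + i)) = c" and "0 < c" for X and l :: 'c and M c
  proof -
    have "(\<lambda>i. absv (X (i + M))) \<longlonglongrightarrow> absv l"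
      using LIMSEQ_ignore_initial_segment[OF tendsto_absv[OF X]] .
    then have "(\<lambda>i. c) \<longlonglongrightarrow> absv l" using c by (simp add: add.commute)
    then have "absv l = c" using LIMSEQ_unique tendsto_const by blast
    then show ?thesis using \<open>0 < c\<close> by auto
  qed
  have val: "absv (\<pi> ^ (M + i) * m (Suc n + 2 * i) u) = \<rho> ^ M * (g ^ D (Suc n) / \<rho> ^ Suc n)" for M i
    unfolding absv_mult absv_power absv_m_odd[OF L u] using rho by (simp add: power_add)
  have pos: "0 < \<rho> ^ M * (g ^ D (Suc n) / \<rho> ^ Suc n)" for M using rho g by simp
  show ?thesis
  proof (cases "even (Suc n)")
    case True
    then obtain M where M: "Suc n = 2 * M" by blast
    have "phi0 q \<pi> u \<noteq> 0"
    proof (rule lim_nz[OF phi0_tendsto[OF L u] _ pos])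
      fix i
      have "2 * (M + i) = Suc n + 2 * i" using M by simp
      then show "absv (\<pi> ^ (M + i) * m (2 * (M + i)) u) = \<rho> ^ M * (g ^ D (Suc n) / \<rho> ^ Suc n)"
        by (simp only: val)
    qed
    then show ?thesis by simp
  next
    case False
    then have "even (Suc (Suc n))" by simp
    then obtain M where M: "Suc (Suc n) = 2 * M" by (rule evenE)
    have "phi1 q \<pi> u \<noteq> 0"
    proof (rule lim_nz[OF phi1_tendsto[OF L u] _ pos])
      fix i
      have "2 * (M + i) - 1 = Suc n + 2 * i" using M by simp
      then show "absv (\<pi> ^ (M + i) * m (2 * (M + i) - 1) u) = \<rho> ^ M * (g ^ D (Suc n) / \<rho> ^ Suc n)"
        by (simp only: val)
    qed
    then show ?thesis by simp
  qed
qed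

section \<open>The determinant of the periods and its approximations\<close>

definition G_lim :: "'c \<Rightarrow> 'c \<Rightarrow> 'c" where
  "G_lim u v = phi1 q \<pi> u * phi0 q \<pi> v - phi0 q \<pi> u * phi1 q \<pi> v"

lemma period_map_eq_iff:
  assumes "level g n" "absv u = g" "absv v = g"
  shows "period_map q \<pi> u = period_map q \<pi> v \<longleftrightarrow> G_lim u v = 0"
  using proj_point_eq_iff[OF phi_nonzero[OF assms(1,2)] phi_nonzero[OF assms(1,3)]]
  by (auto simp: period_map_def G_lim_def mult.commute)

text \<open>A bound for term \<open>k\<close> of the sum \<open>G\<close>, hence by the ultrametric
  inequality also for the distance of \<open>G k\<close> from its limit.\<close>

definition tail :: "real \<Rightarrow> nat \<Rightarrow> nat \<Rightarrow> real" where
  "tail g n k = max (coef g n) (coef g (Suc n)) * g ^ (q ^ k)"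

lemma tail_tendsto_zero: "level g n \<Longrightarrow> tail g n \<longlonglongrightarrow> 0"
  using power_q_tendsto_zero levelD unfolding tail_def by blast

lemma tail_decseq: "level g n \<Longrightarrow> decseq (tail g n)"
  unfolding tail_def using levelD coef_pos
  by (intro power_q_decseq) (auto simp: le_max_iff_disj less_imp_le)

lemma G_step_le:
  assumes L: "level g n" and u: "absv u = g" and v: "absv v = g" and k: "n \<le> k"
  shows "absv (G (Suc k) u v - G k u v) \<le> tail g n k"
proof -
  have "G (Suc k) u v - G k u v = (-\<pi>) ^ k * m k u * m k v * (u ^ (q ^ k) - v ^ (q ^ k))"
    by (simp add: G_def)
  then have "absv (G (Suc k) u v - G k u v) = \<rho> ^ k * (absv (m k u) * absv (m k v)) * tau u v k"
    by (simp only: absv_mult absv_power absv_minus tau_def mult.assoc)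
  also have "\<dots> \<le> tail g n k"
    unfolding tail_def using coef_growth_bound[OF L u v k] tau_le[OF u v, of k] coef_pos[OF levelD(1)[OF L], of n]
    by (intro mult_mono) (auto simp: le_max_iff_disj)
  finally show ?thesis .
qed

text \<open>The step estimate gives convergence with an error bound, and the limit is identified
  along even indices.\<close>

lemma G_tendsto:
  assumes L: "level g n" and u: "absv u = g" and v: "absv v = g"
  shows "(\<lambda>k. G k u v) \<longlonglongrightarrow> G_lim u v" and "n \<le> k \<Longrightarrow> absv (G_lim u v - G k u v) \<le> tail g n k"
proof -
  obtain l where l: "(\<lambda>k. G k u v) \<longlonglongrightarrow> l" "\<And>k. n \<le> k \<Longrightarrow> absv (l - G k u v) \<le> tail g n k"
  proof (rule nonarch_convergent[OF tail_tendsto_zero[OF L] _ tail_decseq[OF L]])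
    show "absv (G (Suc k) u v - G k u v) \<le> tail g n k" if "n \<le> k" for k
      by (rule G_step_le[OF L u v that])
  qed (rule that)
  \<comment> \<open>For an even index the factor \<open>\<pi> ^ (2 * N)\<close> splits evenly
    between the two approximate periods.\<close>
  have "G (2 * N) u v = (\<pi> ^ N * m (2 * N - 1) u) * (\<pi> ^ N * m (2 * N) v) +
      - ((\<pi> ^ N * m (2 * N) u) * (\<pi> ^ N * m (2 * N - 1) v))" for N
  proof (cases N)
    case 0
    then show ?thesis by (simp add: G_def)
  next
    case (Suc N')
    then have e: "2 * N = Suc (2 * N - 1)" by simp
    have "(-\<pi>) ^ (2 * N) = \<pi> ^ N * \<pi> ^ N"
      by (simp add: power_mult power2_eq_square power_mult_distrib)
    moreover have "G (2 * N) u v = - ((-\<pi>) ^ (2 * N)) * (m (2 * N) u * m (2 * N - 1) v - m (2 * N - 1) u * m (2 * N) v)"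
      using G_wedge[of "2 * N - 1" u v] e by metis
    ultimately show ?thesis by (simp add: algebra_simps)
  qed
  moreover have "(\<lambda>N. (\<pi> ^ N * m (2 * N - 1) u) * (\<pi> ^ N * m (2 * N) v) +
      - ((\<pi> ^ N * m (2 * N) u) * (\<pi> ^ N * m (2 * N - 1) v))) \<longlonglongrightarrow>
      phi1 q \<pi> u * phi0 q \<pi> v + - (phi0 q \<pi> u * phi1 q \<pi> v)"
    by (intro tendsto_add_nonarch tendsto_minus_nonarch tendsto_mult_nonarch
        phi0_tendsto[OF L u] phi0_tendsto[OF L v] phi1_tendsto[OF L u] phi1_tendsto[OF L v])
  ultimately have "(\<lambda>N. G (2 * N) u v) \<longlonglongrightarrow> G_lim u v" by (simp add: G_lim_def)
  moreover have "(\<lambda>N. G (2 * N) u v) \<longlonglongrightarrow> l"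
    using LIMSEQ_subseq_LIMSEQ[OF l(1), of "\<lambda>N. 2 * N"] by (simp add: o_def strict_mono_def)
  ultimately have "l = G_lim u v" using LIMSEQ_unique by blast
  then show "(\<lambda>k. G k u v) \<longlonglongrightarrow> G_lim u v" "n \<le> k \<Longrightarrow> absv (G_lim u v - G k u v) \<le> tail g n k"
    using l by auto
qed

section \<open>Comparing the fibre with the zeros of one approximation\<close>

definition fibre :: "real \<Rightarrow> 'c \<Rightarrow> 'c set" where
  "fibre g v = {z. absv z = g \<and> G_lim z v = 0}"

lemma period_fibre_sphere:
  assumes "level g n" "absv v = g"
  shows "period_fibre q \<pi> v \<inter> disc_sphere g = fibre g v"
  using period_map_eq_iff[OF assms(1) _ assms(2)] levelD(2)[OF assms(1)]
  by (auto simp: period_fibre_def disc_sphere_def open_disc_def fibre_def)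

text \<open>Near the diagonal \<open>absv (G k z z')\<close> does not depend on \<open>k\<close>, so
  the isometry \<open>G_near\<close> survives in the limit.\<close>

lemma fibre_discrete:
  assumes L: "level g n" and v: "absv v = g" and z: "z \<in> fibre g v" "z' \<in> fibre g v"
    and less: "absv (z - z') < min g \<rho>"
  shows "z = z'"
proof -
  have g: "absv z = g" "absv z' = g" using z by (auto simp: fibre_def)
  have "G_lim z z' = 0"
    using z period_map_eq_iff[OF L g] period_map_eq_iff[OF L g(1) v] period_map_eq_iff[OF L g(2) v]
    by (simp add: fibre_def)
  then have "(\<lambda>k. absv (G k z z')) \<longlonglongrightarrow> 0"
    using tendsto_absv[OF G_tendsto(1)[OF L g]] by simp
  from LIMSEQ_ignore_initial_segment[OF this, of "Suc n"]
  have "(\<lambda>k. absv (z - z')) \<longlonglongrightarrow> 0"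
    using G_near[OF L g _ less] by simp
  then have "absv (z - z') = 0" using LIMSEQ_unique tendsto_const by blast
  then show ?thesis by simp
qed

lemma zeros_discrete:
  assumes L: "level g n" and v: "absv v = g" and k: "n < k"
    and z: "z \<in> zeros g k v" "z' \<in> zeros g k v" and less: "absv (z - z') < min g \<rho>"
  shows "z = z'"
proof -
  have g: "absv z = g" "absv z' = g" and G0: "G k z v = 0" "G k v z' = 0"
    using z G_swap[of k v z'] by (auto simp: zeros_def)
  have "absv (G k z z') = 0" using plucker_zero[OF L g v k G0(2)] G0(1) by simp
  then show ?thesis using G_near[OF L g k less] by simp
qed

lemma zeros_near:
  assumes L: "level g n" and v: "absv v = g" and z: "absv z = g" and k: "n < k"
    and e: "absv (G k z v) \<le> e" "e < min g \<rho>"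
  obtains z' where "z' \<in> zeros g k v" "absv (z' - z) \<le> e"
proof -
  obtain a A where A: "is_root_mset k v a A" using root_mset_exists[OF L v k] .
  have "0 \<le> e" using e(1) absv_nonneg[of "G k z v"] by linarith
  have "size (filter_mset (\<lambda>x. absv (x - z) \<le> e) A) = 1"
    by (rule one_root_near[OF L v z k A \<open>0 \<le> e\<close> e(2,1)])
  then have "filter_mset (\<lambda>x. absv (x - z) \<le> e) A \<noteq> {#}" by force
  then obtain x where x: "x \<in># filter_mset (\<lambda>x. absv (x - z) \<le> e) A" by blast
  then have "absv (x - z) < g" using e(2) by auto
  then have "absv x = g" by (rule absv_eq_of_near[OF z])
  then show thesis using x in_root_mset_iff[OF A] by (intro that[of x]) (auto simp: zeros_def)
qed

text \<open>A zero of one approximation is moved to a zero of the limit by a Cauchy sequence of zeros of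
  the following approximations.\<close>

lemma fibre_near:
  assumes L: "level g n" and v: "absv v = g" and k: "n < k" and small: "tail g n k < min g \<rho>"
    and z\<^sub>0: "z\<^sub>0 \<in> zeros g k v"
  obtains z where "z \<in> fibre g v" "absv (z - z\<^sub>0) \<le> tail g n k"
proof -
  have small': "tail g n (k + i) < min g \<rho>" for i
    using decseqD[OF tail_decseq[OF L], of k "k + i"] small by simp
  have "\<exists>y. \<forall>i. (y i \<in> zeros g (k + i) v \<and> (i = 0 \<longrightarrow> y i = z\<^sub>0)) \<and> absv (y (Suc i) - y i) \<le> tail g n (k + i)"
  proof (rule dependent_nat_choice)
    fix x i assume x: "x \<in> zeros g (k + i) v \<and> (i = 0 \<longrightarrow> x = z\<^sub>0)"
    then have xg: "absv x = g" and "G (k + i) x v = 0" by (auto simp: zeros_def)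
    then have "absv (G (Suc (k + i)) x v) \<le> tail g n (k + i)"
      using G_step_le[OF L xg v, of "k + i"] k by simp
    then obtain y where "y \<in> zeros g (Suc (k + i)) v" "absv (y - x) \<le> tail g n (k + i)"
      using zeros_near[OF L v xg _ _ small'] k by (metis less_SucI trans_less_add1)
    then show "\<exists>y. (y \<in> zeros g (k + Suc i) v \<and> (Suc i = 0 \<longrightarrow> y = z\<^sub>0)) \<and> absv (y - x) \<le> tail g n (k + i)"
      by auto
  qed (use z\<^sub>0 in auto)
  then obtain y where y: "\<And>i. y i \<in> zeros g (k + i) v" "y 0 = z\<^sub>0"
      "\<And>i. absv (y (Suc i) - y i) \<le> tail g n (k + i)" by metis
  have tail0: "(\<lambda>i. tail g n (k + i)) \<longlonglongrightarrow> 0"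
    using LIMSEQ_ignore_initial_segment[OF tail_tendsto_zero[OF L], of k] by (simp add: add.commute)
  have dec: "decseq (\<lambda>i. tail g n (k + i))"
    using tail_decseq[OF L] by (simp add: decseq_def)
  obtain z where z: "\<And>i. 0 \<le> i \<Longrightarrow> absv (z - y i) \<le> tail g n (k + i)"
    using nonarch_convergent[OF tail0 y(3) dec, of 0] by blast
  have yg: "absv (y i) = g" and Gy: "G (k + i) (y i) v = 0" for i using y(1)[of i] by (auto simp: zeros_def)
  have near: "absv (z - y i) < min g \<rho>" for i using z[of i] small'[of i] by simp
  have zg: "absv z = g" using absv_eq_of_near[OF yg[of 0]] near[of 0] by simp
  \<comment> \<open>Since \<open>y i\<close> is a zero, \<open>plucker_zero\<close> exchanges
    \<open>v\<close> for \<open>y i\<close>, and the isometry turns the value into a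
    distance.\<close>
  have "absv (G (k + i) z v) \<le> tail g n (k + i)" for i
  proof -
    have ni: "n < k + i" using k by simp
    have "absv (G (k + i) z v) = absv (G (k + i) z (y i))"
      by (rule plucker_zero[OF L zg v yg ni Gy])
    also have "\<dots> = absv (z - y i)" by (rule G_near[OF L zg yg ni near])
    finally show ?thesis using z[of i] by simp
  qed
  then have "(\<lambda>i. G (k + i) z v) \<longlonglongrightarrow> 0" using tail0 by (intro tendsto_absvI[of "\<lambda>i. tail g n (k + i)"]) auto
  moreover have "(\<lambda>i. G (k + i) z v) \<longlonglongrightarrow> G_lim z v"
    using LIMSEQ_ignore_initial_segment[OF G_tendsto(1)[OF L zg v], of k] by (simp add: add.commute)
  ultimately have "G_lim z v = 0" using LIMSEQ_unique by blast
  then show thesis using that[of z] zg z[of 0] y(2) by (simp add: fibre_def)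
qed

text \<open>Points on either side are at least \<open>min g \<rho>\<close> apart, more than they are
  displaced. Hence matching nearby points is bijective, and no distance from \<open>v\<close>
  changes.\<close>

lemma fibre_bij_zeros:
  assumes L: "level g n" and v: "absv v = g" and k: "n < k" and small: "tail g n k < min g \<rho>"
  obtains h where "bij_betw h (fibre g v) (zeros g k v)" "\<And>z. z \<in> fibre g v \<Longrightarrow> absv (h z - v) = absv (z - v)"
proof -
  have "\<forall>z\<in>fibre g v. \<exists>z'. z' \<in> zeros g k v \<and> absv (z' - z) \<le> tail g n k"
  proof
    fix z assume "z \<in> fibre g v"
    then have zg: "absv z = g" and "G_lim z v = 0" by (auto simp: fibre_def)
    then have "absv (G k z v) \<le> tail g n k" using G_tendsto(2)[OF L zg v, of k] k by simp
    then show "\<exists>z'. z' \<in> zeros g k v \<and> absv (z' - z) \<le> tail g n k"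
      using zeros_near[OF L v zg k _ small] by metis
  qed
  then obtain h where h: "\<And>z. z \<in> fibre g v \<Longrightarrow> h z \<in> zeros g k v" "\<And>z. z \<in> fibre g v \<Longrightarrow> absv (h z - z) \<le> tail g n k"
    using bchoice[of "fibre g v" "\<lambda>z z'. z' \<in> zeros g k v \<and> absv (z' - z) \<le> tail g n k"] by blast
  have "bij_betw h (fibre g v) (zeros g k v)"
  proof (rule bij_betwI')
    fix x y assume xy: "x \<in> fibre g v" "y \<in> fibre g v"
    show "h x = h y \<longleftrightarrow> x = y"
    proof
      assume "h x = h y"
      then have "absv (x - y) \<le> max (absv (h y - y)) (absv (h x - x))"
        using absv_diff_le[of "h y - y" "h x - x"] by simp
      then have "absv (x - y) < min g \<rho>" using h(2)[OF xy(1)] h(2)[OF xy(2)] small by linarith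
      then show "x = y" by (rule fibre_discrete[OF L v xy])
    qed simp
  next
    fix z' assume z': "z' \<in> zeros g k v"
    then obtain z where z: "z \<in> fibre g v" "absv (z - z') \<le> tail g n k"
      using fibre_near[OF L v k small] by metis
    have "absv (h z - z') \<le> max (absv (h z - z)) (absv (z - z'))"
      using absv_add[of "h z - z" "z - z'"] by simp
    then have "absv (h z - z') < min g \<rho>" using h(2)[OF z(1)] z(2) small by linarith
    then have "h z = z'" by (rule zeros_discrete[OF L v k h(1)[OF z(1)] z'])
    then show "\<exists>z\<in>fibre g v. z' = h z" using z(1) by blast
  qed (rule h(1))
  moreover have "absv (h z - v) = absv (z - v)" if z: "z \<in> fibre g v" for z
  proof (cases "z = v")
    case True
    have "v \<in> zeros g k v" using v by (simp add: zeros_def)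
    moreover have "absv (h z - v) < min g \<rho>" using h(2)[OF z] True small by simp
    ultimately show ?thesis using zeros_discrete[OF L v k h(1)[OF z]] True by simp
  next
    case False
    have "v \<in> fibre g v" using v by (simp add: fibre_def G_lim_def)
    then have "\<not> absv (z - v) < min g \<rho>" using fibre_discrete[OF L v z] False by blast
    then have "absv (h z - z) < absv (z - v)" using h(2)[OF z] small by linarith
    then show ?thesis using absv_add_eq_right[of "h z - z" "z - v"] by simp
  qed
  ultimately show thesis by (rule that)
qed

lemma tail_small:
  assumes L: "level g n"
  obtains k\<^sub>0 where "n < k\<^sub>0" "\<And>k. k\<^sub>0 \<le> k \<Longrightarrow> tail g n k < min g \<rho>"
proof -
  have "0 < min g \<rho>" using levelD[OF L] rho by simp
  from order_tendstoD(2)[OF tail_tendsto_zero[OF L] this]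
  obtain N where N: "\<And>k. N \<le> k \<Longrightarrow> tail g n k < min g \<rho>"
    unfolding eventually_sequentially by blast
  show thesis by (rule that[of "max N (Suc n)"]) (simp, intro N, simp)
qed

lemma fibre_structure:
  assumes L: "level g n" and v: "absv v = g"
  shows "finite (fibre g v)" and "v \<in> fibre g v"
    and "j \<le> n \<Longrightarrow> card {z \<in> fibre g v. absv (z - v) \<le> radius g j} = q ^ j"
    and "j \<le> n \<Longrightarrow> z \<in> fibre g v \<Longrightarrow> radius g j < absv (z - v) \<Longrightarrow>
      (if j < n then radius g (Suc j) else g) \<le> absv (z - v)"
    and "g ^ ((q + 1) * q ^ n) < \<rho> \<Longrightarrow> z \<in> fibre g v \<Longrightarrow> absv (z - v) < g"
    and "g ^ ((q + 1) * q ^ n) = \<rho> \<Longrightarrow> card (fibre g v) = q ^ n + q ^ Suc n"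
proof -
  obtain k\<^sub>0 where k0: "n < k\<^sub>0" "\<And>k. k\<^sub>0 \<le> k \<Longrightarrow> tail g n k < min g \<rho>"
    using tail_small[OF L] by blast
  \<comment> \<open>Large enough for the comparison, and of the form that
    \<open>card_zeros_boundary\<close> demands.\<close>
  define k where "k = Suc n + 2 * Suc k\<^sub>0"
  have k: "n < k" "tail g n k < min g \<rho>" using k0 by (auto simp: k_def)
  obtain h where h: "bij_betw h (fibre g v) (zeros g k v)" "\<And>z. z \<in> fibre g v \<Longrightarrow> absv (h z - v) = absv (z - v)"
    using fibre_bij_zeros[OF L v k] by blast
  have hz: "h z \<in> zeros g k v" if "z \<in> fibre g v" for z using h(1) that by (auto simp: bij_betw_def)
  show "finite (fibre g v)" using bij_betw_finite[OF h(1)] finite_zeros[OF L v k(1)] by simp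
  show "v \<in> fibre g v" using v by (simp add: fibre_def G_lim_def)
  show "(if j < n then radius g (Suc j) else g) \<le> absv (z - v)"
    if "j \<le> n" "z \<in> fibre g v" "radius g j < absv (z - v)"
    using zeros_region(2)[OF L v k(1) that(1) hz[OF that(2)]] h(2)[OF that(2)] that(3) by simp
  show "absv (z - v) < g" if "g ^ ((q + 1) * q ^ n) < \<rho>" "z \<in> fibre g v"
    using zeros_dist_less[OF L v k(1) that(1) hz[OF that(2)]] h(2)[OF that(2)] by simp
  show "card (fibre g v) = q ^ n + q ^ Suc n" if "g ^ ((q + 1) * q ^ n) = \<rho>"
    using bij_betw_same_card[OF h(1)] card_zeros_boundary[OF L v that k_def] by simp
  show "card {z \<in> fibre g v. absv (z - v) \<le> radius g j} = q ^ j" if "j \<le> n"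
  proof -
    have "h ` {z \<in> fibre g v. absv (z - v) \<le> radius g j} = {z \<in> zeros g k v. absv (z - v) \<le> radius g j}"
    proof (intro equalityI subsetI)
      fix y assume "y \<in> {z \<in> zeros g k v. absv (z - v) \<le> radius g j}"
      moreover from this obtain z where "z \<in> fibre g v" "y = h z"
        using bij_betw_imp_surj_on[OF h(1)] by blast
      ultimately show "y \<in> h ` {z \<in> fibre g v. absv (z - v) \<le> radius g j}" using h(2)[of z] by simp
    qed (use hz h(2) in force)
    moreover have "inj_on h {z \<in> fibre g v. absv (z - v) \<le> radius g j}"
      by (rule inj_on_subset[OF bij_betw_imp_inj_on[OF h(1)]]) blast
    ultimately show ?thesis
      using zeros_region(1)[OF L v k(1) that] by (simp add: card_image[symmetric])
  qed
qed

end

section \<open>Enumerating the fibre\<close>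

text \<open>The enumeration of \<open>L n\<close> is prolonged by an arbitrary bijection from the
  next block of indices onto the new layer.\<close>

lemma enumerate_filtration:
  fixes L :: "nat \<Rightarrow> 'a set"
  assumes "L 0 = {v}" "N 0 = 1"
    and "\<And>j. j \<le> n \<Longrightarrow> finite (L j) \<and> card (L j) = N j"
    and "\<And>j. j < n \<Longrightarrow> L j \<subseteq> L (Suc j)"
  shows "\<exists>u. bij_betw u {1..N n} (L n) \<and> u 1 = v \<and>
    (\<forall>j i. j < n \<and> N j < i \<and> i \<le> N (Suc j) \<longrightarrow> u i \<in> L (Suc j) - L j)"
  using assms(3,4)
proof (induction n)
  case 0
  show ?case using assms(1,2) by (intro exI[of _ "\<lambda>_. v"]) (auto simp: bij_betw_def)
next
  case (Suc n)
  then obtain u where u: "bij_betw u {1..N n} (L n)" "u 1 = v"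
    "\<And>j i. j < n \<Longrightarrow> N j < i \<Longrightarrow> i \<le> N (Suc j) \<Longrightarrow> u i \<in> L (Suc j) - L j"
    by (metis less_Suc_eq le_SucI)
  have sub: "L n \<subseteq> L (Suc n)" and fin: "finite (L (Suc n))" "finite (L n)"
    and card: "card (L (Suc n)) = N (Suc n)" "card (L n) = N n"
    using Suc.prems by auto
  have "N n \<le> N (Suc n)" using card_mono[OF fin(1) sub] card by simp
  have mono: "N j \<le> N n" if "j \<le> n" for j
    using that
  proof (induction j rule: inc_induct)
    case (step i)
    have "N i \<le> N (Suc i)"
      using Suc.prems(1)[of i] Suc.prems(1)[of "Suc i"] Suc.prems(2)[of i] step card_mono[of "L (Suc i)" "L i"]
      by auto
    then show ?case using step by simp
  qed simp
  have "card {N n<..N (Suc n)} = card (L (Suc n) - L n)"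
    using card_Diff_subset[OF fin(2) sub] card by simp
  then obtain f where f: "bij_betw f {N n<..N (Suc n)} (L (Suc n) - L n)"
    using finite_same_card_bij fin by (metis finite_Diff finite_greaterThanAtMost)
  define w where "w i = (if i \<le> N n then u i else f i)" for i
  have "bij_betw w {1..N n} (L n)" using u(1) by (subst bij_betw_cong[of _ w u]) (auto simp: w_def)
  moreover have "bij_betw w {N n<..N (Suc n)} (L (Suc n) - L n)"
    using f by (subst bij_betw_cong[of _ w f]) (auto simp: w_def)
  ultimately have "bij_betw w ({1..N n} \<union> {N n<..N (Suc n)}) (L n \<union> (L (Suc n) - L n))"
    by (rule bij_betw_combine) auto
  moreover have "{1..N n} \<union> {N n<..N (Suc n)} = {1..N (Suc n)}" using \<open>N n \<le> N (Suc n)\<close> by auto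
  moreover have "L n \<union> (L (Suc n) - L n) = L (Suc n)" using sub by auto
  ultimately have "bij_betw w {1..N (Suc n)} (L (Suc n))" by simp
  moreover have "w 1 = v" using u(2) mono[of 0] assms(2) by (simp add: w_def)
  moreover have "w i \<in> L (Suc j) - L j" if "j < Suc n" "N j < i" "i \<le> N (Suc j)" for j i
  proof (cases "j = n")
    case True
    then show ?thesis using that f by (auto simp: w_def bij_betw_def)
  next
    case False
    then show ?thesis using that u(3)[of j i] mono[of "Suc j"] by (simp add: w_def)
  qed
  ultimately show ?case by blast
qed

section \<open>From real exponents to integer powers\<close>

lemma powr_inverse_eq_root: "0 < N \<Longrightarrow> 0 < x \<Longrightarrow> x powr (1 / real N) = root N x"
  by (simp add: root_powr_inverse)

lemma less_root_iff:
  assumes "0 < N" "0 \<le> x" "0 \<le> (y::real)"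
  shows "x < root N y \<longleftrightarrow> x ^ N < y"
  using assms real_root_less_iff[of N "x ^ N" y] by (simp add: real_root_power_cancel)

lemma eq_root_iff:
  assumes "0 < N" "0 \<le> x" "0 \<le> (y::real)"
  shows "x = root N y \<longleftrightarrow> x ^ N = y"
  using assms by (metis real_root_pow_pos2 real_root_power_cancel)

context universal_deformation_alg_closed
begin

lemma less_powr_iff:
  assumes "0 < g"
  shows "g ^ (q ^ n) < \<rho> powr (1 / (real q + 1)) \<longleftrightarrow> g ^ ((q + 1) * q ^ n) < \<rho>"
proof -
  have "\<rho> powr (1 / (real q + 1)) = root (q + 1) \<rho>"
    using powr_inverse_eq_root[of "q + 1" \<rho>] rho by (simp add: add.commute)
  then show ?thesis
    using less_root_iff[of "q + 1" "g ^ (q ^ n)" \<rho>] assms rho by (simp add: mult.commute power_add flip: power_mult)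
qed

lemma eq_powr_iff:
  assumes "0 < g"
  shows "g = \<rho> powr (1 / (real q ^ s + real q ^ (s + 1))) \<longleftrightarrow> g ^ ((q + 1) * q ^ s) = \<rho>"
proof -
  have "\<rho> powr (1 / (real q ^ s + real q ^ (s + 1))) = root ((q + 1) * q ^ s) \<rho>"
    using powr_inverse_eq_root[of "(q + 1) * q ^ s" \<rho>] rho q_pos by (simp add: algebra_simps)
  then show ?thesis
    using eq_root_iff[of "(q + 1) * q ^ s" g \<rho>] assms rho q_pos by simp
qed

lemma radius_eq_powr:
  assumes "0 < g" "1 \<le> j"
  shows "radius g j = (\<rho> / g ^ (2 * q ^ (j - 1))) powr (1 / (real q ^ j - real q ^ (j - 1)))"
proof -
  have less: "q ^ (j - 1) < q ^ j" using assms q_pos by (intro power_strict_increasing) auto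
  have "radius g j = root (q ^ j - q ^ (j - 1)) (\<rho> / g ^ (2 * q ^ (j - 1)))"
    using assms(2) by (simp add: radius_def)
  also have "\<dots> = (\<rho> / g ^ (2 * q ^ (j - 1))) powr (1 / real (q ^ j - q ^ (j - 1)))"
    by (rule powr_inverse_eq_root[symmetric]) (use less assms(1) rho(1) in simp_all)
  also have "real (q ^ j - q ^ (j - 1)) = real q ^ j - real q ^ (j - 1)"
    using less by (simp only: of_nat_diff less_imp_le of_nat_power)
  finally show ?thesis .
qed

lemma radius_Suc_boundary:
  assumes "0 < g" "g ^ ((q + 1) * q ^ s) = \<rho>"
  shows "radius g (Suc s) = g"
  using radius_compare[of g g s] power_level[of g s] assms by auto

text \<open>The gap between consecutive critical radii, in which the fibre has no points, turns the
  two inequalities for a layer into an equality.\<close>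

lemma fibre_filtration:
  assumes L: "level g n" and v: "absv v = g"
  defines "F \<equiv> \<lambda>j. {z \<in> fibre g v. absv (z - v) \<le> radius g j}"
  shows "F 0 = {v}" and "\<And>j. j \<le> n \<Longrightarrow> finite (F j) \<and> card (F j) = q ^ j"
    and "\<And>j. F j \<subseteq> F (Suc j)"
    and "\<And>j z. j < n \<Longrightarrow> z \<in> F (Suc j) - F j \<Longrightarrow> absv (z - v) = radius g (Suc j)"
proof -
  note S = fibre_structure[OF L v]
  show "F 0 = {v}" using S(2) by (auto simp: F_def radius_def)
  show "finite (F j) \<and> card (F j) = q ^ j" if "j \<le> n" for j
    using S(1) S(3)[OF that] by (simp add: F_def)
  show "F j \<subseteq> F (Suc j)" for j
    using radius_strict_mono[OF levelD(1,2)[OF L], of j] by (auto simp: F_def)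
  show "absv (z - v) = radius g (Suc j)" if "j < n" "z \<in> F (Suc j) - F j" for j z
    using S(4)[of j z] that by (auto simp: F_def)
qed

lemma enumerate_fibre_generic:
  assumes L: "level g n" and v: "absv v = g" and strict: "g ^ ((q + 1) * q ^ n) < \<rho>"
  shows "\<exists>u. bij_betw u {1..q ^ n} (fibre g v) \<and> u 1 = v \<and>
    (\<forall>j i. 1 \<le> j \<and> j \<le> n \<and> q ^ (j - 1) < i \<and> i \<le> q ^ j \<longrightarrow> absv (u i - v) = radius g j)"
proof -
  note S = fibre_structure[OF L v] and T = fibre_filtration[OF L v]
  define F where "F j = {z \<in> fibre g v. absv (z - v) \<le> radius g j}" for j
  have "\<exists>u. bij_betw u {1..q ^ n} (F n) \<and> u 1 = v \<and>
    (\<forall>j i. j < n \<and> q ^ j < i \<and> i \<le> q ^ Suc j \<longrightarrow> u i \<in> F (Suc j) - F j)"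
  proof (rule enumerate_filtration[where L = F and N = "\<lambda>j. q ^ j"])
    show "F 0 = {v}" unfolding F_def by (rule T(1))
    show "finite (F j) \<and> card (F j) = q ^ j" if "j \<le> n" for j
      unfolding F_def by (rule T(2)[OF that])
    show "F j \<subseteq> F (Suc j)" for j unfolding F_def by (rule T(3))
  qed simp
  then obtain u where u: "bij_betw u {1..q ^ n} (F n)" "u 1 = v"
    "\<And>j i. j < n \<Longrightarrow> q ^ j < i \<Longrightarrow> i \<le> q ^ Suc j \<Longrightarrow> u i \<in> F (Suc j) - F j" by blast
  \<comment> \<open>A point beyond the last radius would have distance at least \<open>g\<close>,
    which strictness excludes.\<close>
  have "absv (z - v) \<le> radius g n" if "z \<in> fibre g v" for z
    using S(4)[of n z] S(5)[OF strict that] that by force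
  then have "F n = fibre g v" by (auto simp: F_def)
  moreover have "absv (u i - v) = radius g j" if "1 \<le> j" "j \<le> n" "q ^ (j - 1) < i" "i \<le> q ^ j" for i j
    using T(4)[of "j - 1" "u i"] u(3)[of "j - 1" i] that by (simp add: F_def)
  ultimately show ?thesis using u(1,2) by (intro exI[of _ u]) auto
qed

lemma enumerate_fibre_boundary:
  assumes L: "level g s" and v: "absv v = g" and eq: "g ^ ((q + 1) * q ^ s) = \<rho>"
  shows "\<exists>u. bij_betw u {1..q ^ s + q ^ (s + 1)} (fibre g v) \<and> u 1 = v \<and>
    (\<forall>j i. 1 \<le> j \<and> j \<le> s \<and> q ^ (j - 1) < i \<and> i \<le> q ^ j \<longrightarrow> absv (u i - v) = radius g j) \<and>
    (\<forall>i. q ^ s < i \<and> i \<le> q ^ s + q ^ (s + 1) \<longrightarrow> absv (u i - v) = g)"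
proof -
  note S = fibre_structure[OF L v] and T = fibre_filtration[OF L v]
  define F where "F j = {z \<in> fibre g v. absv (z - v) \<le> radius g j}" for j
  \<comment> \<open>One further layer, the points at distance \<open>g\<close>, is appended to the
    filtration by discs.\<close>
  define H where "H j = (if j \<le> s then F j else fibre g v)" for j
  define N where "N j = (if j \<le> s then q ^ j else q ^ s + q ^ (s + 1))" for j
  have "\<exists>u. bij_betw u {1..N (Suc s)} (H (Suc s)) \<and> u 1 = v \<and>
    (\<forall>j i. j < Suc s \<and> N j < i \<and> i \<le> N (Suc j) \<longrightarrow> u i \<in> H (Suc j) - H j)"
  proof (rule enumerate_filtration[where L = H and N = N])
    show "H 0 = {v}" "N 0 = 1" using T(1) by (simp_all add: H_def N_def F_def)
    show "finite (H j) \<and> card (H j) = N j" if "j \<le> Suc s" for j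
      using T(2)[of j] S(1) S(6)[OF eq] by (simp add: H_def N_def F_def)
    show "H j \<subseteq> H (Suc j)" if "j < Suc s" for j
      using T(3)[of j] by (auto simp: H_def F_def)
  qed
  then obtain u where u: "bij_betw u {1..q ^ s + q ^ (s + 1)} (fibre g v)" "u 1 = v"
    "\<And>j i. j < Suc s \<Longrightarrow> N j < i \<Longrightarrow> i \<le> N (Suc j) \<Longrightarrow> u i \<in> H (Suc j) - H j"
    by (auto simp: N_def H_def)
  have "absv (u i - v) = radius g j" if "1 \<le> j" "j \<le> s" "q ^ (j - 1) < i" "i \<le> q ^ j" for i j
    using T(4)[of "j - 1" "u i"] u(3)[of "j - 1" i] that by (simp add: F_def H_def N_def)
  moreover have "absv (u i - v) = g" if "q ^ s < i" "i \<le> q ^ s + q ^ (s + 1)" for i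
  proof -
    have "u i \<in> fibre g v - F s" using u(3)[of s i] that by (simp add: H_def N_def)
    then have z: "u i \<in> fibre g v" "radius g s < absv (u i - v)" by (auto simp: F_def)
    have "g \<le> absv (u i - v)" using S(4)[OF order_refl z] by simp
    moreover have "absv (u i - v) \<le> g"
      using absv_diff_le[of "u i" v] z(1) v by (simp add: fibre_def)
    ultimately show ?thesis by simp
  qed
  ultimately show ?thesis using u(1,2) by (intro exI[of _ u]) auto
qed

end

text \<open>In \<open>i * (p ^ e choose i) = p ^ e * (p ^ e - 1 choose (i - 1))\<close> a binomial
  coefficient prime to \<open>p\<close> would force \<open>p ^ e\<close> to divide
  \<open>i\<close>.\<close>

lemma prime_dvd_choose_prime_power:
  assumes "prime (p::nat)" "0 < i" "i < p ^ e"
  shows "p dvd (p ^ e choose i)"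
proof (rule ccontr)
  assume "\<not> p dvd (p ^ e choose i)"
  then have cop: "coprime (p ^ e) (p ^ e choose i)"
    using assms(1) by (simp add: prime_imp_coprime)
  obtain i' N' where i': "i = Suc i'" "p ^ e = Suc N'" using assms by (metis less_nat_zero_code not0_implies_Suc)
  have "Suc i' * (Suc N' choose Suc i') = Suc N' * (N' choose i')"
    by (rule Suc_times_binomial)
  then have "p ^ e dvd i * (p ^ e choose i)" unfolding i' by (metis dvd_triv_left)
  then have "p ^ e dvd i" using cop by (simp add: coprime_dvd_mult_left_iff)
  then show False using assms by (auto dest: dvd_imp_le)
qed

theorem mainTheorem1:
  fixes p q :: nat
    and K :: "'c::{nonarch_field, complete_space, alg_closed_field} set"
    and \<pi> u\<^sub>1 :: 'c
    and \<gamma> :: real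
  assumes "p_adic_complex TYPE('c) p"
    and "finite_extension K"
    and "uniformizer K \<pi>"
    and "q = card (residue_field K)"
    and "0 < \<gamma>" and "\<gamma> < 1"
    and "u\<^sub>1 \<in> disc_sphere \<gamma>"
  shows
    "(\<forall>n. (\<nexists>s::nat. \<gamma> = absv \<pi> powr (1 / (real q ^ s + real q ^ (s + 1)))) \<and>
          n = (LEAST n. \<gamma> ^ (q ^ n) < absv \<pi> powr (1 / (real q + 1))) \<longrightarrow>
        (\<exists>u :: nat \<Rightarrow> 'c.
           bij_betw u {1..q ^ n} (period_fibre q \<pi> u\<^sub>1 \<inter> disc_sphere \<gamma>) \<and> u 1 = u\<^sub>1 \<and>
           (\<forall>j i. 1 \<le> j \<and> j \<le> n \<and> q ^ (j - 1) < i \<and> i \<le> q ^ j \<longrightarrow>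
              absv (u i - u\<^sub>1) =
                (absv \<pi> / \<gamma> ^ (2 * q ^ (j - 1))) powr (1 / (real q ^ j - real q ^ (j - 1))))))
     \<and>
     (\<forall>s::nat. \<gamma> = absv \<pi> powr (1 / (real q ^ s + real q ^ (s + 1))) \<longrightarrow>
        (\<exists>u :: nat \<Rightarrow> 'c.
           bij_betw u {1..q ^ s + q ^ (s + 1)} (period_fibre q \<pi> u\<^sub>1 \<inter> disc_sphere \<gamma>) \<and> u 1 = u\<^sub>1 \<and>
           (\<forall>j i. 1 \<le> j \<and> j \<le> s \<and> q ^ (j - 1) < i \<and> i \<le> q ^ j \<longrightarrow>
              absv (u i - u\<^sub>1) =
                (absv \<pi> / \<gamma> ^ (2 * q ^ (j - 1))) powr (1 / (real q ^ j - real q ^ (j - 1)))) \<and>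
           (\<forall>i. q ^ s < i \<and> i \<le> q ^ s + q ^ (s + 1) \<longrightarrow> absv (u i - u\<^sub>1) = \<gamma>)) \<and>
        \<gamma> = (absv \<pi> / \<gamma> ^ (2 * q ^ s)) powr (1 / (real q ^ (s + 1) - real q ^ s)))"
proof -
  have p: "prime p" "absv (of_nat p :: 'c) < 1"
    using assms(1) by (auto simp: p_adic_complex_def)
  obtain e where e: "0 < e" "q = p ^ e"
    using residue_field_card[OF p assms(2)] assms(4) by metis
  have Q: "Q_p \<subseteq> K" using assms(2) by (simp add: finite_extension_def)
  have max: "max_ideal K = (\<lambda>a. \<pi> * a) ` int_ring K" and "\<pi> \<in> K"
    using assms(3) by (auto simp: uniformizer_def)
  have "1 \<in> int_ring K" using Q Q_p_of_rat[of "1::'c"] by (auto simp: int_ring_def)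
  then have "\<pi> \<in> max_ideal K" unfolding max by force
  then have pi_less: "absv \<pi> < 1" by (simp add: max_ideal_def)
  \<comment> \<open>As \<open>p\<close> lies in the ideal generated by \<open>\<pi>\<close>, this
    gives both \<open>\<pi> \<noteq> 0\<close> and \<open>absv p \<le> absv \<pi>\<close>.\<close>
  have "of_nat p \<in> max_ideal K"
    using p Q Q_p_of_rat[of "of_nat p :: 'c"] by (auto simp: max_ideal_def)
  then obtain a where a: "of_nat p = \<pi> * a" "absv a \<le> 1" unfolding max by (auto simp: int_ring_def)
  have "(of_nat p :: 'c) \<noteq> 0" using p by (auto simp: prime_gt_0_nat)
  then have pi_nz: "\<pi> \<noteq> 0" using a by auto
  have p_le: "absv (of_nat p :: 'c) \<le> absv \<pi>"
    unfolding a absv_mult using a(2) by (intro mult_right_le_one_le) auto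
  interpret universal_deformation_alg_closed q \<pi>
  proof
    have "2 ^ 1 \<le> p ^ e"
      using prime_ge_2_nat[OF p(1)] e(1) by (metis One_nat_def Suc_leI power_mono power_increasing
          le_trans one_le_numeral zero_le)
    then show "2 \<le> q" using e by simp
    fix i assume i: "0 < i" "i < q"
    then obtain b where "q choose i = p * b"
      using prime_dvd_choose_prime_power[OF p(1), of i e] e by blast
    then have "absv (of_nat (q choose i) :: 'c) = absv (of_nat p :: 'c) * absv (of_nat b :: 'c)"
      by (simp add: absv_mult)
    also have "\<dots> \<le> absv (of_nat p :: 'c)"
      using absv_of_nat_le_1[of b, where 'a = 'c] by (intro mult_right_le_one_le) auto
    finally show "absv (of_nat (q choose i) :: 'c) \<le> absv \<pi>" using p_le by simp
  qed (use pi_nz pi_less in auto)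
  have u1: "absv u\<^sub>1 = \<gamma>" using assms(7) by (simp add: disc_sphere_def)
  note \<gamma> = assms(5,6)
  show ?thesis
  proof (intro conjI allI impI)
    fix n
    assume "(\<nexists>s::nat. \<gamma> = absv \<pi> powr (1 / (real q ^ s + real q ^ (s + 1)))) \<and>
          n = (LEAST n. \<gamma> ^ (q ^ n) < absv \<pi> powr (1 / (real q + 1)))"
    then have no: "\<And>s. \<gamma> ^ ((q + 1) * q ^ s) \<noteq> \<rho>" and n: "n = (LEAST n. \<gamma> ^ ((q + 1) * q ^ n) < \<rho>)"
      using eq_powr_iff[OF \<gamma>(1)] less_powr_iff[OF \<gamma>(1)] by auto
    \<comment> \<open>The least index exists because these powers tend to 0.\<close>
    have "0 < \<gamma> ^ (q + 1)" "\<gamma> ^ (q + 1) < 1"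
      using \<gamma> by (simp_all only: zero_less_power power_less_one_iff less_imp_le) simp
    from order_tendstoD(2)[OF power_q_tendsto_zero[OF this, of 1] rho(1)]
    obtain k where "\<gamma> ^ ((q + 1) * q ^ k) < \<rho>"
      unfolding eventually_sequentially power_mult by auto
    then have strict: "\<gamma> ^ ((q + 1) * q ^ n) < \<rho>" unfolding n by (rule LeastI)
    \<comment> \<open>Minimality gives the weak inequality; equality is ruled out because
      \<open>\<gamma>\<close> is not exceptional.\<close>
    have "\<rho> < \<gamma> ^ ((q + 1) * q ^ j)" if "j < n" for j
      using not_less_Least[of j] that no[of j] unfolding n by fastforce
    then have L: "level \<gamma> n" using \<gamma> strict by (simp add: level_def)
    show "\<exists>u. bij_betw u {1..q ^ n} (period_fibre q \<pi> u\<^sub>1 \<inter> disc_sphere \<gamma>) \<and> u 1 = u\<^sub>1 \<and>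
           (\<forall>j i. 1 \<le> j \<and> j \<le> n \<and> q ^ (j - 1) < i \<and> i \<le> q ^ j \<longrightarrow>
              absv (u i - u\<^sub>1) =
                (absv \<pi> / \<gamma> ^ (2 * q ^ (j - 1))) powr (1 / (real q ^ j - real q ^ (j - 1))))"
      using enumerate_fibre_generic[OF L u1 strict]
      by (simp only: period_fibre_sphere[OF L u1] radius_eq_powr[OF \<gamma>(1)] cong: conj_cong imp_cong)
  next
    fix s :: nat
    assume "\<gamma> = absv \<pi> powr (1 / (real q ^ s + real q ^ (s + 1)))"
    then have eq: "\<gamma> ^ ((q + 1) * q ^ s) = \<rho>" using eq_powr_iff[OF \<gamma>(1)] by blast
    have "\<rho> < \<gamma> ^ ((q + 1) * q ^ j)" if "j < s" for j
      unfolding eq[symmetric] using \<gamma> that q_pos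
      by (intro power_strict_decreasing mult_strict_left_mono power_strict_increasing) auto
    then have L: "level \<gamma> s" using \<gamma> eq by (simp add: level_def)
    show "\<exists>u. bij_betw u {1..q ^ s + q ^ (s + 1)} (period_fibre q \<pi> u\<^sub>1 \<inter> disc_sphere \<gamma>) \<and> u 1 = u\<^sub>1 \<and>
           (\<forall>j i. 1 \<le> j \<and> j \<le> s \<and> q ^ (j - 1) < i \<and> i \<le> q ^ j \<longrightarrow>
              absv (u i - u\<^sub>1) =
                (absv \<pi> / \<gamma> ^ (2 * q ^ (j - 1))) powr (1 / (real q ^ j - real q ^ (j - 1)))) \<and>
           (\<forall>i. q ^ s < i \<and> i \<le> q ^ s + q ^ (s + 1) \<longrightarrow> absv (u i - u\<^sub>1) = \<gamma>)"
      using enumerate_fibre_boundary[OF L u1 eq]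
      by (simp only: period_fibre_sphere[OF L u1] radius_eq_powr[OF \<gamma>(1)] cong: conj_cong imp_cong)
    show "\<gamma> = (absv \<pi> / \<gamma> ^ (2 * q ^ s)) powr (1 / (real q ^ (s + 1) - real q ^ s))"
      using radius_Suc_boundary[OF \<gamma>(1) eq] radius_eq_powr[OF \<gamma>(1), of "Suc s"] by simp
  qed
qed

end
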